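(* It is undecidable, given a finite set of rotations of the $3$-sphere $S^3\subset\mathbb{R}^4$, each specified by a pair $(a,b)$ of unit quaternions with rational coefficients acting by $q\mapsto a\,q\,b^{-1}$, whether the semigroup generated by these rotations (under composition) is a group.
   Context: A point $x=(x_1,x_2,x_3,x_4)$ of the unit $3$-sphere is identified with the unit quaternion $x_1+x_2i+x_3j+x_4k$; a pair $(a,b)$ of unit quaternions determines the rotation $q\mapsto aqb^{-1}$ of $S^3$. *)

theory Defs
  imports Complex_Main "HOL-Library.Nat_Bijection" "HOL-Algebra.Group"
begin

datatype recf =
    Z
  | Sc
  | Id nat nat
  | Cn nat recf "recf list"
  | Pr nat recf recf
  | Mn nat recf

inductive eval_rf :: "recf \<Rightarrow> nat list \<Rightarrow> nat \<Rightarrow> bool" where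
  zero: "eval_rf Z xs 0"
| suc: "eval_rf Sc [x] (Suc x)"
| proj: "\<lbrakk>length xs = n; i < n\<rbrakk> \<Longrightarrow> eval_rf (Id n i) xs (xs ! i)"
| comp: "\<lbrakk>length xs = n; list_all2 (\<lambda>g y. eval_rf g xs y) gs ys; eval_rf f ys z\<rbrakk>
          \<Longrightarrow> eval_rf (Cn n f gs) xs z"
| pr0: "\<lbrakk>length xs = n; eval_rf f xs y\<rbrakk> \<Longrightarrow> eval_rf (Pr n f g) (0 # xs) y"
| prS: "\<lbrakk>eval_rf (Pr n f g) (k # xs) y; eval_rf g (k # y # xs) z\<rbrakk>
          \<Longrightarrow> eval_rf (Pr n f g) (Suc k # xs) z"
| mn: "\<lbrakk>length xs = n; eval_rf f (y # xs) 0;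
         \<forall>u<y. \<exists>v. eval_rf f (u # xs) v \<and> v \<noteq> 0\<rbrakk>
          \<Longrightarrow> eval_rf (Mn n f) xs y"

definition decidable_problem :: "'i set \<Rightarrow> ('i \<Rightarrow> nat) \<Rightarrow> ('i \<Rightarrow> bool) \<Rightarrow> bool" where
  "decidable_problem Inst code P \<longleftrightarrow>
     (\<exists>f. \<forall>x\<in>Inst. eval_rf f [code x] (if P x then 1 else 0))"

type_synonym rquat = "rat \<times> rat \<times> rat \<times> rat"

definition rat_code :: "rat \<Rightarrow> nat" where
  "rat_code r = prod_encode (int_encode (fst (quotient_of r)), nat (snd (quotient_of r)))"

definition rquat_code :: "rquat \<Rightarrow> nat" where
  "rquat_code q = (case q of (a, b, c, d) \<Rightarrow>
      list_encode [rat_code a, rat_code b, rat_code c, rat_code d])"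

definition instance_code :: "(rquat \<times> rquat) list \<Rightarrow> nat" where
  "instance_code L = list_encode (map (\<lambda>(a, b). prod_encode (rquat_code a, rquat_code b)) L)"

definition unit_rquat :: "rquat \<Rightarrow> bool" where
  "unit_rquat q = (case q of (a, b, c, d) \<Rightarrow> a\<^sup>2 + b\<^sup>2 + c\<^sup>2 + d\<^sup>2 = 1)"

type_synonym quat = "real \<times> real \<times> real \<times> real"

definition qmult :: "quat \<Rightarrow> quat \<Rightarrow> quat" where
  "qmult p q = (case p of (a1, b1, c1, d1) \<Rightarrow> case q of (a2, b2, c2, d2) \<Rightarrow>
     (a1*a2 - b1*b2 - c1*c2 - d1*d2,
      a1*b2 + b1*a2 + c1*d2 - d1*c2,
      a1*c2 - b1*d2 + c1*a2 + d1*b2,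
      a1*d2 + b1*c2 - c1*b2 + d1*a2))"

definition qinv :: "quat \<Rightarrow> quat" where
  "qinv q = (case q of (a, b, c, d) \<Rightarrow>
     (let n = a\<^sup>2 + b\<^sup>2 + c\<^sup>2 + d\<^sup>2 in (a / n, - b / n, - c / n, - d / n)))"

definition quat_of_rquat :: "rquat \<Rightarrow> quat" where
  "quat_of_rquat q = (case q of (a, b, c, d) \<Rightarrow> (of_rat a, of_rat b, of_rat c, of_rat d))"

definition rotation :: "rquat \<Rightarrow> rquat \<Rightarrow> quat \<Rightarrow> quat" where
  "rotation a b = (\<lambda>q. qmult (qmult (quat_of_rquat a) q) (qinv (quat_of_rquat b)))"

inductive_set gen_semigroup :: "('a \<Rightarrow> 'a) set \<Rightarrow> ('a \<Rightarrow> 'a) set" for G where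
  gen: "f \<in> G \<Longrightarrow> f \<in> gen_semigroup G"
| comp: "f \<in> gen_semigroup G \<Longrightarrow> g \<in> gen_semigroup G \<Longrightarrow> f \<circ> g \<in> gen_semigroup G"

definition semigroup_is_group :: "('a \<Rightarrow> 'a) set \<Rightarrow> bool" where
  "semigroup_is_group S \<longleftrightarrow> (\<exists>e. group \<lparr>carrier = S, mult = (\<circ>), one = e\<rparr>)"

definition rotation_semigroup_is_group :: "(rquat \<times> rquat) list \<Rightarrow> bool" where
  "rotation_semigroup_is_group L \<longleftrightarrow>
     semigroup_is_group (gen_semigroup ((\<lambda>(a, b). rotation a b) ` set L))"

definition valid_instances :: "(rquat \<times> rquat) list set" where
  "valid_instances = {L. \<forall>(a, b) \<in> set L. unit_rquat a \<and> unit_rquat b}"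

end

theory Submission
  imports Defs "HOL-Library.Countable" "HOL-Library.Numeral_Type"
begin

text \<open>
A recursive function \<open>f\<close> is compiled to a nondeterministic program on integer counters. Such a program is
an automaton whose edges are labelled by elements of a direct product of free groups, arranged so that
\<open>f\<close> halts on \<open>n\<close> if and only if some run has trivial label. In a free group \<open>F\<close> an edge from \<open>s\<close> to \<open>t\<close>
with label \<open>b\<close> becomes the relator \<open>s\<^sup>-\<^sup>1 b t b\<^sup>-\<^sup>1\<close>, and the pairs \<open>(y, y)\<close> for letters \<open>y\<close> together with the
pairs \<open>(1, r)\<close> for relators \<open>r\<close> generate a semigroup in \<open>F \<times> F\<close>: it is a group if and only if the submonoid of
\<open>F\<close> generated by the conjugates of the relators is one. Mapping \<open>F\<close> to a wreath product turns a
product of conjugates that equals 1 into a circulation, hence into a closed path of the automaton; a gadget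
with a letter of order three and a free letter makes sure that closed paths through a distinguished edge contain
a run with trivial label, and that all edges lie on closed paths if there is such a run. The group \<open>F\<close> is
realised by rational unit quaternions. Undecidability follows by diagonalisation: a generating set is
evaluated on its own code.
\<close>

subsection \<open>Recursive functions\<close>

text \<open>The pairs follow Mikhailova's construction. Commutators, cubes, input pairs and pairs
  \<open>(y, y)\<close> occur together with their inverses; only edge relators are one-sided, so the
  question is exactly whether these become invertible. One-sidedness makes multiplicities
  nonnegative, which a circulation needs. But a circulation provides some cycle, not a run from the
  start. Order three is the remedy: a token that avoids completing the program arrives at an
  \<open>LT\<close> edge with one or two factors \<open>LZ\<close>, which is never trivial modulo 3;
  once the program can be crossed for free, those factors can be removed again by collecting more of
  them. The pairs (a, b) and (-a, -b) give the same rotation, so freeness is needed up to sign. The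
  input enters through two generators only, which keeps the code of an instance easy to compute.
  Since an instance is fed its own code, neither a universal function nor a numbering of recursive
  functions is needed.\<close>

inductive_cases eval_Z: "eval_rf Z xs y"
inductive_cases eval_Sc: "eval_rf Sc xs y"
inductive_cases eval_Id: "eval_rf (Id n i) xs y"
inductive_cases eval_Cn: "eval_rf (Cn n f gs) xs y"
inductive_cases eval_Pr0: "eval_rf (Pr n f g) (0 # xs) y"
inductive_cases eval_PrS: "eval_rf (Pr n f g) (Suc k # xs) y"
inductive_cases eval_Mn: "eval_rf (Mn n f) xs y"

lemma eval_rf_deterministic:
  "eval_rf f xs y \<Longrightarrow> eval_rf f xs y' \<Longrightarrow> y = y'"
proof (induction arbitrary: y' rule: eval_rf.induct)
  case (zero xs)
  then show ?case by (rule eval_Z) simp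
next
  case (suc x)
  then show ?case by (rule eval_Sc) simp
next
  case (proj xs n i)
  from proj.prems show ?case by (rule eval_Id) simp
next
  case (comp xs n gs ys f z)
  from comp.prems obtain zs where zs: "list_all2 (\<lambda>g y. eval_rf g xs y) gs zs" "eval_rf f zs y'"
    by (rule eval_Cn)
  have "ys = zs"
    using comp.IH(1) zs(1)
    by (intro nth_equalityI) (simp_all add: list_all2_conv_all_nth)
  with comp.IH(2) zs(2) show ?case by simp
next
  case (pr0 xs n f y g)
  from pr0.prems show ?case by (rule eval_Pr0) (rule pr0.IH)
next
  case (prS n f g k xs y z)
  from prS.prems obtain w where "eval_rf (Pr n f g) (k # xs) w" "eval_rf g (k # w # xs) y'"
    by (rule eval_PrS)
  with prS.IH show ?case by blast
next
  case (mn xs n f y)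
  from mn.prems have *: "eval_rf f (y' # xs) 0" "\<forall>u<y'. \<exists>v. eval_rf f (u # xs) v \<and> v \<noteq> 0"
    by (rule eval_Mn, simp)+
  have "\<not> y' < y" using mn.IH(2) *(1) by (metis gr0I)
  moreover have "\<not> y < y'" using mn.IH(1) *(2) by (metis gr0I)
  ultimately show ?case by simp
qed

text \<open>Functions of lists put all arities under one predicate, so that computability goals
  yield to closure rules applied backwards.\<close>

definition total_rec :: "nat \<Rightarrow> (nat list \<Rightarrow> nat) \<Rightarrow> bool" where
  "total_rec n f \<longleftrightarrow> (\<exists>r. \<forall>xs. length xs = n \<longrightarrow> eval_rf r xs (f xs))"

abbreviation rec1 :: "(nat \<Rightarrow> nat) \<Rightarrow> bool" where
  "rec1 f \<equiv> total_rec 1 (\<lambda>xs. f (xs ! 0))"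

abbreviation rec2 :: "(nat \<Rightarrow> nat \<Rightarrow> nat) \<Rightarrow> bool" where
  "rec2 f \<equiv> total_rec 2 (\<lambda>xs. f (xs ! 0) (xs ! 1))"

abbreviation rec3 :: "(nat \<Rightarrow> nat \<Rightarrow> nat \<Rightarrow> nat) \<Rightarrow> bool" where
  "rec3 f \<equiv> total_rec 3 (\<lambda>xs. f (xs ! 0) (xs ! 1) (xs ! 2))"

lemma total_rec_1D: "total_rec 1 f \<Longrightarrow> \<exists>r. \<forall>x. eval_rf r [x] (f [x])"
  unfolding total_rec_def by (metis One_nat_def length_Cons list.size(3))

lemma total_rec_2D: "total_rec 2 f \<Longrightarrow> \<exists>r. \<forall>x y. eval_rf r [x, y] (f [x, y])"
  unfolding total_rec_def by (elim ex_forward) simp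

lemma total_rec_3D: "total_rec 3 f \<Longrightarrow> \<exists>r. \<forall>x y z. eval_rf r [x, y, z] (f [x, y, z])"
  unfolding total_rec_def by (elim ex_forward) simp

lemma total_rec_proj: "i < n \<Longrightarrow> total_rec n (\<lambda>xs. xs ! i)"
  unfolding total_rec_def by (rule exI[of _ "Id n i"]) (auto intro: eval_rf.proj)

lemma total_rec_compose:
  assumes "total_rec (length fs) g" "\<And>f. f \<in> set fs \<Longrightarrow> total_rec n f"
  shows "total_rec n (\<lambda>xs. g (map (\<lambda>f. f xs) fs))"
proof -
  obtain rg where rg: "\<And>xs. length xs = length fs \<Longrightarrow> eval_rf rg xs (g xs)"
    using assms(1) by (auto simp: total_rec_def)
  have "\<exists>r. \<forall>xs. length xs = n \<longrightarrow> eval_rf r xs (f xs)" if "f \<in> set fs" for f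
    using assms(2)[OF that] by (auto simp: total_rec_def)
  then obtain R where R: "\<And>f xs. f \<in> set fs \<Longrightarrow> length xs = n \<Longrightarrow> eval_rf (R f) xs (f xs)"
    by metis
  have "eval_rf (Cn n rg (map R fs)) xs (g (map (\<lambda>f. f xs) fs))" if "length xs = n" for xs
    by (rule eval_rf.comp[where ys = "map (\<lambda>f. f xs) fs"])
       (use that R in \<open>auto simp: list_all2_conv_all_nth intro!: rg\<close>)
  then show ?thesis unfolding total_rec_def by blast
qed

lemma rec1_compose: "rec1 g \<Longrightarrow> total_rec n f \<Longrightarrow> total_rec n (\<lambda>xs. g (f xs))"
  using total_rec_compose[of "[f]" "\<lambda>xs. g (xs ! 0)" n] by simp

lemma rec2_compose:
  "rec2 g \<Longrightarrow> total_rec n f1 \<Longrightarrow> total_rec n f2 \<Longrightarrow> total_rec n (\<lambda>xs. g (f1 xs) (f2 xs))"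
  using total_rec_compose[of "[f1, f2]" "\<lambda>xs. g (xs ! 0) (xs ! 1)" n]
  by (auto simp: numeral_2_eq_2)

lemma total_rec_Suc: "total_rec n f \<Longrightarrow> total_rec n (\<lambda>xs. Suc (f xs))"
proof -
  have "rec1 Suc" unfolding total_rec_def
    by (rule exI[of _ Sc]) (auto simp: length_Suc_conv intro: eval_rf.suc)
  then show "total_rec n f \<Longrightarrow> ?thesis" by (rule rec1_compose)
qed

lemma total_rec_const: "total_rec n (\<lambda>_. c)"
proof (induction c)
  case 0
  show ?case unfolding total_rec_def by (rule exI[of _ Z]) (auto intro: eval_rf.zero)
qed (rule total_rec_Suc)

lemma rec1_primrec:
  assumes "rec2 g" "\<And>m. h (Suc m) = g m (h m)"
  shows "rec1 h"
proof -
  obtain r0 where r0: "eval_rf r0 [] (h 0)"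
    using total_rec_const[of 0 "h 0"] by (auto simp: total_rec_def)
  obtain rg where rg: "\<And>x y. eval_rf rg [x, y] (g x y)"
    using total_rec_2D[OF assms(1)] by auto
  have "eval_rf (Pr 0 r0 rg) [m] (h m)" for m
    by (induction m) (auto simp: assms(2) intro: eval_rf.pr0 r0 eval_rf.prS rg)
  then show ?thesis unfolding total_rec_def
    by (intro exI[of _ "Pr 0 r0 rg"]) (auto simp: length_Suc_conv)
qed

lemma rec2_primrec:
  assumes "rec1 f" "rec3 g" "\<And>x. h 0 x = f x" "\<And>m x. h (Suc m) x = g m (h m x) x"
  shows "rec2 h"
proof -
  obtain rf where rf: "\<And>x. eval_rf rf [x] (f x)"
    using total_rec_1D[OF assms(1)] by auto
  obtain rg where rg: "\<And>x y z. eval_rf rg [x, y, z] (g x y z)"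
    using total_rec_3D[OF assms(2)] by auto
  have "eval_rf (Pr 1 rf rg) [m, x] (h m x)" for m x
    by (induction m) (auto simp: assms(3,4) intro: eval_rf.pr0 rf eval_rf.prS rg)
  then show ?thesis unfolding total_rec_def
    by (intro exI[of _ "Pr 1 rf rg"]) (auto simp: length_Suc_conv numeral_2_eq_2)
qed

lemma rec1_Least:
  assumes "rec2 f" "\<And>x. f (h x) x = 0" "\<And>u x. u < h x \<Longrightarrow> f u x \<noteq> 0"
  shows "rec1 h"
proof -
  obtain rf where rf: "\<And>x y. eval_rf rf [x, y] (f x y)"
    using total_rec_2D[OF assms(1)] by auto
  have "eval_rf (Mn 1 rf) [x] (h x)" for x
  proof (rule eval_rf.mn)
    show "eval_rf rf [h x, x] 0" using rf[of "h x" x] assms(2) by simp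
    show "\<forall>u<h x. \<exists>v. eval_rf rf [u, x] v \<and> v \<noteq> 0" using rf assms(3) by blast
  qed simp
  then show ?thesis unfolding total_rec_def
    by (intro exI[of _ "Mn 1 rf"]) (auto simp: length_Suc_conv)
qed

section \<open>Arithmetic and the Cantor pairing function\<close>

lemma rec2_add: "rec2 (+)"
  by (rule rec2_primrec[of "\<lambda>x. x" "\<lambda>m r x. Suc r"])
     ((intro total_rec_Suc total_rec_proj)?; simp)+

lemmas total_rec_add = rec2_compose[OF rec2_add]

lemma rec2_mult: "rec2 (*)"
  by (rule rec2_primrec[of "\<lambda>x. 0" "\<lambda>m r x. x + r"])
     ((intro total_rec_const total_rec_add total_rec_proj)?; simp)+

lemmas total_rec_mult = rec2_compose[OF rec2_mult]

lemma rec1_pred: "rec1 (\<lambda>x. x - 1)"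
  by (rule rec1_primrec[of "\<lambda>m r. m"]) ((intro total_rec_proj)?; simp)+

lemma rec2_minus: "rec2 (\<lambda>x y. x - y)"
proof -
  \<comment> \<open>Primitive recursion runs over the first argument, so the subtrahend comes first
    and the arguments are swapped afterwards.\<close>
  have "rec2 (\<lambda>m x. x - m)"
    by (rule rec2_primrec[of "\<lambda>x. x" "\<lambda>m r x. r - 1"])
       (simp_all add: total_rec_proj rec1_compose[OF rec1_pred, simplified])
  then show ?thesis
    using rec2_compose[of "\<lambda>m x. x - m" 2 "\<lambda>xs. xs ! 1" "\<lambda>xs. xs ! 0"] total_rec_proj by simp
qed

lemmas total_rec_minus = rec2_compose[OF rec2_minus]

lemma rec1_power: "rec1 (\<lambda>n. c ^ n)"
  by (rule rec1_primrec[of "\<lambda>m r. c * r"])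
     ((intro total_rec_mult total_rec_const total_rec_proj)?; simp)+

lemmas total_rec_power = rec1_compose[OF rec1_power]

lemma rec1_triangle: "rec1 triangle"
proof (rule rec1_primrec)
  show "rec2 (\<lambda>m r. r + Suc m)"
    by (intro total_rec_add total_rec_Suc total_rec_proj) simp_all
  show "triangle (Suc m) = triangle m + Suc m" for m by simp
qed

lemmas total_rec_triangle = rec1_compose[OF rec1_triangle]

lemma rec2_prod_encode: "rec2 (\<lambda>x y. prod_encode (x, y))"
  unfolding prod_encode_def prod.case
  by (intro total_rec_add total_rec_triangle total_rec_proj) simp_all

lemmas total_rec_prod_encode = rec2_compose[OF rec2_prod_encode]

lemma triangle_mono: "m \<le> n \<Longrightarrow> triangle m \<le> triangle n"
  unfolding triangle_def by (intro div_le_mono mult_le_mono) auto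

lemma prod_decode_sum:
  "m = triangle (fst (prod_decode m) + snd (prod_decode m)) + fst (prod_decode m)"
proof -
  have "prod_encode (fst (prod_decode m), snd (prod_decode m)) = m" by simp
  then show ?thesis unfolding prod_encode_def prod.case by (rule sym)
qed

text \<open>The diagonal \<open>x + y\<close> is recovered from \<open>prod_encode (x, y)\<close> by unbounded search.\<close>

lemma rec1_prod_decode_sum: "rec1 (\<lambda>m. fst (prod_decode m) + snd (prod_decode m))"
proof (rule rec1_Least[of "\<lambda>s m. Suc m - triangle (Suc s)"])
  show "rec2 (\<lambda>s m. Suc m - triangle (Suc s))"
    by (intro total_rec_minus total_rec_triangle total_rec_Suc total_rec_proj) simp_all
  fix m
  define a b where ab: "a = fst (prod_decode m)" "b = snd (prod_decode m)"
  have m: "m = triangle (a + b) + a" unfolding ab by (rule prod_decode_sum)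
  have "m < triangle (Suc (a + b))" using m by simp
  then show "Suc m - triangle (Suc (fst (prod_decode m) + snd (prod_decode m))) = 0"
    unfolding ab by simp
  show "Suc m - triangle (Suc u) \<noteq> 0" if "u < fst (prod_decode m) + snd (prod_decode m)" for u
  proof -
    have "triangle (Suc u) \<le> triangle (a + b)"
      using that by (intro triangle_mono) (simp add: ab)
    then show ?thesis using m by linarith
  qed
qed

lemma rec1_fst_prod_decode: "rec1 (\<lambda>m. fst (prod_decode m))"
proof -
  have *: "fst (prod_decode m) = m - triangle (fst (prod_decode m) + snd (prod_decode m))" for m
    using prod_decode_sum[of m] by linarith
  show ?thesis
    by (subst *) (intro total_rec_minus total_rec_triangle total_rec_proj rec1_prod_decode_sum, simp)
qed

lemma rec1_snd_prod_decode: "rec1 (\<lambda>m. snd (prod_decode m))"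
  using rec2_compose[OF rec2_minus rec1_prod_decode_sum rec1_fst_prod_decode] by simp

lemmas total_rec_fst = rec1_compose[OF rec1_fst_prod_decode]
lemmas total_rec_snd = rec1_compose[OF rec1_snd_prod_decode]

subsection \<open>Counter programs\<close>

text \<open>There is no union: choosing the number of iterations, together with tests that may fail,
  is all the branching the compiled programs use.\<close>

datatype 'a rex = At 'a | Ep | Sq "'a rex" "'a rex" | Rp "'a rex"

inductive lng :: "'a rex \<Rightarrow> 'a list \<Rightarrow> bool" where
  At: "lng (At a) [a]"
| Ep: "lng Ep []"
| Sq: "lng p u \<Longrightarrow> lng q v \<Longrightarrow> lng (Sq p q) (u @ v)"
| Rp0: "lng (Rp p) []"
| RpS: "lng p u \<Longrightarrow> lng (Rp p) v \<Longrightarrow> lng (Rp p) (u @ v)"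

inductive_cases lng_AtE: "lng (At a) w"
inductive_cases lng_EpE: "lng Ep w"
inductive_cases lng_SqE: "lng (Sq p q) w"

lemma lng_At_iff [simp]: "lng (At a) w \<longleftrightarrow> w = [a]"
  by (auto elim: lng_AtE intro: lng.At)

lemma lng_Ep_iff [simp]: "lng Ep w \<longleftrightarrow> w = []"
  by (auto elim: lng_EpE intro: lng.Ep)

lemma lng_Sq_iff: "lng (Sq p q) w \<longleftrightarrow> (\<exists>u v. w = u @ v \<and> lng p u \<and> lng q v)"
  by (blast elim: lng_SqE intro: lng.Sq)

text \<open>Counters range over the integers and decrementing never blocks: only \<open>Tst\<close> can fail.\<close>

datatype instr = Inc nat | Dec nat | Tst nat

fun exec :: "instr list \<Rightarrow> (nat \<Rightarrow> int) \<Rightarrow> (nat \<Rightarrow> int) option" where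
  "exec [] \<sigma> = Some \<sigma>"
| "exec (Inc i # w) \<sigma> = exec w (\<sigma>(i := \<sigma> i + 1))"
| "exec (Dec i # w) \<sigma> = exec w (\<sigma>(i := \<sigma> i - 1))"
| "exec (Tst i # w) \<sigma> = (if \<sigma> i = 0 then exec w \<sigma> else None)"

lemma exec_append: "exec (u @ v) \<sigma> = Option.bind (exec u \<sigma>) (exec v)"
proof (induction u arbitrary: \<sigma>)
  case (Cons a u)
  then show ?case by (cases a) (simp_all add: fun_upd_def)
qed simp

definition sem :: "instr rex \<Rightarrow> (nat \<Rightarrow> int) \<Rightarrow> (nat \<Rightarrow> int) \<Rightarrow> bool" where
  "sem p \<sigma> \<sigma>' \<longleftrightarrow> (\<exists>w. lng p w \<and> exec w \<sigma> = Some \<sigma>')"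

lemma sem_Inc [simp]: "sem (At (Inc i)) \<sigma> \<sigma>' \<longleftrightarrow> \<sigma>' = \<sigma>(i := \<sigma> i + 1)"
  and sem_Dec [simp]: "sem (At (Dec i)) \<sigma> \<sigma>' \<longleftrightarrow> \<sigma>' = \<sigma>(i := \<sigma> i - 1)"
  and sem_Tst [simp]: "sem (At (Tst i)) \<sigma> \<sigma>' \<longleftrightarrow> \<sigma> i = 0 \<and> \<sigma>' = \<sigma>"
  and sem_Ep [simp]: "sem Ep \<sigma> \<sigma>' \<longleftrightarrow> \<sigma>' = \<sigma>"
  by (auto simp: sem_def)

lemma sem_Sq [simp]: "sem (Sq p q) \<sigma> \<sigma>' \<longleftrightarrow> (\<exists>\<tau>. sem p \<sigma> \<tau> \<and> sem q \<tau> \<sigma>')"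
proof
  assume "sem (Sq p q) \<sigma> \<sigma>'"
  then obtain u v where "lng p u" "lng q v" "exec (u @ v) \<sigma> = Some \<sigma>'"
    unfolding sem_def lng_Sq_iff by blast
  then show "\<exists>\<tau>. sem p \<sigma> \<tau> \<and> sem q \<tau> \<sigma>'"
    unfolding sem_def exec_append bind_eq_Some_conv by blast
next
  assume "\<exists>\<tau>. sem p \<sigma> \<tau> \<and> sem q \<tau> \<sigma>'"
  then obtain \<tau> u v where "lng p u" "exec u \<sigma> = Some \<tau>" "lng q v" "exec v \<tau> = Some \<sigma>'"
    unfolding sem_def by blast
  then have "lng (Sq p q) (u @ v)" "exec (u @ v) \<sigma> = Some \<sigma>'"
    by (simp_all add: lng.Sq exec_append)
  then show "sem (Sq p q) \<sigma> \<sigma>'" unfolding sem_def by blast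
qed

lemma sem_Rp: "sem (Rp p) \<sigma> \<sigma>' \<longleftrightarrow> (\<exists>n. (sem p ^^ n) \<sigma> \<sigma>')"
proof
  assume "sem (Rp p) \<sigma> \<sigma>'"
  then obtain w where w: "lng (Rp p) w" "exec w \<sigma> = Some \<sigma>'"
    unfolding sem_def by blast
  have "lng r w \<Longrightarrow> r = Rp p \<Longrightarrow> exec w \<sigma> = Some \<sigma>' \<Longrightarrow> \<exists>n. (sem p ^^ n) \<sigma> \<sigma>'" for r
  proof (induction arbitrary: \<sigma> rule: lng.induct)
    case (Rp0 q)
    then have "(sem p ^^ 0) \<sigma> \<sigma>'" by simp
    then show ?case ..
  next
    case (RpS q u v)
    from RpS.prems(2) obtain \<tau> where \<tau>: "exec u \<sigma> = Some \<tau>" "exec v \<tau> = Some \<sigma>'"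
      unfolding exec_append bind_eq_Some_conv by blast
    have "q = p" using RpS.prems(1) by simp
    with RpS.hyps(1) \<tau>(1) have "sem p \<sigma> \<tau>" unfolding sem_def by blast
    moreover obtain n where "(sem p ^^ n) \<tau> \<sigma>'" using RpS.IH(2) RpS.prems(1) \<tau>(2) by blast
    ultimately have "(sem p ^^ Suc n) \<sigma> \<sigma>'" by (rule relpowp_Suc_I2)
    then show ?case ..
  qed simp_all
  with w show "\<exists>n. (sem p ^^ n) \<sigma> \<sigma>'" by blast
next
  assume "\<exists>n. (sem p ^^ n) \<sigma> \<sigma>'"
  then obtain n where "(sem p ^^ n) \<sigma> \<sigma>'" ..
  then show "sem (Rp p) \<sigma> \<sigma>'"
  proof (induction n arbitrary: \<sigma>)
    case 0
    then have "exec [] \<sigma> = Some \<sigma>'" by simp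
    then show ?case unfolding sem_def by (blast intro: lng.Rp0)
  next
    case (Suc n)
    then obtain \<tau> where "sem p \<sigma> \<tau>" "sem (Rp p) \<tau> \<sigma>'"
      using relpowp_Suc_D2[OF Suc.prems] by blast
    then obtain u v where "lng p u" "exec u \<sigma> = Some \<tau>" "lng (Rp p) v" "exec v \<tau> = Some \<sigma>'"
      unfolding sem_def by blast
    then have "lng (Rp p) (u @ v)" "exec (u @ v) \<sigma> = Some \<sigma>'"
      by (simp_all add: lng.RpS exec_append)
    then show ?case unfolding sem_def by blast
  qed
qed

text \<open>An exact loop rule in both directions. \<open>F j\<close> is a set of states, not a
  single state, because a round may have no outcome when a subprogram diverges.\<close>

lemma sem_Rp_family:
  assumes "\<And>j \<tau>'. (\<exists>\<tau>. F j \<tau> \<and> sem p \<tau> \<tau>') \<longleftrightarrow> F (Suc j) \<tau>'"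
  shows "(\<exists>\<tau>. F 0 \<tau> \<and> sem (Rp p) \<tau> \<tau>') \<longleftrightarrow> (\<exists>j. F j \<tau>')"
proof -
  have "(\<exists>\<tau>. F 0 \<tau> \<and> (sem p ^^ j) \<tau> \<tau>') \<longleftrightarrow> F j \<tau>'" for j
  proof (induction j arbitrary: \<tau>')
    case (Suc j)
    have "(\<exists>\<tau>. F 0 \<tau> \<and> (sem p ^^ Suc j) \<tau> \<tau>') \<longleftrightarrow> (\<exists>\<rho>. F j \<rho> \<and> sem p \<rho> \<tau>')"
      unfolding Suc.IH[symmetric] relpowp.simps relcompp_apply by blast
    then show ?case by (simp add: assms)
  qed simp
  then show ?thesis unfolding sem_Rp by blast
qed

lemma sem_Rp_function:
  assumes "\<And>j \<tau>. sem p (F j) \<tau> \<longleftrightarrow> \<tau> = F (Suc j)"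
  shows "sem (Rp p) (F 0) \<tau> \<longleftrightarrow> (\<exists>j. \<tau> = F j)"
  using sem_Rp_family[of "\<lambda>j \<tau>. \<tau> = F j" p \<tau>] assms by auto

text \<open>The number of decrements is guessed and the final test rejects every wrong guess; a
  negative counter has no right one.\<close>

definition drain :: "nat \<Rightarrow> instr rex" where
  "drain x = Sq (Rp (At (Dec x))) (At (Tst x))"

definition move :: "nat \<Rightarrow> nat \<Rightarrow> instr rex" where
  "move x y = Sq (Rp (Sq (At (Dec x)) (At (Inc y)))) (At (Tst x))"

definition copy :: "nat \<Rightarrow> nat \<Rightarrow> nat \<Rightarrow> instr rex" where
  "copy x y t = Sq (Sq (Rp (Sq (At (Dec x)) (Sq (At (Inc y)) (At (Inc t))))) (At (Tst x))) (move t x)"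

lemma sem_drain [simp]: "sem (drain x) \<sigma> \<sigma>' \<longleftrightarrow> 0 \<le> \<sigma> x \<and> \<sigma>' = \<sigma>(x := 0)"
proof -
  let ?F = "\<lambda>j. \<sigma>(x := \<sigma> x - int j)"
  have "sem (At (Dec x)) (?F j) \<tau> \<longleftrightarrow> \<tau> = ?F (Suc j)" for j \<tau>
    by (simp add: diff_diff_add add.commute)
  from sem_Rp_function[of _ ?F, OF this]
  have "sem (Rp (At (Dec x))) \<sigma> \<tau> \<longleftrightarrow> (\<exists>j. \<tau> = ?F j)" for \<tau> by simp
  then have "sem (drain x) \<sigma> \<sigma>' \<longleftrightarrow> (\<exists>j. \<sigma> x = int j \<and> \<sigma>' = ?F j)"
    unfolding drain_def sem_Sq sem_Tst by auto
  also have "\<dots> \<longleftrightarrow> 0 \<le> \<sigma> x \<and> \<sigma>' = \<sigma>(x := 0)"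
    by (auto elim: nonneg_int_cases)
  finally show ?thesis .
qed

lemma sem_move [simp]:
  assumes "x \<noteq> y"
  shows "sem (move x y) \<sigma> \<sigma>' \<longleftrightarrow> 0 \<le> \<sigma> x \<and> \<sigma>' = \<sigma>(x := 0, y := \<sigma> y + \<sigma> x)"
proof -
  let ?p = "Sq (At (Dec x)) (At (Inc y))"
  let ?F = "\<lambda>j. \<sigma>(x := \<sigma> x - int j, y := \<sigma> y + int j)"
  have "sem ?p (?F j) \<tau> \<longleftrightarrow> \<tau> = ?F (Suc j)" for j \<tau>
  proof -
    have "(?F j)(x := ?F j x - 1, y := ?F j y + 1) = ?F (Suc j)"
      using assms by (auto simp: fun_eq_iff)
    then show ?thesis using assms by simp
  qed
  from sem_Rp_function[of ?p ?F, OF this]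
  have "sem (Rp ?p) \<sigma> \<tau> \<longleftrightarrow> (\<exists>j. \<tau> = ?F j)" for \<tau> by simp
  then have "sem (move x y) \<sigma> \<sigma>' \<longleftrightarrow> (\<exists>j. \<sigma> x = int j \<and> \<sigma>' = ?F j)"
    unfolding move_def sem_Sq[of "Rp _"] sem_Tst using assms by auto
  also have "\<dots> \<longleftrightarrow> 0 \<le> \<sigma> x \<and> \<sigma>' = \<sigma>(x := 0, y := \<sigma> y + \<sigma> x)"
    by (auto elim: nonneg_int_cases)
  finally show ?thesis .
qed

lemma sem_copy [simp]:
  assumes "distinct [x, y, t]" "\<sigma> t = 0"
  shows "sem (copy x y t) \<sigma> \<sigma>' \<longleftrightarrow> 0 \<le> \<sigma> x \<and> \<sigma>' = \<sigma>(y := \<sigma> y + \<sigma> x)"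
proof -
  let ?p = "Sq (At (Dec x)) (Sq (At (Inc y)) (At (Inc t)))"
  let ?F = "\<lambda>j. \<sigma>(x := \<sigma> x - int j, y := \<sigma> y + int j, t := int j)"
  have "sem ?p (?F j) \<tau> \<longleftrightarrow> \<tau> = ?F (Suc j)" for j \<tau>
  proof -
    have "(?F j)(x := ?F j x - 1, y := ?F j y + 1, t := ?F j t + 1) = ?F (Suc j)"
      using assms(1) by (auto simp: fun_eq_iff)
    then show ?thesis using assms(1) by auto
  qed
  from sem_Rp_function[of ?p ?F, OF this]
  have "sem (Rp ?p) (?F 0) \<tau> \<longleftrightarrow> (\<exists>j. \<tau> = ?F j)" for \<tau> .
  moreover have "?F 0 = \<sigma>" using assms by (auto simp: fun_eq_iff)
  ultimately have R: "sem (Rp ?p) \<sigma> \<tau> \<longleftrightarrow> (\<exists>j. \<tau> = ?F j)" for \<tau> by simp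
  have "sem (copy x y t) \<sigma> \<sigma>' \<longleftrightarrow> (\<exists>j. \<sigma> x = int j \<and> sem (move t x) (?F j) \<sigma>')"
    unfolding copy_def sem_Sq[of "Sq (Rp ?p) _"] sem_Sq[of "Rp ?p"] sem_Tst R
    using assms(1) by auto
  also have "\<dots> \<longleftrightarrow> (\<exists>j. \<sigma> x = int j \<and> \<sigma>' = (?F j)(t := 0, x := ?F j x + ?F j t))"
    using assms(1) by simp
  also have "\<dots> \<longleftrightarrow> 0 \<le> \<sigma> x \<and> \<sigma>' = \<sigma>(y := \<sigma> y + \<sigma> x)"
  proof -
    have "(?F j)(t := 0, x := ?F j x + ?F j t) = \<sigma>(y := \<sigma> y + int j)" for j
      using assms by (auto simp: fun_eq_iff)
    then show ?thesis by (auto elim: nonneg_int_cases)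
  qed
  finally show ?thesis .
qed

section \<open>Compiling recursive functions to counter programs\<close>

fun drains :: "nat list \<Rightarrow> instr rex" where
  "drains [] = Ep"
| "drains (r # rs) = Sq (drain r) (drains rs)"

lemma sem_drains:
  "(\<And>r. r \<in> set rs \<Longrightarrow> 0 \<le> \<sigma> r) \<Longrightarrow>
    sem (drains rs) \<sigma> \<sigma>' \<longleftrightarrow> \<sigma>' = (\<lambda>r. if r \<in> set rs then 0 else \<sigma> r)"
proof (induction rs arbitrary: \<sigma>)
  case (Cons r rs)
  have "sem (drains rs) (\<sigma>(r := 0)) \<sigma>' \<longleftrightarrow>
      \<sigma>' = (\<lambda>q. if q \<in> set rs then 0 else (\<sigma>(r := 0)) q)"
    using Cons.prems by (intro Cons.IH) auto
  moreover have "(\<lambda>q. if q \<in> set rs then 0 else (\<sigma>(r := 0)) q)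
      = (\<lambda>q. if q \<in> set (r # rs) then 0 else \<sigma> q)"
    by auto
  ultimately show ?case using Cons.prems by simp
qed simp

text \<open>Registers from \<open>b\<close> on are scratch, zero before and after; inputs are
  preserved and the result is added to \<open>out\<close>. The equivalence also says that an
  undefined value leaves no successful execution.\<close>

definition implements ::
  "instr rex \<Rightarrow> nat list \<Rightarrow> nat \<Rightarrow> nat \<Rightarrow> (nat list \<Rightarrow> nat \<Rightarrow> bool) \<Rightarrow> bool" where
  "implements p ins out b f \<longleftrightarrow> (\<forall>xs \<sigma> \<sigma>'. map \<sigma> ins = map int xs \<longrightarrow> (\<forall>r\<ge>b. \<sigma> r = 0) \<longrightarrow>
     (sem p \<sigma> \<sigma>' \<longleftrightarrow> (\<exists>y. f xs y \<and> \<sigma>' = \<sigma>(out := \<sigma> out + int y))))"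

lemma implementsD:
  "implements p ins out b f \<Longrightarrow> map \<sigma> ins = map int xs \<Longrightarrow> (\<And>r. r \<ge> b \<Longrightarrow> \<sigma> r = 0) \<Longrightarrow>
    sem p \<sigma> \<sigma>' \<longleftrightarrow> (\<exists>y. f xs y \<and> \<sigma>' = \<sigma>(out := \<sigma> out + int y))"
  by (auto simp: implements_def)

definition implementable :: "(nat list \<Rightarrow> nat \<Rightarrow> bool) \<Rightarrow> bool" where
  "implementable f \<longleftrightarrow> (\<forall>ins out b. set ins \<subseteq> {..<b} \<longrightarrow> out < b \<longrightarrow> out \<notin> set ins \<longrightarrow>
     (\<exists>p. implements p ins out b f))"

lemma implementableD:
  "implementable f \<Longrightarrow> set ins \<subseteq> {..<b} \<Longrightarrow> out < b \<Longrightarrow> out \<notin> set ins \<Longrightarrow>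
    \<exists>p. implements p ins out b f"
  by (simp add: implementable_def)

lemma implements_nowhere:
  assumes "\<And>xs y. length xs = length ins \<Longrightarrow> \<not> f xs y"
  shows "\<exists>p. implements p ins out b f"
proof (intro exI)
  \<comment> \<open>Register \<open>b\<close> holds 0, so the test after the increment always
    fails.\<close>
  show "implements (Sq (At (Inc b)) (At (Tst b))) ins out b f"
    unfolding implements_def using assms by (auto dest: map_eq_imp_length_eq)
qed

text \<open>Results go to consecutive registers from \<open>c\<close> on. The inputs stay below
  \<open>c\<close>, so each program may use everything above its own output as scratch.\<close>

lemma implementable_list:
  assumes "\<And>g. g \<in> set gs \<Longrightarrow> implementable (eval_rf g)" "set ins \<subseteq> {..<c}"
  shows "\<exists>p. \<forall>xs \<sigma> \<sigma>'. map \<sigma> ins = map int xs \<longrightarrow> (\<forall>r\<ge>c. \<sigma> r = 0) \<longrightarrow>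
     (sem p \<sigma> \<sigma>' \<longleftrightarrow> (\<exists>ys. list_all2 (\<lambda>g y. eval_rf g xs y) gs ys \<and>
       \<sigma>' = (\<lambda>r. if c \<le> r \<and> r < c + length gs then int (ys ! (r - c)) else \<sigma> r)))"
  using assms
proof (induction gs arbitrary: c)
  case Nil
  show ?case by (rule exI[of _ Ep]) auto
next
  case (Cons g gs)
  have "implementable (eval_rf g)" using Cons.prems by simp
  then obtain p where p: "implements p ins c (Suc c) (eval_rf g)"
    unfolding implementable_def using Cons.prems(2) by (metis less_SucI lessI lessThan_iff nless_le subset_iff)
  have "set ins \<subseteq> {..<Suc c}" using Cons.prems(2) by auto
  with Cons.IH[of "Suc c"] Cons.prems(1) obtain q where q:
    "\<And>xs \<sigma> \<sigma>'. map \<sigma> ins = map int xs \<Longrightarrow> (\<forall>r\<ge>Suc c. \<sigma> r = 0) \<Longrightarrow>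
     (sem q \<sigma> \<sigma>' \<longleftrightarrow> (\<exists>ys. list_all2 (\<lambda>g y. eval_rf g xs y) gs ys \<and>
       \<sigma>' = (\<lambda>r. if Suc c \<le> r \<and> r < Suc c + length gs then int (ys ! (r - Suc c)) else \<sigma> r)))"
    by (simp (no_asm_use)) blast
  show ?case
  proof (intro exI[of _ "Sq p q"] allI impI)
    fix xs \<sigma> \<sigma>'
    assume ins: "map \<sigma> ins = map int xs" and z: "\<forall>r\<ge>c. \<sigma> r = 0"
    have P: "sem p \<sigma> \<tau> \<longleftrightarrow> (\<exists>y. eval_rf g xs y \<and> \<tau> = \<sigma>(c := int y))" for \<tau>
      using implementsD[OF p ins] z by auto
    have Q: "sem q (\<sigma>(c := int y)) \<sigma>' \<longleftrightarrow> (\<exists>ys. list_all2 (\<lambda>g y. eval_rf g xs y) gs ys \<and>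
       \<sigma>' = (\<lambda>r. if c \<le> r \<and> r < c + length (g # gs) then int ((y # ys) ! (r - c)) else \<sigma> r))" for y
    proof -
      have "map (\<sigma>(c := int y)) ins = map int xs"
        unfolding ins[symmetric] using Cons.prems(2) by auto
      then have "sem q (\<sigma>(c := int y)) \<sigma>' \<longleftrightarrow> (\<exists>ys. list_all2 (\<lambda>g y. eval_rf g xs y) gs ys \<and>
          \<sigma>' = (\<lambda>r. if Suc c \<le> r \<and> r < Suc c + length gs then int (ys ! (r - Suc c))
             else (\<sigma>(c := int y)) r))"
        by (rule q) (use z in auto)
      moreover have "(\<lambda>r. if Suc c \<le> r \<and> r < Suc c + length gs then int (ys ! (r - Suc c))
             else (\<sigma>(c := int y)) r) =
          (\<lambda>r. if c \<le> r \<and> r < c + length (g # gs) then int ((y # ys) ! (r - c)) else \<sigma> r)" for ys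
        by (auto simp: fun_eq_iff nth_Cons split: nat.splits) (metis Suc_diff_Suc Suc_le_eq diff_Suc_Suc
          le_neq_implies_less nat.inject)+
      ultimately show ?thesis by simp
    qed
    show "sem (Sq p q) \<sigma> \<sigma>' \<longleftrightarrow> (\<exists>ys. list_all2 (\<lambda>g y. eval_rf g xs y) (g # gs) ys \<and>
       \<sigma>' = (\<lambda>r. if c \<le> r \<and> r < c + length (g # gs) then int (ys ! (r - c)) else \<sigma> r))"
      unfolding sem_Sq P list_all2_Cons1 using Q by blast
  qed
qed

lemma implementable_Cn:
  assumes f: "implementable (eval_rf f)"
    and gs: "\<And>g. g \<in> set gs \<Longrightarrow> implementable (eval_rf g)"
  shows "implementable (eval_rf (Cn n f gs))"
  unfolding implementable_def
proof (intro allI impI)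
  fix ins :: "nat list" and out c :: nat assume ins: "set ins \<subseteq> {..<c}" and out: "out < c" "out \<notin> set ins"
  show "\<exists>p. implements p ins out c (eval_rf (Cn n f gs))"
  proof (cases "length ins = n")
    case False
    then show ?thesis by (intro implements_nowhere) (auto elim: eval_Cn)
  next
    case n: True
    define m where "m = length gs"
    from implementable_list[of gs ins c, OF gs ins] obtain q where q:
      "\<And>xs \<sigma> \<sigma>'. map \<sigma> ins = map int xs \<Longrightarrow> \<forall>r\<ge>c. \<sigma> r = 0 \<Longrightarrow>
       (sem q \<sigma> \<sigma>' \<longleftrightarrow> (\<exists>ys. list_all2 (\<lambda>g y. eval_rf g xs y) gs ys \<and>
         \<sigma>' = (\<lambda>r. if c \<le> r \<and> r < c + m then int (ys ! (r - c)) else \<sigma> r)))"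
      unfolding m_def by blast
    have "set [c..<c + m] \<subseteq> {..<c + m}" "out < c + m" "out \<notin> set [c..<c + m]" using out by auto
    then obtain p where p: "implements p [c..<c + m] out (c + m) (eval_rf f)"
      using f unfolding implementable_def by blast
    have "implements (Sq q (Sq p (drains [c..<c + m]))) ins out c (eval_rf (Cn n f gs))"
      unfolding implements_def
    proof (intro allI impI)
      fix xs \<sigma> \<sigma>'
      assume xs: "map \<sigma> ins = map int xs" and z: "\<forall>r\<ge>c. \<sigma> r = 0"
      then have lxs: "length xs = n" using n by (auto dest: map_eq_imp_length_eq)
      let ?S = "\<lambda>ys r. if c \<le> r \<and> r < c + m then int (ys ! (r - c)) else \<sigma> r"
      have *: "sem (Sq p (drains [c..<c + m])) (?S ys) \<sigma>' \<longleftrightarrow>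
          (\<exists>y. eval_rf f ys y \<and> \<sigma>' = \<sigma>(out := \<sigma> out + int y))" if ys: "length ys = m" for ys
      proof -
        have "map (?S ys) [c..<c + m] = map int ys"
          using ys by (auto intro!: nth_equalityI)
        from implementsD[OF p this] have P: "sem p (?S ys) \<tau> \<longleftrightarrow>
            (\<exists>y. eval_rf f ys y \<and> \<tau> = (?S ys)(out := \<sigma> out + int y))" for \<tau>
          using z out(1) by auto
        have D: "sem (drains [c..<c + m]) ((?S ys)(out := \<sigma> out + int y)) \<sigma>' \<longleftrightarrow>
            \<sigma>' = \<sigma>(out := \<sigma> out + int y)" for y
        proof -
          have "(\<lambda>r. if r \<in> set [c..<c + m] then 0 else ((?S ys)(out := \<sigma> out + int y)) r)
              = \<sigma>(out := \<sigma> out + int y)"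
            using z out(1) by (auto simp: fun_eq_iff)
          then show ?thesis using out(1) by (subst sem_drains) auto
        qed
        show ?thesis unfolding sem_Sq P using D by blast
      qed
      have "sem (Sq q (Sq p (drains [c..<c + m]))) \<sigma> \<sigma>' \<longleftrightarrow>
          (\<exists>ys. list_all2 (\<lambda>g y. eval_rf g xs y) gs ys \<and> sem (Sq p (drains [c..<c + m])) (?S ys) \<sigma>')"
        unfolding sem_Sq[of q] q[OF xs z] by blast
      also have "\<dots> \<longleftrightarrow> (\<exists>ys. list_all2 (\<lambda>g y. eval_rf g xs y) gs ys \<and>
          (\<exists>y. eval_rf f ys y \<and> \<sigma>' = \<sigma>(out := \<sigma> out + int y)))"
      proof -
        have "list_all2 (\<lambda>g y. eval_rf g xs y) gs ys \<Longrightarrow> length ys = m" for ys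
          unfolding m_def by (simp add: list_all2_lengthD)
        with * show ?thesis by (simp only: cong: conj_cong)
      qed
      also have "\<dots> \<longleftrightarrow> (\<exists>y. eval_rf (Cn n f gs) xs y \<and> \<sigma>' = \<sigma>(out := \<sigma> out + int y))"
        using lxs by (auto elim!: eval_Cn intro: eval_rf.comp)
      finally show "sem (Sq q (Sq p (drains [c..<c + m]))) \<sigma> \<sigma>' \<longleftrightarrow>
        (\<exists>y. eval_rf (Cn n f gs) xs y \<and> \<sigma>' = \<sigma>(out := \<sigma> out + int y))" .
    qed
    then show ?thesis ..
  qed
qed

text \<open>The rule \<open>prS\<close> has no arity condition; the arity is inherited from
  \<open>pr0\<close> at the bottom of the recursion.\<close>

lemma eval_Pr_length: "eval_rf h zs y \<Longrightarrow> h = Pr n f g \<Longrightarrow> length zs = Suc n"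
  by (induction rule: eval_rf.induct) auto

lemma eval_PrS_iff: "eval_rf (Pr n f g) (Suc k # xs) z \<longleftrightarrow>
    (\<exists>y. eval_rf (Pr n f g) (k # xs) y \<and> eval_rf g (k # y # xs) z)"
  by (blast elim: eval_PrS intro: eval_rf.prS)

lemma eval_Pr0_iff: "length xs = n \<Longrightarrow> eval_rf (Pr n f g) (0 # xs) y \<longleftrightarrow> eval_rf f xs y"
  by (blast elim: eval_Pr0 intro: eval_rf.pr0)

lemma implementable_Pr:
  assumes f: "implementable (eval_rf f)" and g: "implementable (eval_rf g)"
  shows "implementable (eval_rf (Pr n f g))"
  unfolding implementable_def
proof (intro allI impI)
  fix ins :: "nat list" and out b :: nat assume ins: "set ins \<subseteq> {..<b}" and out: "out < b" "out \<notin> set ins"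
  show "\<exists>p. implements p ins out b (eval_rf (Pr n f g))"
  proof (cases "length ins = Suc n")
    case False
    then show ?thesis by (intro implements_nowhere) (auto dest: eval_Pr_length)
  next
    case True
    then obtain i js where ij: "ins = i # js" and n: "length js = n" by (auto simp: length_Suc_conv)
    have i: "i < b" "out \<noteq> i" and js: "\<And>j. j \<in> set js \<Longrightarrow> j < b" "out \<notin> set js"
      using ins out ij by auto
    \<comment> \<open>\<open>k\<close> counts finished rounds, \<open>y\<close> holds the current
      value, \<open>z\<close> receives the next one, \<open>r\<close> holds the rounds that remain,
      and scratch starts at \<open>c\<close>.\<close>
    define k y z r c where reg: "k = b" "y = Suc b" "z = Suc (Suc b)" "r = Suc (Suc (Suc b))"
      "c = Suc (Suc (Suc (Suc b)))"
    have "\<exists>p. implements p js y c (eval_rf f)"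
    proof (rule implementableD[OF f])
      show "set js \<subseteq> {..<c}" "y \<notin> set js"
        using js(1) by (fastforce simp: reg)+
    qed (simp add: reg)
    then obtain pf where pf: "implements pf js y c (eval_rf f)" ..
    have "\<exists>p. implements p (k # y # js) z c (eval_rf g)"
    proof (rule implementableD[OF g])
      show "set (k # y # js) \<subseteq> {..<c}" "z \<notin> set (k # y # js)"
        using js(1) by (fastforce simp: reg)+
    qed (simp add: reg)
    then obtain pg where pg: "implements pg (k # y # js) z c (eval_rf g)" ..
    let ?body = "Sq (At (Dec r)) (Sq pg (Sq (drain y) (Sq (move z y) (At (Inc k)))))"
    let ?tail = "Sq (At (Tst r)) (Sq (move y out) (drain k))"
    let ?p = "Sq (Sq pf (copy i r c)) (Sq (Rp ?body) ?tail)"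
    have "implements ?p ins out b (eval_rf (Pr n f g))"
      unfolding implements_def
    proof (intro allI impI)
      fix zs \<sigma> \<sigma>'
      assume zs: "map \<sigma> ins = map int zs" and Z: "\<forall>r\<ge>b. \<sigma> r = 0"
      then obtain N xs where zs_eq: "zs = N # xs" and N: "\<sigma> i = int N" and xs: "map \<sigma> js = map int xs"
        using ij by (cases zs) auto
      then have lxs: "length xs = n" using n by (auto dest: map_eq_imp_length_eq)
      have upd: "map \<tau> js = map int xs" if "\<forall>q<b. \<tau> q = \<sigma> q" for \<tau>
        unfolding xs[symmetric] using that js(1) by simp
      \<comment> \<open>Counters are integers: rounds beyond \<open>N\<close> make \<open>r\<close>
        negative, and the test in the tail rejects them.\<close>
      let ?G = "\<lambda>j v. \<sigma>(k := int j, y := int v, r := int N - int j)"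
      define F where "F j \<tau> \<longleftrightarrow> (\<exists>v. eval_rf (Pr n f g) (j # xs) v \<and> \<tau> = ?G j v)" for j \<tau>
      have pg': "sem pg ((?G j v)(r := int N - int j - 1)) \<tau> \<longleftrightarrow>
          (\<exists>w. eval_rf g (j # v # xs) w \<and> \<tau> = (?G j v)(r := int N - int j - 1, z := int w))" for j v \<tau>
      proof -
        have "map ((?G j v)(r := int N - int j - 1)) js = map int xs"
          by (rule upd) (simp add: reg)
        then have "map ((?G j v)(r := int N - int j - 1)) (k # y # js) = map int (j # v # xs)"
          by (simp add: reg)
        moreover have "((?G j v)(r := int N - int j - 1)) z = 0" using Z by (simp add: reg)
        ultimately show ?thesis using Z by (subst implementsD[OF pg]) (auto simp: reg)
      qed
      have body: "sem ?body (?G j v) \<tau>' \<longleftrightarrow>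
          (\<exists>w. eval_rf g (j # v # xs) w \<and> \<tau>' = ?G (Suc j) w)" for j v \<tau>'
      proof -
        have upd': "((?G j v)(r := int N - int j - 1, z := int w))
           (y := 0, z := 0, y := int w, k := int j + 1) = ?G (Suc j) w" for w
          using Z by (auto simp: reg fun_eq_iff)
        have "sem ?body (?G j v) \<tau>' \<longleftrightarrow> (\<exists>\<tau>. sem pg ((?G j v)(r := int N - int j - 1)) \<tau> \<and>
            sem (Sq (drain y) (Sq (move z y) (At (Inc k)))) \<tau> \<tau>')"
          by simp
        also have "\<dots> \<longleftrightarrow> (\<exists>w. eval_rf g (j # v # xs) w \<and>
            sem (Sq (drain y) (Sq (move z y) (At (Inc k))))
              ((?G j v)(r := int N - int j - 1, z := int w)) \<tau>')"
          unfolding pg' by blast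
        also have "\<dots> \<longleftrightarrow> (\<exists>w. eval_rf g (j # v # xs) w \<and> \<tau>' = ?G (Suc j) w)"
          unfolding upd'[symmetric] by (simp add: reg)
        finally show ?thesis .
      qed
      have "(\<exists>\<tau>. F j \<tau> \<and> sem ?body \<tau> \<tau>') \<longleftrightarrow> F (Suc j) \<tau>'" for j \<tau>'
      proof -
        have "(\<exists>\<tau>. F j \<tau> \<and> sem ?body \<tau> \<tau>') \<longleftrightarrow>
            (\<exists>v. eval_rf (Pr n f g) (j # xs) v \<and> sem ?body (?G j v) \<tau>')"
          unfolding F_def by blast
        also have "\<dots> \<longleftrightarrow> F (Suc j) \<tau>'"
          unfolding body F_def eval_PrS_iff by blast
        finally show ?thesis .
      qed
      from sem_Rp_family[of F ?body, OF this]
      have loop: "(\<exists>\<tau>. F 0 \<tau> \<and> sem (Rp ?body) \<tau> \<tau>') \<longleftrightarrow> (\<exists>j. F j \<tau>')" for \<tau>' .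
      have init: "sem (Sq pf (copy i r c)) \<sigma> \<tau> \<longleftrightarrow> F 0 \<tau>" for \<tau>
      proof -
        have "sem pf \<sigma> \<rho> \<longleftrightarrow> (\<exists>v. eval_rf f xs v \<and> \<rho> = \<sigma>(y := int v))" for \<rho>
          using Z by (subst implementsD[OF pf xs]) (auto simp: reg)
        then have "sem (Sq pf (copy i r c)) \<sigma> \<tau> \<longleftrightarrow>
            (\<exists>v. eval_rf f xs v \<and> sem (copy i r c) (\<sigma>(y := int v)) \<tau>)"
          by auto
        also have "\<dots> \<longleftrightarrow> (\<exists>v. eval_rf f xs v \<and> \<tau> = \<sigma>(y := int v, r := int N))"
        proof -
          have "sem (copy i r c) (\<sigma>(y := int v)) \<tau> \<longleftrightarrow> \<tau> = \<sigma>(y := int v, r := int N)" for v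
            using Z i N by (subst sem_copy) (simp_all add: reg)
          then show ?thesis by simp
        qed
        also have "\<dots> \<longleftrightarrow> F 0 \<tau>"
        proof -
          have "\<sigma>(y := int v, r := int N) = ?G 0 v" for v using Z by (auto simp: reg fun_eq_iff)
          then show ?thesis unfolding F_def eval_Pr0_iff[OF lxs] by simp
        qed
        finally show ?thesis .
      qed
      have tail: "sem ?tail (?G j v) \<sigma>' \<longleftrightarrow> j = N \<and> \<sigma>' = \<sigma>(out := \<sigma> out + int v)" for j v
      proof -
        have "(?G N v)(y := 0, out := \<sigma> out + int v, k := 0) = \<sigma>(out := \<sigma> out + int v)"
          using Z out(1) by (auto simp: reg fun_eq_iff)
        then show ?thesis using out(1) by (auto simp: reg)
      qed
      have "sem ?p \<sigma> \<sigma>' \<longleftrightarrow> (\<exists>\<tau>'. (\<exists>\<tau>. F 0 \<tau> \<and> sem (Rp ?body) \<tau> \<tau>') \<and> sem ?tail \<tau>' \<sigma>')"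
        unfolding sem_Sq[of "Sq pf (copy i r c)"] sem_Sq[of "Rp ?body"] init by blast
      also have "\<dots> \<longleftrightarrow> (\<exists>\<tau>'. (\<exists>j. F j \<tau>') \<and> sem ?tail \<tau>' \<sigma>')"
        by (simp only: loop)
      also have "\<dots> \<longleftrightarrow> (\<exists>j v. eval_rf (Pr n f g) (j # xs) v \<and> sem ?tail (?G j v) \<sigma>')"
        unfolding F_def by blast
      also have "\<dots> \<longleftrightarrow> (\<exists>v. eval_rf (Pr n f g) zs v \<and> \<sigma>' = \<sigma>(out := \<sigma> out + int v))"
        unfolding tail zs_eq by blast
      finally show "sem ?p \<sigma> \<sigma>' \<longleftrightarrow>
        (\<exists>v. eval_rf (Pr n f g) zs v \<and> \<sigma>' = \<sigma>(out := \<sigma> out + int v))" .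
    qed
    then show ?thesis ..
  qed
qed

lemma eval_Mn_iff:
  assumes "length xs = n"
  shows "eval_rf (Mn n f) xs y \<longleftrightarrow>
    eval_rf f (y # xs) 0 \<and> (\<forall>u<y. \<exists>v. eval_rf f (u # xs) v \<and> v \<noteq> 0)"
proof
  assume "eval_rf (Mn n f) xs y"
  then show "eval_rf f (y # xs) 0 \<and> (\<forall>u<y. \<exists>v. eval_rf f (u # xs) v \<and> v \<noteq> 0)"
    by (rule eval_Mn) simp
qed (use assms in \<open>auto intro: eval_rf.mn\<close>)

lemma implementable_Mn:
  assumes f: "implementable (eval_rf f)"
  shows "implementable (eval_rf (Mn n f))"
  unfolding implementable_def
proof (intro allI impI)
  fix ins :: "nat list" and out b :: nat assume ins: "set ins \<subseteq> {..<b}" and out: "out < b" "out \<notin> set ins"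
  show "\<exists>p. implements p ins out b (eval_rf (Mn n f))"
  proof (cases "length ins = n")
    case False
    then show ?thesis by (intro implements_nowhere) (auto elim: eval_Mn)
  next
    case n: True
    define u v c where reg: "u = b" "v = Suc b" "c = Suc (Suc b)"
    have "\<exists>q. implements q (u # ins) v c (eval_rf f)"
    proof (rule implementableD[OF f])
      show "set (u # ins) \<subseteq> {..<c}" "v \<notin> set (u # ins)"
        using ins by (fastforce simp: reg)+
    qed (simp add: reg)
    then obtain q where q: "implements q (u # ins) v c (eval_rf f)" ..
    \<comment> \<open>\<open>drain\<close> succeeds only on nonnegative counters, so a decrement
      before it tests that the value was not 0.\<close>
    let ?body = "Sq q (Sq (At (Dec v)) (Sq (drain v) (At (Inc u))))"
    let ?tail = "Sq q (Sq (At (Tst v)) (move u out))"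
    have "implements (Sq (Rp ?body) ?tail) ins out b (eval_rf (Mn n f))"
      unfolding implements_def
    proof (intro allI impI)
      fix xs \<sigma> \<sigma>'
      assume xs: "map \<sigma> ins = map int xs" and Z: "\<forall>r\<ge>b. \<sigma> r = 0"
      then have lxs: "length xs = n" using n by (auto dest: map_eq_imp_length_eq)
      define F where "F j \<tau> \<longleftrightarrow> (\<forall>u<j. \<exists>v. eval_rf f (u # xs) v \<and> v \<noteq> 0) \<and> \<tau> = \<sigma>(u := int j)" for j \<tau>
      have Q: "sem q (\<sigma>(u := int j)) \<tau> \<longleftrightarrow>
          (\<exists>w. eval_rf f (j # xs) w \<and> \<tau> = \<sigma>(u := int j, v := int w))" for j \<tau>
      proof -
        have "map (\<sigma>(u := int j)) (u # ins) = map int (j # xs)"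
          using xs[symmetric] ins by (auto simp: reg)
        then show ?thesis using Z by (subst implementsD[OF q]) (auto simp: reg)
      qed
      have body: "sem ?body (\<sigma>(u := int j)) \<tau>' \<longleftrightarrow>
          (\<exists>w. eval_rf f (j # xs) w \<and> w \<noteq> 0) \<and> \<tau>' = \<sigma>(u := int (Suc j))" for j \<tau>'
      proof -
        have "\<sigma>(u := int j, v := 0, u := int j + 1) = \<sigma>(u := int (Suc j))"
          using Z by (auto simp: reg fun_eq_iff)
        moreover have "sem ?body (\<sigma>(u := int j)) \<tau>' \<longleftrightarrow> (\<exists>w. eval_rf f (j # xs) w \<and>
            sem (Sq (At (Dec v)) (Sq (drain v) (At (Inc u)))) (\<sigma>(u := int j, v := int w)) \<tau>')"
          unfolding sem_Sq[of q] Q by blast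
        moreover have "sem (Sq (At (Dec v)) (Sq (drain v) (At (Inc u)))) (\<sigma>(u := int j, v := int w)) \<tau>'
            \<longleftrightarrow> w \<noteq> 0 \<and> \<tau>' = \<sigma>(u := int j, v := 0, u := int j + 1)" for w
          by (auto simp: reg)
        ultimately have "sem ?body (\<sigma>(u := int j)) \<tau>' \<longleftrightarrow>
            (\<exists>w. eval_rf f (j # xs) w \<and> w \<noteq> 0 \<and> \<tau>' = \<sigma>(u := int (Suc j)))"
          by (simp only:)
        then show ?thesis by blast
      qed
      have "(\<exists>\<tau>. F j \<tau> \<and> sem ?body \<tau> \<tau>') \<longleftrightarrow> F (Suc j) \<tau>'" for j \<tau>'
      proof -
        have "(\<exists>\<tau>. F j \<tau> \<and> sem ?body \<tau> \<tau>') \<longleftrightarrow>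
            (\<forall>u<j. \<exists>v. eval_rf f (u # xs) v \<and> v \<noteq> 0) \<and> sem ?body (\<sigma>(u := int j)) \<tau>'"
          unfolding F_def by blast
        also have "\<dots> \<longleftrightarrow> F (Suc j) \<tau>'"
          unfolding body F_def All_less_Suc by blast
        finally show ?thesis .
      qed
      from sem_Rp_family[of F ?body, OF this]
      have loop: "(\<exists>\<tau>. F 0 \<tau> \<and> sem (Rp ?body) \<tau> \<tau>') \<longleftrightarrow> (\<exists>j. F j \<tau>')" for \<tau>' .
      have "\<sigma>(u := int 0) = \<sigma>" using Z by (auto simp: reg)
      then have init: "F 0 \<tau> \<longleftrightarrow> \<tau> = \<sigma>" for \<tau> by (simp add: F_def)
      have tail: "sem ?tail (\<sigma>(u := int j)) \<sigma>' \<longleftrightarrow>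
          eval_rf f (j # xs) 0 \<and> \<sigma>' = \<sigma>(out := \<sigma> out + int j)" for j
      proof -
        have eq: "\<sigma>(u := int j, v := 0, u := 0, out := \<sigma> out + int j) = \<sigma>(out := \<sigma> out + int j)"
          using Z out(1) by (auto simp: reg fun_eq_iff)
        have "sem ?tail (\<sigma>(u := int j)) \<sigma>' \<longleftrightarrow> (\<exists>w. eval_rf f (j # xs) w \<and>
            sem (Sq (At (Tst v)) (move u out)) (\<sigma>(u := int j, v := int w)) \<sigma>')"
          unfolding sem_Sq[of q] Q by blast
        also have "\<dots> \<longleftrightarrow> eval_rf f (j # xs) 0 \<and>
            \<sigma>' = \<sigma>(u := int j, v := 0, u := 0, out := \<sigma> out + int j)"
        proof -
          have "sem (Sq (At (Tst v)) (move u out)) (\<sigma>(u := int j, v := int w)) \<sigma>' \<longleftrightarrow>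
              w = 0 \<and> \<sigma>' = \<sigma>(u := int j, v := 0, u := 0, out := \<sigma> out + int j)" for w
            using out(1) by (auto simp: reg)
          then show ?thesis by auto
        qed
        finally show ?thesis unfolding eq .
      qed
      have run: "sem (Rp ?body) \<sigma> \<tau> \<longleftrightarrow> (\<exists>j. F j \<tau>)" for \<tau>
      proof -
        have "(\<exists>\<rho>. \<rho> = \<sigma> \<and> sem (Rp ?body) \<rho> \<tau>) \<longleftrightarrow> (\<exists>j. F j \<tau>)"
          using loop[of \<tau>] unfolding init .
        then show ?thesis by (simp only: ex_simps simp_thms)
      qed
      have "sem (Sq (Rp ?body) ?tail) \<sigma> \<sigma>' \<longleftrightarrow> (\<exists>\<tau>. (\<exists>j. F j \<tau>) \<and> sem ?tail \<tau> \<sigma>')"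
        unfolding sem_Sq[of "Rp ?body"] run by (rule refl)
      also have "\<dots> \<longleftrightarrow> (\<exists>j. (\<forall>u<j. \<exists>v. eval_rf f (u # xs) v \<and> v \<noteq> 0) \<and>
          sem ?tail (\<sigma>(u := int j)) \<sigma>')"
        unfolding F_def by blast
      also have "\<dots> \<longleftrightarrow> (\<exists>j. eval_rf (Mn n f) xs j \<and> \<sigma>' = \<sigma>(out := \<sigma> out + int j))"
        unfolding tail eval_Mn_iff[OF lxs] by blast
      finally show "sem (Sq (Rp ?body) ?tail) \<sigma> \<sigma>' \<longleftrightarrow>
        (\<exists>j. eval_rf (Mn n f) xs j \<and> \<sigma>' = \<sigma>(out := \<sigma> out + int j))" .
    qed
    then show ?thesis ..
  qed
qed

lemma implementable_eval_rf: "implementable (eval_rf f)"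
proof (induction f)
  case Z
  have "eval_rf Z xs y \<longleftrightarrow> y = 0" for xs y by (auto elim: eval_Z intro: eval_rf.zero)
  then have "implements Ep ins out b (eval_rf Z)" for ins out b
    by (simp add: implements_def)
  then show ?case unfolding implementable_def by blast
next
  case Sc
  show ?case unfolding implementable_def
  proof (intro allI impI)
    fix ins :: "nat list" and out b :: nat assume *: "set ins \<subseteq> {..<b}" "out < b" "out \<notin> set ins"
    show "\<exists>p. implements p ins out b (eval_rf Sc)"
    proof (cases "\<exists>i. ins = [i]")
      case True
      then obtain i where i: "ins = [i]" ..
      have "eval_rf Sc [x] y \<longleftrightarrow> y = Suc x" for x y by (auto elim: eval_Sc intro: eval_rf.suc)
      then have "implements (Sq (copy i out b) (At (Inc out))) ins out b (eval_rf Sc)"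
        using * i unfolding implements_def by (auto simp: map_eq_Cons_conv algebra_simps)
      then show ?thesis ..
    next
      case False
      then show ?thesis by (intro implements_nowhere) (auto elim!: eval_Sc simp: length_Suc_conv eq_commute[of "Suc 0"])
    qed
  qed
next
  case (Id n i)
  show ?case unfolding implementable_def
  proof (intro allI impI)
    fix ins :: "nat list" and out b :: nat assume *: "set ins \<subseteq> {..<b}" "out < b" "out \<notin> set ins"
    show "\<exists>p. implements p ins out b (eval_rf (Id n i))"
    proof (cases "length ins = n \<and> i < n")
      case True
      have i: "ins ! i < b" "ins ! i \<noteq> out" using * True by (auto dest: nth_mem)
      have "implements (copy (ins ! i) out b) ins out b (eval_rf (Id n i))"
        unfolding implements_def
      proof (intro allI impI)
        fix xs \<sigma> \<sigma>' assume xs: "map \<sigma> ins = map int xs" and Z: "\<forall>r\<ge>b. \<sigma> r = 0"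
        then have "length xs = n" using True by (auto dest: map_eq_imp_length_eq)
        then have "eval_rf (Id n i) xs y \<longleftrightarrow> y = xs ! i" for y
          using True by (auto elim!: eval_Id intro: eval_rf.proj)
        moreover have "\<sigma> (ins ! i) = int (xs ! i)"
          using xs True by (metis map_eq_imp_length_eq nth_map)
        moreover have "sem (copy (ins ! i) out b) \<sigma> \<sigma>' \<longleftrightarrow>
            0 \<le> \<sigma> (ins ! i) \<and> \<sigma>' = \<sigma>(out := \<sigma> out + \<sigma> (ins ! i))"
          using i *(2) Z by (intro sem_copy) simp_all
        ultimately show "sem (copy (ins ! i) out b) \<sigma> \<sigma>' \<longleftrightarrow>
            (\<exists>y. eval_rf (Id n i) xs y \<and> \<sigma>' = \<sigma>(out := \<sigma> out + int y))"
          by simp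
      qed
      then show ?thesis ..
    next
      case False
      then show ?thesis by (intro implements_nowhere) (auto elim!: eval_Id)
    qed
  qed
qed (auto intro: implementable_Cn implementable_Pr implementable_Mn)

text \<open>Draining output and input turns halting into reachability of the all-zero state, which a
  trivial label can express.\<close>

lemma implements_halting:
  assumes q: "implements q [a] b c f" and "a \<noteq> b" "a < c"
  shows "(\<exists>y. f [n] y) \<longleftrightarrow> sem (Sq q (Sq (drain b) (drain a))) ((\<lambda>_. 0)(a := int n)) (\<lambda>_. 0)"
proof -
  define \<sigma> :: "nat \<Rightarrow> int" where "\<sigma> = (\<lambda>_. 0)(a := int n)"
  have Q: "sem q \<sigma> \<tau> \<longleftrightarrow> (\<exists>y. f [n] y \<and> \<tau> = \<sigma>(b := int y))" for \<tau>
    using assms(2,3) by (subst implementsD[OF q, of _ "[n]"]) (simp_all add: \<sigma>_def)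
  have "sem (Sq q (Sq (drain b) (drain a))) \<sigma> \<sigma>' \<longleftrightarrow> (\<exists>y. f [n] y \<and>
      sem (Sq (drain b) (drain a)) (\<sigma>(b := int y)) \<sigma>')" for \<sigma>'
    unfolding sem_Sq[of q] Q by blast
  moreover have "sem (Sq (drain b) (drain a)) (\<sigma>(b := int y)) (\<lambda>_. 0)" for y
  proof -
    have "sem (drain b) (\<sigma>(b := int y)) \<sigma>" "sem (drain a) \<sigma> (\<lambda>_. 0)"
      unfolding sem_drain
      by (intro conjI ext, simp_all add: \<sigma>_def assms(2) assms(2)[symmetric])+
    then show ?thesis unfolding sem_Sq by blast
  qed
  ultimately show ?thesis unfolding \<sigma>_def by blast
qed

lemma halting_program:
  "\<exists>p. \<forall>n. (\<exists>y. eval_rf f [n] y) \<longleftrightarrow> sem p ((\<lambda>_. 0)(0 := int n)) (\<lambda>_. 0)"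
proof -
  have "\<exists>q. implements q [0] (Suc 0) 2 (eval_rf f)"
    by (rule implementableD[OF implementable_eval_rf]) simp_all
  then obtain q where q: "implements q [0] (Suc 0) 2 (eval_rf f)" ..
  have "(0 :: nat) \<noteq> Suc 0" "(0 :: nat) < 2" by simp_all
  from implements_halting[OF q this] show ?thesis by blast
qed

subsection \<open>Automata for regular expressions\<close>

text \<open>A state of the automaton is the list of programs that remain to be run.\<close>

fun edg :: "'a rex \<Rightarrow> 'a rex list \<Rightarrow> ('a rex list \<times> 'a list \<times> 'a rex list) list" where
  "edg (At a) k = [(At a # k, [a], k)]"
| "edg Ep k = [(Ep # k, [], k)]"
| "edg (Sq p q) k = (Sq p q # k, [], p # q # k) # edg p (q # k) @ edg q k"
| "edg (Rp p) k = (Rp p # k, [], k) # (Rp p # k, [], p # Rp p # k) # edg p (Rp p # k)"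

inductive path :: "('s \<times> 'a list \<times> 's) set \<Rightarrow> 's \<Rightarrow> 'a list \<Rightarrow> 's \<Rightarrow> bool" for E where
  nil: "path E s [] s"
| step: "(s, b, t) \<in> E \<Longrightarrow> path E t w u \<Longrightarrow> path E s (b @ w) u"

lemma path_append: "path E s v t \<Longrightarrow> path E t w u \<Longrightarrow> path E s (v @ w) u"
  by (induction rule: path.induct) (auto intro: path.step)

lemma path_edge: "(s, b, t) \<in> E \<Longrightarrow> path E s b t"
  using path.step[OF _ path.nil] by fastforce

lemma path_mono: "path E s w t \<Longrightarrow> E \<subseteq> F \<Longrightarrow> path F s w t"
  by (induction rule: path.induct) (auto intro: path.intros)

lemma lng_path: "lng p w \<Longrightarrow> path (set (edg p k)) (p # k) w k"
proof (induction arbitrary: k rule: lng.induct)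
  case (Sq p u q v)
  let ?E = "set (edg (Sq p q) k)"
  have "path ?E (p # q # k) u (q # k)"
    using Sq.IH(1)[of "q # k"] by (rule path_mono) auto
  moreover have "path ?E (q # k) v k"
    using Sq.IH(2)[of k] by (rule path_mono) auto
  ultimately have "path ?E (p # q # k) (u @ v) k" by (rule path_append)
  then show ?case using path.step[of "Sq p q # k" "[]" "p # q # k" ?E "u @ v" k] by simp
next
  case (RpS p u v)
  let ?E = "set (edg (Rp p) k)"
  have "path ?E (p # Rp p # k) u (Rp p # k)"
    using RpS.IH(1)[of "Rp p # k"] by (rule path_mono) auto
  from path_append[OF this RpS.IH(2)] have "path ?E (p # Rp p # k) (u @ v) k" .
  then show ?case using path.step[of "Rp p # k" "[]" "p # Rp p # k" ?E "u @ v" k] by simp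
qed (auto intro: path_edge)

fun lngs :: "'a rex list \<Rightarrow> 'a list \<Rightarrow> bool" where
  "lngs [] w \<longleftrightarrow> w = []"
| "lngs (p # k) w \<longleftrightarrow> (\<exists>u v. w = u @ v \<and> lng p u \<and> lngs k v)"

text \<open>States that arise from different subterms may coincide. This does no harm, because the
  language accepted from a state depends only on its list of programs.\<close>

lemma lngs_edge: "(s, b, t) \<in> set (edg p k) \<Longrightarrow> lngs t w \<Longrightarrow> lngs s (b @ w)"
proof (induction p arbitrary: k)
  case (At a)
  then have eq: "s = At a # k" "b = [a]" and w: "lngs k w" by auto
  have "lng (At a) [a]" by simp
  with w show ?case unfolding eq lngs.simps by blast
next
  case Ep
  then have eq: "s = Ep # k" "b = []" and w: "lngs k w" by auto
  have "lng (Ep) []" by simp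
  with w show ?case unfolding eq lngs.simps by blast
next
  case (Sq p q)
  consider "s = Sq p q # k" "b = []" "t = p # q # k" | "(s, b, t) \<in> set (edg p (q # k))"
    | "(s, b, t) \<in> set (edg q k)"
    using Sq.prems(1) by auto
  then show ?case
  proof cases
    case 1
    then obtain u v v' where "w = u @ v @ v'" "lng p u" "lng q v" "lngs k v'"
      using Sq.prems(2) by (auto simp: append_assoc)
    then have "w = (u @ v) @ v'" "lng (Sq p q) (u @ v)" "lngs k v'" by (simp_all add: lng.Sq)
    then show ?thesis unfolding 1 lngs.simps append.simps by blast
  qed (use Sq in blast)+
next
  case (Rp p)
  consider "s = Rp p # k" "b = []" "t = k" | "s = Rp p # k" "b = []" "t = p # Rp p # k"
    | "(s, b, t) \<in> set (edg p (Rp p # k))"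
    using Rp.prems(1) by auto
  then show ?case
  proof cases
    case 1
    then have "w = [] @ w" "lng (Rp p) []" "lngs k w" using Rp.prems(2) by (simp_all add: lng.Rp0)
    then show ?thesis unfolding 1 lngs.simps append.simps by blast
  next
    case 2
    then obtain u v v' where "w = u @ v @ v'" "lng p u" "lng (Rp p) v" "lngs k v'"
      using Rp.prems(2) by (auto simp: append_assoc)
    then have "w = (u @ v) @ v'" "lng (Rp p) (u @ v)" "lngs k v'" by (simp_all add: lng.RpS)
    then show ?thesis unfolding 2 lngs.simps append.simps by blast
  qed (use Rp in blast)
qed

lemma path_lngs: "path E s w t \<Longrightarrow> E = set (edg p k) \<Longrightarrow> lngs t v \<Longrightarrow> lngs s (w @ v)"
  by (induction rule: path.induct) (auto dest: lngs_edge)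

lemma path_iff_lng: "path (set (edg p [])) [p] w [] \<longleftrightarrow> lng p w"
proof
  assume "path (set (edg p [])) [p] w []"
  then have "lngs [p] (w @ [])" by (rule path_lngs) simp_all
  then show "lng p w" by simp
qed (rule lng_path)

text \<open>Guarantees that \<open>Ust\<close> has at least one way back to
  \<open>Dst\<close>.\<close>

lemma edg_start: "\<exists>b t. (p # k, b, t) \<in> set (edg p k)"
  by (cases p) auto

text \<open>\<open>Inp\<close> loads the input and \<open>Pop i\<close> removes the trace left by a zero test of counter \<open>i\<close>.\<close>

datatype batom = Ins instr | Pop nat | Inp

fun pops :: "nat \<Rightarrow> batom rex" where
  "pops 0 = Ep"
| "pops (Suc k) = Sq (Rp (At (Pop k))) (pops k)"

definition full :: "instr rex \<Rightarrow> nat \<Rightarrow> batom rex" where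
  "full p k = Sq (At Inp) (Sq (map_rex Ins p) (pops k))"

lemma lng_map: "lng p w \<Longrightarrow> lng (map_rex f p) (map f w)"
  by (induction rule: lng.induct) (auto intro: lng.intros)

lemma lng_mapD: "lng r w \<Longrightarrow> r = map_rex f p \<Longrightarrow> \<exists>v. lng p v \<and> w = map f v"
proof (induction arbitrary: p rule: lng.induct)
  case (At a)
  then obtain b where "p = At b" "a = f b" by (cases p) auto
  then show ?case by (intro exI[of _ "[b]"]) simp
next
  case Ep
  then have "p = Ep" by (cases p) auto
  then show ?case by (intro exI[of _ "[]"]) simp
next
  case (Sq q u r v)
  then obtain q' r' where p: "p = Sq q' r'" "q = map_rex f q'" "r = map_rex f r'" by (cases p) auto
  with Sq.IH obtain u' v' where "lng q' u'" "u = map f u'" "lng r' v'" "v = map f v'" by metis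
  then have "lng p (u' @ v')" "u @ v = map f (u' @ v')" by (simp_all add: p lng.Sq)
  then show ?case by blast
next
  case (Rp0 q)
  then obtain q' where "p = Rp q'" by (cases p) auto
  then show ?case by (intro exI[of _ "[]"]) (simp add: lng.Rp0)
next
  case (RpS q u v)
  then obtain q' where p: "p = Rp q'" "q = map_rex f q'" by (cases p) auto
  with RpS.IH(1)[of q'] RpS.IH(2)[of p] RpS.prems
  obtain u' v' where "lng q' u'" "u = map f u'" "lng p v'" "v = map f v'" by blast
  then have "lng p (u' @ v')" "u @ v = map f (u' @ v')" by (simp_all add: p lng.RpS)
  then show ?case by blast
qed

lemma lng_Rp_At: "lng r w \<Longrightarrow> r = Rp (At a) \<Longrightarrow> set w \<subseteq> {a}"
  by (induction rule: lng.induct) auto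

lemma lng_Rp_At_replicate: "lng (Rp (At a)) (replicate n a)"
proof (induction n)
  case (Suc n)
  then show ?case using lng.RpS[of "At a" "[a]" "replicate n a"] by simp
qed (simp add: lng.Rp0)

lemma lng_pops: "lng (pops k) w \<Longrightarrow> set w \<subseteq> range Pop"
proof (induction k arbitrary: w)
  case (Suc k)
  then obtain u v where "w = u @ v" "lng (Rp (At (Pop k))) u" "lng (pops k) v"
    by (auto simp: lng_Sq_iff)
  with Suc.IH lng_Rp_At[of _ u "Pop k"] show ?case by auto
qed simp

lemma lng_pops_replicate:
  "lng (pops k) (concat (map (\<lambda>i. replicate (m i) (Pop i)) (rev [0..<k])))"
  by (induction k) (auto intro!: lng.Sq lng_Rp_At_replicate)

lemma lng_full: "lng (full p k) w \<longleftrightarrow>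
    (\<exists>u v. w = Inp # map Ins u @ v \<and> lng p u \<and> lng (pops k) v)"
proof
  assume "lng (full p k) w"
  then obtain u v where "w = Inp # u @ v" "lng (map_rex Ins p) u" "lng (pops k) v"
    unfolding full_def lng_Sq_iff lng_At_iff by auto
  with lng_mapD show "\<exists>u v. w = Inp # map Ins u @ v \<and> lng p u \<and> lng (pops k) v" by blast
next
  assume "\<exists>u v. w = Inp # map Ins u @ v \<and> lng p u \<and> lng (pops k) v"
  then obtain u v where "w = Inp # map Ins u @ v" "lng p u" "lng (pops k) v" by blast
  then have "w = [Inp] @ map Ins u @ v" "lng (At Inp) [Inp]" "lng (map_rex Ins p) (map Ins u)"
    "lng (pops k) v"
    by (simp_all add: lng_map)
  then show "lng (full p k) w" unfolding full_def by (metis lng.Sq)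
qed

subsection \<open>The generators\<close>

text \<open>A zero test of counter \<open>i\<close> appends \<open>CY i\<close>: since increments and decrements append powers of
  \<open>CA i\<close>, the blocks between consecutive tests must vanish for the product to be a power of
  \<open>CY i\<close>, which the \<open>Pop\<close> phase then cancels. The letters \<open>Dst\<close>, \<open>Ust\<close> and \<open>Pst ps\<close> are tokens
  for the states of an automaton: an edge \<open>(s, b, t)\<close> gives the relator \<open>- s + b + t - b\<close>.\<close>

datatype letter = CA nat | CY nat | CH | LT | LZ | Dst | Ust | Pst "batom rex list"

instance rex :: (countable) countable by countable_datatype
instance instr :: countable by countable_datatype
instance batom :: countable by countable_datatype
instance letter :: countable by countable_datatype

type_synonym word = "(letter \<times> bool) list"

fun lab :: "batom \<Rightarrow> letter \<times> bool" where
  "lab (Ins (Inc i)) = (CA i, True)"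
| "lab (Ins (Dec i)) = (CA i, False)"
| "lab (Ins (Tst i)) = (CY i, True)"
| "lab (Pop i) = (CY i, False)"
| "lab Inp = (CH, True)"

definition inv_word :: "('a \<times> bool) list \<Rightarrow> ('a \<times> bool) list" where
  "inv_word w = rev (map (\<lambda>l. (fst l, \<not> snd l)) w)"

text \<open>The loop \<open>Dst \<rightarrow> Pst [p] \<rightarrow>\<^sup>* Pst [] \<rightarrow> Ust \<rightarrow> Pst q \<rightarrow> Pst q' \<rightarrow> Dst\<close> runs the program between two
  letters \<open>LT\<close> and then uses an arbitrary edge \<open>q \<rightarrow> q'\<close>, so that all edges become invertible as soon as
  the program has a run with trivial label. The letter \<open>LZ\<close> of order three marks the other ways of
  reaching the edges that carry \<open>LT\<close>.\<close>

definition edges :: "batom rex \<Rightarrow> (letter \<times> word \<times> letter) set" where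
  "edges p = {(Dst, [(LT, True)], Pst [p]), (Pst [], [(LT, False)], Ust)} \<union>
     (\<Union>(q, b, q') \<in> set (edg p []). {(Pst q, map lab b, Pst q'), (Ust, [(LZ, True)], Pst q),
        (Pst q', inv_word (map lab b) @ [(LZ, True)], Dst)})"

definition relator :: "letter \<times> word \<times> letter \<Rightarrow> word" where
  "relator e = (case e of (s, b, t) \<Rightarrow> (s, False) # b @ (t, True) # inv_word b)"

subsection \<open>Free generators among rational unit quaternions\<close>

text \<open>Generic in the ring: products are taken over the rationals, over the reals and, for
  numerators, over the integers.\<close>

definition qm :: "'a \<times> 'a \<times> 'a \<times> 'a \<Rightarrow> 'a \<times> 'a \<times> 'a \<times> 'a \<Rightarrow> 'a::comm_ring_1 \<times> 'a \<times> 'a \<times> 'a" where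
  "qm p q = (case p of (a1, b1, c1, d1) \<Rightarrow> case q of (a2, b2, c2, d2) \<Rightarrow>
     (a1*a2 - b1*b2 - c1*c2 - d1*d2,
      a1*b2 + b1*a2 + c1*d2 - d1*c2,
      a1*c2 - b1*d2 + c1*a2 + d1*b2,
      a1*d2 + b1*c2 - c1*b2 + d1*a2))"

definition qcnj :: "'a \<times> 'a \<times> 'a \<times> 'a \<Rightarrow> 'a::comm_ring_1 \<times> 'a \<times> 'a \<times> 'a" where
  "qcnj q = (case q of (a, b, c, d) \<Rightarrow> (a, - b, - c, - d))"

definition qnorm :: "'a \<times> 'a \<times> 'a \<times> 'a \<Rightarrow> 'a::comm_ring_1" where
  "qnorm q = (case q of (a, b, c, d) \<Rightarrow> a\<^sup>2 + b\<^sup>2 + c\<^sup>2 + d\<^sup>2)"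

lemma qm_assoc: "qm (qm p q) r = qm p (qm q r)"
  by (cases p; cases q; cases r) (simp add: qm_def algebra_simps)

lemma qm_1 [simp]: "qm (1, 0, 0, 0) q = q" "qm q (1, 0, 0, 0) = q"
  by (cases q; simp add: qm_def)+

lemma qnorm_qm: "qnorm (qm p q) = qnorm p * qnorm q"
  by (cases p; cases q) (simp add: qm_def qnorm_def power2_eq_square algebra_simps)

lemma qnorm_qcnj [simp]: "qnorm (qcnj q) = qnorm q"
  by (cases q) (simp add: qnorm_def qcnj_def)

lemma qm_qcnj: "qm (qcnj q) q = (qnorm q, 0, 0, 0)" "qm q (qcnj q) = (qnorm q, 0, 0, 0)"
  by (cases q; simp add: qm_def qnorm_def qcnj_def power2_eq_square algebra_simps)+

lemma qcnj_qm: "qcnj (qm p q) = qm (qcnj q) (qcnj p)"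
  by (cases p; cases q) (simp add: qm_def qcnj_def algebra_simps)

text \<open>The group of rational unit quaternions is written additively, because \<open>group_add\<close> is the
  type class of not necessarily commutative groups.\<close>

typedef uquat = "{q :: rquat. qnorm q = 1}"
  by (rule exI[of _ "(1, 0, 0, 0)"]) (simp add: qnorm_def)

setup_lifting type_definition_uquat

instantiation uquat :: group_add
begin
lift_definition zero_uquat :: uquat is "(1, 0, 0, 0)" by (simp add: qnorm_def)
lift_definition plus_uquat :: "uquat \<Rightarrow> uquat \<Rightarrow> uquat" is qm by (simp add: qnorm_qm)
lift_definition uminus_uquat :: "uquat \<Rightarrow> uquat" is qcnj by simp
definition minus_uquat :: "uquat \<Rightarrow> uquat \<Rightarrow> uquat" where "minus_uquat a b = a + - b"
instance
proof
  fix a b c :: uquat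
  show "a + b + c = a + (b + c)" by transfer (rule qm_assoc)
  show "0 + a = a" "a + 0 = a" by (transfer, simp)+
  show "- a + a = 0" by transfer (simp add: qm_qcnj)
  show "a + - b = a - b" by (simp add: minus_uquat_def)
qed
end

text \<open>The quaternion -1. The pair \<open>(uneg, uneg)\<close> acts as the identity, so a free
  subgroup must also avoid this element.\<close>

lift_definition uneg :: uquat is "(-1, 0, 0, 0)" by (simp add: qnorm_def)

section \<open>Rotations and the kernel of the action\<close>

lemma unit_rquat_Rep: "unit_rquat (Rep_uquat a)"
  using Rep_uquat[of a] by (auto simp: unit_rquat_def qnorm_def split: prod.splits)

definition rot :: "uquat \<times> uquat \<Rightarrow> quat \<Rightarrow> quat" where
  "rot g = rotation (Rep_uquat (fst g)) (Rep_uquat (snd g))"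

lemma rot_apply:
  "rot (a, b) q = qm (qm (quat_of_rquat (Rep_uquat a)) q) (qcnj (quat_of_rquat (Rep_uquat b)))"
proof -
  have qmult: "qmult = qm" by (intro ext) (simp add: qmult_def qm_def)
  obtain b1 b2 b3 b4 where b: "Rep_uquat b = (b1, b2, b3, b4)" by (cases "Rep_uquat b")
  have "b1\<^sup>2 + b2\<^sup>2 + b3\<^sup>2 + b4\<^sup>2 = 1"
    using Rep_uquat[of b] by (simp add: b qnorm_def)
  then have "(of_rat (b1\<^sup>2 + b2\<^sup>2 + b3\<^sup>2 + b4\<^sup>2) :: real) = 1" by simp
  then have "qinv (quat_of_rquat (Rep_uquat b)) = qcnj (quat_of_rquat (Rep_uquat b))"
    by (simp add: b qinv_def qcnj_def quat_of_rquat_def of_rat_add of_rat_power)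
  then show ?thesis by (simp add: rot_def rotation_def qmult)
qed

lemma quat_of_rquat_qm: "quat_of_rquat (qm p q) = qm (quat_of_rquat p) (quat_of_rquat q)"
  by (cases p; cases q) (simp add: quat_of_rquat_def qm_def of_rat_add of_rat_diff of_rat_mult)

lemma quat_of_rquat_eq_iff: "quat_of_rquat p = quat_of_rquat q \<longleftrightarrow> p = q"
  by (cases p; cases q) (simp add: quat_of_rquat_def)

lemma rot_add: "rot (a + a', b + b') = rot (a, b) \<circ> rot (a', b')"
  by (rule ext) (simp add: rot_apply plus_uquat.rep_eq quat_of_rquat_qm qcnj_qm qm_assoc)

lemma rot_0: "rot (0, 0) = id"
  by (rule ext) (simp add: rot_apply zero_uquat.rep_eq quat_of_rquat_def qcnj_def)

text \<open>Evaluating at 1 gives equal components, commuting with i and j makes them real, and norm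
  one leaves 1 and -1.\<close>

lemma rot_eq_idD:
  assumes "rot (a, b) = id"
  shows "a = b \<and> (a = 0 \<or> a = uneg)"
proof -
  obtain a1 a2 a3 a4 where a: "quat_of_rquat (Rep_uquat a) = (a1, a2, a3, a4)"
    by (cases "quat_of_rquat (Rep_uquat a)")
  define B where "B = quat_of_rquat (Rep_uquat b)"
  obtain r1 r2 r3 r4 where r: "Rep_uquat a = (r1, r2, r3, r4)" by (cases "Rep_uquat a")
  have "qnorm (Rep_uquat b) = 1" using Rep_uquat[of b] by simp
  then have B1: "qm (qcnj B) B = (1, 0, 0, 0)"
    by (cases "Rep_uquat b")
       (simp add: qm_qcnj B_def qnorm_def quat_of_rquat_def
         flip: of_rat_power of_rat_add)
  have *: "qm (quat_of_rquat (Rep_uquat a)) q = qm q B" for q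
  proof -
    have "qm (qm (quat_of_rquat (Rep_uquat a)) q) (qcnj B) = q"
      using fun_cong[OF assms, of q] by (simp add: rot_apply B_def)
    then have "qm (qm (qm (quat_of_rquat (Rep_uquat a)) q) (qcnj B)) B = qm q B" by simp
    then show ?thesis by (simp add: qm_assoc B1)
  qed
  from *[of "(1, 0, 0, 0)"] have aB: "quat_of_rquat (Rep_uquat a) = B" by simp
  then have ab: "a = b"
    unfolding B_def quat_of_rquat_eq_iff Rep_uquat_inject .
  have "a3 = 0" "a4 = 0" "a2 = 0"
    using *[of "(0, 1, 0, 0)"] *[of "(0, 0, 1, 0)"] unfolding aB[symmetric] a
    by (simp_all add: qm_def)
  then have z: "r2 = 0" "r3 = 0" "r4 = 0"
    using a by (auto simp: r quat_of_rquat_def)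
  moreover have "qnorm (Rep_uquat a) = 1" using Rep_uquat[of a] by simp
  ultimately have "r1 = 1 \<or> r1 = - 1" by (simp add: r qnorm_def power2_eq_1_iff)
  then have "Rep_uquat a = Rep_uquat 0 \<or> Rep_uquat a = Rep_uquat uneg"
    by (auto simp: r z zero_uquat.rep_eq uneg.rep_eq)
  with ab show ?thesis by (simp add: Rep_uquat_inject)
qed

text \<open>A pair \<open>(True, s)\<close> stands for \<open>A\<^sup>\<plusminus>\<^sup>1\<close> and \<open>(False, s)\<close> for \<open>B\<^sup>\<plusminus>\<^sup>1\<close>, where
  \<open>A = (3 + 4i)/5\<close> and \<open>B = (3 + 4j)/5\<close>.\<close>

fun num2 :: "bool \<times> bool \<Rightarrow> int \<times> int \<times> int \<times> int" where
  "num2 (True, s) = (3, if s then 4 else - 4, 0, 0)"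
| "num2 (False, s) = (3, 0, if s then 4 else - 4, 0)"

lift_definition quat2 :: "bool \<times> bool \<Rightarrow> uquat" is
  "\<lambda>l. case num2 l of (a, b, c, d) \<Rightarrow> (of_int a / 5, of_int b / 5, of_int c / 5, of_int d / 5)"
  subgoal for l
    by (cases l rule: num2.cases) (auto simp: qnorm_def power2_eq_square)
  done

lemma quat2_inverse: "quat2 (g, \<not> s) = - quat2 (g, s)"
proof -
  have "Rep_uquat (quat2 (g, \<not> s)) = Rep_uquat (- quat2 (g, s))"
    by (cases g) (simp_all add: quat2.rep_eq uminus_uquat.rep_eq qcnj_def)
  then show ?thesis by (simp only: Rep_uquat_inject)
qed

abbreviation val2 :: "(bool \<times> bool) list \<Rightarrow> uquat" where
  "val2 w \<equiv> sum_list (map quat2 w)"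

fun nval2 :: "(bool \<times> bool) list \<Rightarrow> int \<times> int \<times> int \<times> int" where
  "nval2 [] = (1, 0, 0, 0)"
| "nval2 (l # w) = qm (num2 l) (nval2 w)"

lemma Rep_val2: "Rep_uquat (val2 w) = (case nval2 w of (a, b, c, d) \<Rightarrow>
    (of_int a / 5 ^ length w, of_int b / 5 ^ length w, of_int c / 5 ^ length w, of_int d / 5 ^ length w))"
proof (induction w)
  case Nil
  show ?case by (simp add: zero_uquat.rep_eq)
next
  case (Cons l w)
  obtain a b c d where "nval2 w = (a, b, c, d)" by (cases "nval2 w")
  moreover obtain a' b' c' d' where "num2 l = (a', b', c', d')" by (cases "num2 l")
  ultimately show ?case using Cons
    by (simp add: plus_uquat.rep_eq quat2.rep_eq qm_def field_simps)
qed

text \<open>Modulo 5 a nonempty reduced word lies in the right ideal generated by its first letter, which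
  has rank one, and it is nonzero there, because two letters that are not inverse to each other have a
  nonzero product modulo 5.\<close>

fun starts_with :: "bool \<times> bool \<Rightarrow> int \<times> int \<times> int \<times> int \<Rightarrow> bool" where
  "starts_with (True, True) (a, b, c, d) \<longleftrightarrow> 5 dvd b + 2 * a \<and> 5 dvd d + 2 * c \<and> \<not> (5 dvd a \<and> 5 dvd c)"
| "starts_with (True, False) (a, b, c, d) \<longleftrightarrow> 5 dvd b - 2 * a \<and> 5 dvd d - 2 * c \<and> \<not> (5 dvd a \<and> 5 dvd c)"
| "starts_with (False, True) (a, b, c, d) \<longleftrightarrow> 5 dvd c + 2 * a \<and> 5 dvd d - 2 * b \<and> \<not> (5 dvd a \<and> 5 dvd b)"
| "starts_with (False, False) (a, b, c, d) \<longleftrightarrow> 5 dvd c - 2 * a \<and> 5 dvd d + 2 * b \<and> \<not> (5 dvd a \<and> 5 dvd b)"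

abbreviation inv_letter :: "'a \<times> bool \<Rightarrow> 'a \<times> bool" where
  "inv_letter l \<equiv> (fst l, \<not> snd l)"

fun reduced :: "('a \<times> bool) list \<Rightarrow> bool" where
  "reduced (l # m # w) \<longleftrightarrow> m \<noteq> inv_letter l \<and> reduced (m # w)"
| "reduced _ \<longleftrightarrow> True"

text \<open>Congruence modulo 5 with an explicit quotient, which turns modular reasoning into ring
  identities.\<close>

definition add5 :: "int \<times> int \<times> int \<times> int \<Rightarrow> int \<times> int \<times> int \<times> int \<Rightarrow> int \<times> int \<times> int \<times> int" where
  "add5 q r = (case q of (a, b, c, d) \<Rightarrow> case r of (a', b', c', d') \<Rightarrow>
     (a + 5 * a', b + 5 * b', c + 5 * c', d + 5 * d'))"

lemma qm_add5: "qm p (add5 q r) = add5 (qm p q) (qm p r)"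
  by (cases p; cases q; cases r) (simp add: qm_def add5_def algebra_simps)

lemma starts_with_add5: "starts_with l (add5 q r) \<longleftrightarrow> starts_with l q"
proof -
  have *: "5 dvd x + 5 * y \<longleftrightarrow> 5 dvd x" for x y :: int by presburger
  have 5: "5 dvd x + 5 * y \<longleftrightarrow> 5 dvd x"
    "5 dvd x + 5 * y + 2 * (z + 5 * w) \<longleftrightarrow> 5 dvd x + 2 * z"
    "5 dvd x + 5 * y - 2 * (z + 5 * w) \<longleftrightarrow> 5 dvd x - 2 * z" for x y z w :: int
    using *[of x y] *[of "x + 2 * z" "y + 2 * w"] *[of "x - 2 * z" "y - 2 * w"]
    by (simp_all add: algebra_simps)
  show ?thesis
    by (cases "(l, q)" rule: starts_with.cases; cases r) (simp_all add: add5_def 5 del: distrib_left_numeral)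
qed

text \<open>Modulo 5 the numerator 3 + 4i is 3(1 - 2i). The first clause lists the products of 1 -
  2i or 1 + 2i with x + yj, the second those of 1 - 2j or 1 + 2j with x + yi.\<close>

fun residue :: "bool \<times> bool \<Rightarrow> int \<Rightarrow> int \<Rightarrow> int \<times> int \<times> int \<times> int" where
  "residue (True, s) x y = (if s then (x, - 2 * x, y, - 2 * y) else (x, 2 * x, y, 2 * y))"
| "residue (False, s) x y = (if s then (x, y, - 2 * x, 2 * y) else (x, y, 2 * x, - 2 * y))"

lemma starts_with_residue:
  "starts_with m q \<Longrightarrow> \<exists>x y r. q = add5 (residue m x y) r \<and> \<not> (5 dvd x \<and> 5 dvd y)"
proof (cases "(m, q)" rule: starts_with.cases)
  case (1 a b c d)
  assume "starts_with m q"
  then obtain u v where "b + 2 * a = 5 * u" "d + 2 * c = 5 * v" "\<not> (5 dvd a \<and> 5 dvd c)"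
    using 1 by (auto elim!: dvdE)
  then show ?thesis using 1
    by (intro exI[of _ a] exI[of _ c] exI[of _ "(0, u, 0, v)"]) (simp add: add5_def)
next
  case (2 a b c d)
  assume "starts_with m q"
  then obtain u v where "b - 2 * a = 5 * u" "d - 2 * c = 5 * v" "\<not> (5 dvd a \<and> 5 dvd c)"
    using 2 by (auto elim!: dvdE)
  then show ?thesis using 2
    by (intro exI[of _ a] exI[of _ c] exI[of _ "(0, u, 0, v)"]) (simp add: add5_def)
next
  case (3 a b c d)
  assume "starts_with m q"
  then obtain u v where "c + 2 * a = 5 * u" "d - 2 * b = 5 * v" "\<not> (5 dvd a \<and> 5 dvd b)"
    using 3 by (auto elim!: dvdE)
  then show ?thesis using 3
    by (intro exI[of _ a] exI[of _ b] exI[of _ "(0, 0, u, v)"]) (simp add: add5_def)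
next
  case (4 a b c d)
  assume "starts_with m q"
  then obtain u v where "c - 2 * a = 5 * u" "d + 2 * b = 5 * v" "\<not> (5 dvd a \<and> 5 dvd b)"
    using 4 by (auto elim!: dvdE)
  then show ?thesis using 4
    by (intro exI[of _ a] exI[of _ b] exI[of _ "(0, 0, u, v)"]) (simp add: add5_def)
qed

lemma residue_add5: "residue m (x + 5 * x') (y + 5 * y') = add5 (residue m x y) (residue m x' y')"
  by (cases m; cases "fst m"; cases "snd m") (simp_all add: add5_def)

text \<open>A finite check: 12 pairs of letters that do not cancel, 24 nonzero residues
  each.\<close>

lemma starts_with_mult_residue:
  assumes "m \<noteq> inv_letter l"
  shows "\<forall>x\<in>{0, 1, 2, 3, 4}. \<forall>y\<in>{0, 1, 2, 3, 4}. x \<noteq> 0 \<or> y \<noteq> 0 \<longrightarrow>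
    starts_with l (qm (num2 l) (residue m x y))"
proof -
  obtain g s where l: "l = (g, s)" by (cases l)
  obtain h t where m: "m = (h, t)" by (cases m)
  show ?thesis
    using assms unfolding l m by (cases g; cases s; cases h; cases t) (simp_all add: qm_def)
qed

lemma starts_with_mult:
  assumes "starts_with m q" "m \<noteq> inv_letter l"
  shows "starts_with l (qm (num2 l) q)"
proof -
  obtain x y r where q: "q = add5 (residue m x y) r" and xy: "\<not> (5 dvd x \<and> 5 dvd y)"
    using starts_with_residue[OF assms(1)] by blast
  have "residue m x y = add5 (residue m (x mod 5) (y mod 5)) (residue m (x div 5) (y div 5))"
    by (subst residue_add5[symmetric]) simp
  moreover have "x mod 5 \<in> {0, 1, 2, 3, 4}" "y mod 5 \<in> {0, 1, 2, 3, 4}"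
    unfolding insert_iff empty_iff by presburger+
  moreover have "x mod 5 \<noteq> 0 \<or> y mod 5 \<noteq> 0" using xy by (simp add: dvd_eq_mod_eq_0)
  ultimately have "starts_with l (qm (num2 l) (residue m x y))"
    using starts_with_mult_residue[OF assms(2)] by (simp only: qm_add5 starts_with_add5)
  then show ?thesis by (simp add: q qm_add5 starts_with_add5)
qed

lemma starts_with_reduced: "reduced (l # w) \<Longrightarrow> starts_with l (nval2 (l # w))"
proof (induction w arbitrary: l)
  case Nil
  show ?case by (cases l rule: num2.cases) (auto simp: qm_def split: if_splits)
next
  case (Cons m w)
  then show ?case using starts_with_mult[of m "nval2 (m # w)" l] by simp
qed

text \<open>Value 1 or -1 would make the numerator of a nonempty word plus or minus
  \<open>5 ^ length w\<close>, with all four coordinates divisible by 5.\<close>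

lemma reduced_val2:
  assumes "reduced w" "val2 w = 0 \<or> val2 w = uneg"
  shows "w = []"
proof (cases w)
  case (Cons l v)
  obtain a b c d where n: "nval2 w = (a, b, c, d)" by (cases "nval2 w")
  have "Rep_uquat (val2 w) = (of_int 1, 0, 0, 0) \<or> Rep_uquat (val2 w) = (of_int (- 1), 0, 0, 0)"
    using assms(2) by (elim disjE) (simp_all add: zero_uquat.rep_eq uneg.rep_eq)
  then obtain e :: int where e: "Rep_uquat (val2 w) = (of_int e, 0, 0, 0)" by blast
  have 0: "b = 0" "c = 0" using e by (simp_all add: Rep_val2 n)
  have "rat_of_int a / 5 ^ length w = of_int e" using e by (simp add: Rep_val2 n)
  then have "rat_of_int a = of_int (e * 5 ^ length w)" by (simp add: divide_eq_eq)
  then have "a = e * 5 ^ length w" by (simp only: of_int_eq_iff)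
  then have "5 dvd a" by (simp add: Cons)
  moreover have "starts_with l (a, b, c, d)"
    using starts_with_reduced[of l v] assms(1) n Cons by simp
  ultimately have False using 0
    by (cases l; cases "fst l"; cases "snd l") simp_all
  then show ?thesis ..
qed

fun push_letter :: "'a \<times> bool \<Rightarrow> ('a \<times> bool) list \<Rightarrow> ('a \<times> bool) list" where
  "push_letter l [] = [l]"
| "push_letter l (m # w) = (if m = inv_letter l then w else l # m # w)"

definition reduce :: "('a \<times> bool) list \<Rightarrow> ('a \<times> bool) list" where
  "reduce w = foldr push_letter w []"

lemma reduced_tl: "reduced (l # w) \<Longrightarrow> reduced w"
  by (cases w) auto

lemma reduced_reduce: "reduced (reduce w)"
proof -
  have "reduced v \<Longrightarrow> reduced (push_letter l v)" for l :: "'a \<times> bool" and v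
    by (cases v) (auto dest: reduced_tl)
  then show ?thesis unfolding reduce_def by (induction w) auto
qed

lemma val2_reduce: "val2 (reduce w) = val2 w"
proof -
  have "val2 (push_letter l v) = quat2 l + val2 v" for l v
  proof (cases "(l, v)" rule: push_letter.cases)
    case (2 l' m w)
    have "quat2 l + quat2 (inv_letter l) = 0"
      using quat2_inverse[of "fst l" "snd l"] by simp
    then show ?thesis using 2 by (simp flip: add.assoc)
  qed simp
  then show ?thesis unfolding reduce_def by (induction w) simp_all
qed

text \<open>Inverse letters need to cancel on \<open>V\<close> only, because \<open>flip\<close> is
  an involution only on valid configurations.\<close>

lemma fold_reduce:
  assumes V: "\<And>l x. V x \<Longrightarrow> V (f l x)" and inv: "\<And>l x. V x \<Longrightarrow> f (inv_letter l) (f l x) = x"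
  shows "V x \<Longrightarrow> fold f (reduce w) x = fold f w x"
proof -
  have push: "V x \<Longrightarrow> fold f (push_letter l v) x = fold f v (f l x)" for l v x
    by (cases "(l, v)" rule: push_letter.cases) (auto simp: inv)
  show "V x \<Longrightarrow> ?thesis"
    unfolding reduce_def by (induction w arbitrary: x) (simp_all add: push V)
qed

text \<open>The elements \<open>B\<^sup>k A B\<^sup>-\<^sup>k\<close> generate a free group of infinite rank.\<close>

fun expand :: "nat \<times> bool \<Rightarrow> (bool \<times> bool) list" where
  "expand (k, s) = replicate k (False, True) @ [(True, s)] @ replicate k (False, False)"

definition lval :: "nat \<times> bool \<Rightarrow> uquat" where
  "lval l = val2 (expand l)"

abbreviation wval :: "(nat \<times> bool) list \<Rightarrow> uquat" where
  "wval w \<equiv> sum_list (map lval w)"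

lemma lval_inverse: "lval (k, \<not> s) = - lval (k, s)"
proof -
  have *: "val2 (replicate k (False, False)) = - val2 (replicate k (False, True))"
  proof (induction k)
    case (Suc k)
    have "replicate (Suc k) (False, False) = replicate k (False, False) @ [(False, False)]"
      by (simp only: replicate_append_same replicate_Suc)
    then have "val2 (replicate (Suc k) (False, False)) =
        val2 (replicate k (False, False)) + quat2 (False, False)"
      by (simp only: map_append sum_list_append list.map sum_list.Cons sum_list.Nil add_0_right)
    also have "\<dots> = - val2 (replicate k (False, True)) + - quat2 (False, True)"
      unfolding Suc using quat2_inverse[of False True] by simp
    also have "\<dots> = - val2 (replicate (Suc k) (False, True))"
      by (simp only: minus_add replicate_Suc list.map sum_list.Cons)
    finally show ?case .
  qed simp
  show ?thesis
    unfolding lval_def expand.simps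
    by (simp only: * map_append sum_list_append list.map sum_list.Cons sum_list.Nil add_0_right
        quat2_inverse minus_add minus_minus add.assoc)
qed

text \<open>Universal property of the elements \<open>lval l\<close>: an action of the numbered
  letters extends to one of A and B on pairs of an integer and a point, where B shifts the integer
  and A at position k acts as letter k. The reduced word in A and B is empty, so it acts
  trivially.\<close>

lemma free_action:
  assumes V: "\<And>l x. V x \<Longrightarrow> V (f l x)" and inv: "\<And>l x. V x \<Longrightarrow> f (inv_letter l) (f l x) = x"
    and w: "wval w = 0 \<or> wval w = uneg" and x: "V x"
  shows "fold f w x = x"
proof -
  \<comment> \<open>Below position 0 the letter A does nothing; \<open>expand\<close> never goes
    there from 0.\<close>
  define F :: "bool \<times> bool \<Rightarrow> int \<times> 'a \<Rightarrow> int \<times> 'a" where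
    "F l y = (if fst l then (fst y, if 0 \<le> fst y then f (nat (fst y), snd l) (snd y) else snd y)
        else (fst y + (if snd l then 1 else - 1), snd y))" for l y
  have up: "fold F (replicate k (False, True)) (j, y) = (j + int k, y)" for j k y
    by (induction k arbitrary: j) (simp_all add: F_def)
  have down: "fold F (replicate k (False, False)) (j, y) = (j - int k, y)" for j k y
    by (induction k arbitrary: j) (simp_all add: F_def)
  have A: "F (True, s) (int k, y) = (int k, f (k, s) y)" for k s y by (simp add: F_def)
  have "fold F (expand l) (0, y) = (0, f l y)" for l y
    by (cases l) (simp add: up down A del: fold_replicate)
  then have expand: "fold F (concat (map expand w)) (0, y) = (0, fold f w y)" for w y
    by (induction w arbitrary: y) simp_all
  have "val2 (concat (map expand w)) = wval w" for w
    by (induction w) (simp_all add: lval_def)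
  with w have "val2 (reduce (concat (map expand w))) = 0 \<or>
      val2 (reduce (concat (map expand w))) = uneg"
    by (simp add: val2_reduce)
  then have "reduce (concat (map expand w)) = []"
    by (intro reduced_val2 reduced_reduce)
  moreover have "fold F (reduce (concat (map expand w))) (0, x) = fold F (concat (map expand w)) (0, x)"
  proof (rule fold_reduce[where V = "\<lambda>y. V (snd y)"])
    fix l and y :: "int \<times> 'a" assume y: "V (snd y)"
    then show "V (snd (F l y))" by (simp add: F_def V)
    obtain g s where l: "l = (g, s)" by (cases l)
    have "f (k, \<not> s) (f (k, s) (snd y)) = snd y" for k
      using inv[OF y, of "(k, s)"] by simp
    then show "F (inv_letter l) (F l y) = y"
      by (cases s) (simp_all add: F_def l prod_eq_iff)
  qed (simp add: x)
  ultimately show ?thesis by (simp add: expand)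
qed

subsection \<open>Circulations\<close>

lemma sum_list_swap:
  "(\<Sum>v\<in>V. f v * sum_list (map (\<lambda>r. g r v) R)) = sum_list (map (\<lambda>r. \<Sum>v\<in>V. f v * g r v) R)"
  for f :: "'v \<Rightarrow> int"
  by (induction R) (simp_all add: distrib_left sum.distrib)

lemma circulation:
  fixes R :: "('v \<times> 'v) list"
  assumes bal: "\<And>v. sum_list (map (\<lambda>(a, b). of_bool (v = b) - of_bool (v = a)) R) = (0 :: int)"
    and e: "(a0, b0) \<in> set R"
  shows "(b0, a0) \<in> (set R)\<^sup>*"
proof -
  \<comment> \<open>The indicator of the points reachable from \<open>b0\<close>. It cannot decrease
    along an edge, and weighting the balance with it makes the total increase 0; hence it is
    constant along each edge.\<close>
  define \<chi> :: "'v \<Rightarrow> int" where "\<chi> v = of_bool ((b0, v) \<in> (set R)\<^sup>*)" for v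
  define V where "V = fst ` set R \<union> snd ` set R"
  have V: "finite V" unfolding V_def by simp
  have "sum_list (map (\<lambda>r. \<Sum>v\<in>V. \<chi> v * (case r of (a, b) \<Rightarrow> of_bool (v = b) - of_bool (v = a))) R) =
      (\<Sum>v\<in>V. \<chi> v * sum_list (map (\<lambda>(a, b). of_bool (v = b) - of_bool (v = a)) R))"
    by (rule sum_list_swap[symmetric])
  also have "\<dots> = 0" by (simp add: bal)
  also have "map (\<lambda>r. \<Sum>v\<in>V. \<chi> v * (case r of (a, b) \<Rightarrow> of_bool (v = b) - of_bool (v = a))) R =
      map (\<lambda>(a, b). \<chi> b - \<chi> a) R"
  proof (rule map_cong[OF refl])
    fix r assume r: "r \<in> set R"
    obtain a b where ab: "r = (a, b)" by (cases r)
    have "a \<in> V" "b \<in> V" using r unfolding V_def ab by force+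
    then show "(\<Sum>v\<in>V. \<chi> v * (case r of (a, b) \<Rightarrow> of_bool (v = b) - of_bool (v = a))) =
        (case r of (a, b) \<Rightarrow> \<chi> b - \<chi> a)"
    proof -
      have "(\<Sum>v\<in>V. \<chi> v * of_bool (v = c)) = \<chi> c" if "c \<in> V" for c
      proof -
        have "(\<Sum>v\<in>V. \<chi> v * of_bool (v = c)) = (\<Sum>v\<in>V. if v = c then \<chi> v else 0)"
          by (intro sum.cong) auto
        then show ?thesis using V that by simp
      qed
      then show ?thesis
        using \<open>a \<in> V\<close> \<open>b \<in> V\<close> by (simp add: ab right_diff_distrib sum_subtractf)
    qed
  qed
  finally have sum: "sum_list (map (\<lambda>(a, b). \<chi> b - \<chi> a) R) = 0" .
  have nonneg: "\<chi> a \<le> \<chi> b" if "(a, b) \<in> set R" for a b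
    using that by (auto simp: \<chi>_def intro: rtrancl_into_rtrancl)
  have "\<forall>x\<in>set (map (\<lambda>(a, b). \<chi> b - \<chi> a) R). x = 0"
    by (rule iffD1[OF sum_list_nonneg_eq_0_iff sum]) (use nonneg in auto)
  then have "\<chi> a0 = \<chi> b0" using e by auto
  then show ?thesis by (simp add: \<chi>_def)
qed

subsection \<open>Actions of the letters\<close>

text \<open>A copy of \<open>\<int> \<wr> \<int>\<close> for each counter (lamps and positions), times a group of order three.\<close>

type_synonym bconf = "(nat \<Rightarrow> int \<Rightarrow> int) \<times> (nat \<Rightarrow> int) \<times> 3"

abbreviation sg :: "bool \<Rightarrow> int" where
  "sg s \<equiv> (if s then 1 else - 1)"

text \<open>\<open>CA i\<close> changes the lamp at the current position and \<open>CY i\<close>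
  moves that position. \<open>CH\<close> acts as the \<open>n\<close>-th power of
  \<open>CA 0\<close>. The last clause is a default for tokens and for \<open>LT\<close>, which
  \<open>omv\<close> treats itself.\<close>

fun bact :: "nat \<Rightarrow> letter \<times> bool \<Rightarrow> bconf \<Rightarrow> bconf" where
  "bact n (CA i, s) (l, p, z) = (l(i := (l i)(p i := l i (p i) + sg s)), p, z)"
| "bact n (CY i, s) (l, p, z) = (l, p(i := p i + sg s), z)"
| "bact n (CH, s) (l, p, z) = (l(0 := (l 0)(p 0 := l 0 (p 0) + sg s * int n)), p, z)"
| "bact n (LZ, s) (l, p, z) = (l, p, z + (if s then 1 else - 1))"
| "bact n _ c = c"

definition base :: bconf where
  "base = (\<lambda>_ _. 0, \<lambda>_. 0, 0)"

lemma bact_inverse: "bact n (x, \<not> s) (bact n (x, s) c) = c"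
  by (cases x; cases c; cases s) simp_all

text \<open>The letter \<open>LT\<close> generates a free factor of order two: configurations are normal forms.\<close>

type_synonym oconf = "bconf \<times> bconf list"

text \<open>A stack operation: push the current configuration unless it is \<open>base\<close>,
  otherwise pop. The empty stack below \<open>base\<close> is a fixed point, as for the cosets of
  the factor of order two.\<close>

definition flip :: "oconf \<Rightarrow> oconf" where
  "flip \<omega> = (if fst \<omega> \<noteq> base then (base, fst \<omega> # snd \<omega>)
     else case snd \<omega> of [] \<Rightarrow> \<omega> | c # st \<Rightarrow> (c, st))"

definition valid :: "oconf \<Rightarrow> bool" where
  "valid \<omega> \<longleftrightarrow> base \<notin> set (snd \<omega>)"

definition omv :: "nat \<Rightarrow> letter \<times> bool \<Rightarrow> oconf \<Rightarrow> oconf" where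
  "omv n l \<omega> = (if fst l = LT then flip \<omega> else (bact n l (fst \<omega>), snd \<omega>))"

lemma valid_omv: "valid \<omega> \<Longrightarrow> valid (omv n l \<omega>)"
  by (cases \<omega>; cases "snd \<omega>") (auto simp: valid_def omv_def flip_def)

lemma flip_flip: "valid \<omega> \<Longrightarrow> flip (flip \<omega>) = \<omega>"
  by (cases \<omega>; cases "snd \<omega>") (auto simp: valid_def flip_def)

lemma omv_inverse: "valid \<omega> \<Longrightarrow> omv n (x, \<not> s) (omv n (x, s) \<omega>) = \<omega>"
  by (simp add: omv_def flip_flip bact_inverse)

fun token :: "letter \<Rightarrow> bool" where
  "token Dst \<longleftrightarrow> True"
| "token Ust \<longleftrightarrow> True"
| "token (Pst ps) \<longleftrightarrow> True"
| "token _ \<longleftrightarrow> False"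

lemma omv_token: "token x \<Longrightarrow> omv n (x, s) \<omega> = \<omega>"
  by (cases x) (simp_all add: omv_def)

text \<open>Besides moving the configuration, a word counts with signs which tokens it meets where. This is
  the value of the word in a wreath product.\<close>

definition tact :: "nat \<Rightarrow> letter \<times> bool \<Rightarrow> oconf \<times> (letter \<times> oconf \<Rightarrow> int) \<Rightarrow>
    oconf \<times> (letter \<times> oconf \<Rightarrow> int)" where
  "tact n l x = (omv n l (fst x), \<lambda>v. snd x v + (if token (fst l) \<and> v = (fst l, fst x) then sg (snd l) else 0))"

lemma tact_inverse: "valid (fst x) \<Longrightarrow> tact n (y, \<not> s) (tact n (y, s) x) = x"
  by (cases "token y") (auto simp: tact_def omv_inverse omv_token prod_eq_iff fun_eq_iff)

definition mv :: "nat \<Rightarrow> word \<Rightarrow> oconf \<Rightarrow> oconf" where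
  "mv n w \<omega> = fold (omv n) w \<omega>"

fun cnt :: "nat \<Rightarrow> word \<Rightarrow> oconf \<Rightarrow> letter \<times> oconf \<Rightarrow> int" where
  "cnt n [] \<omega> v = 0"
| "cnt n (l # w) \<omega> v =
    (if token (fst l) \<and> v = (fst l, \<omega>) then sg (snd l) else 0) + cnt n w (omv n l \<omega>) v"

lemma mv_simps [simp]: "mv n [] \<omega> = \<omega>" "mv n (l # w) \<omega> = mv n w (omv n l \<omega>)"
  "mv n (u @ w) \<omega> = mv n w (mv n u \<omega>)"
  by (simp_all add: mv_def)

lemma cnt_append: "cnt n (u @ w) \<omega> v = cnt n u \<omega> v + cnt n w (mv n u \<omega>) v"
  by (induction u arbitrary: \<omega>) simp_all

lemma valid_mv: "valid \<omega> \<Longrightarrow> valid (mv n w \<omega>)"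
  by (induction w arbitrary: \<omega>) (simp_all add: valid_omv)

lemma fold_tact: "fold (tact n) w (\<omega>, f) = (mv n w \<omega>, \<lambda>v. f v + cnt n w \<omega> v)"
  by (induction w arbitrary: \<omega> f) (simp_all add: tact_def add.assoc)

text \<open>Freeness of the quaternions enters here: \<open>tact\<close> is an action in the sense
  of \<open>free_action\<close> once the numbering \<open>\<nu>\<close> is undone.\<close>

lemma free_mv_cnt:
  fixes \<nu> :: "letter \<Rightarrow> nat"
  assumes "inj \<nu>" "wval (map (map_prod \<nu> id) w) = 0 \<or> wval (map (map_prod \<nu> id) w) = uneg" "valid \<omega>"
  shows "mv n w \<omega> = \<omega> \<and> cnt n w \<omega> v = 0"
proof -
  let ?f = "\<lambda>l. tact n (inv_into UNIV \<nu> (fst l), snd l)"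
  have "fold ?f (map (map_prod \<nu> id) w) (\<omega>, \<lambda>_. 0) = (\<omega>, \<lambda>_. 0)"
  proof (rule free_action[where V = "\<lambda>x. valid (fst x)"])
    fix l x assume "valid (fst (x :: oconf \<times> (letter \<times> oconf \<Rightarrow> int)))"
    then show "valid (fst (?f l x))" "?f (inv_letter l) (?f l x) = x"
      by (simp_all add: tact_inverse) (simp add: tact_def valid_omv)
  qed (use assms in simp_all)
  moreover have "fold ?f (map (map_prod \<nu> id) w) = fold (tact n) w"
    by (induction w) (simp_all add: assms(1))
  ultimately have "(mv n w \<omega>, \<lambda>v. 0 + cnt n w \<omega> v) = (\<omega>, \<lambda>_. 0)"
    by (simp only: fold_tact)
  then have mv: "mv n w \<omega> = \<omega>" and cnt: "(\<lambda>v. 0 + cnt n w \<omega> v) = (\<lambda>_. 0)"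
    by (simp_all only: prod.inject)
  from mv fun_cong[OF cnt, of v] show ?thesis by simp
qed

lemma mv_inv_word: "valid \<omega> \<Longrightarrow> mv n (inv_word w) (mv n w \<omega>) = \<omega>"
proof (induction w arbitrary: \<omega>)
  case (Cons l w)
  then show ?case
    using omv_inverse[of \<omega> n "fst l" "snd l"] by (simp add: inv_word_def valid_omv)
qed (simp add: inv_word_def)

section \<open>Relators as moves of tokens\<close>

definition token_free :: "word \<Rightarrow> bool" where
  "token_free w \<longleftrightarrow> (\<forall>l\<in>set w. \<not> token (fst l))"

lemma cnt_token_free: "token_free w \<Longrightarrow> cnt n w \<omega> v = 0"
  by (induction w arbitrary: \<omega>) (simp_all add: token_free_def)

lemma token_free_lab: "token_free (map lab b)"
proof -
  have "\<not> token (fst (lab x))" for x by (cases x rule: lab.cases) simp_all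
  then show ?thesis by (simp add: token_free_def)
qed

lemma token_free_inv_word: "token_free w \<Longrightarrow> token_free (inv_word w)"
  by (auto simp: token_free_def inv_word_def)

lemma edges_token: "(s, b, t) \<in> edges p \<Longrightarrow> token s \<and> token t \<and> token_free b"
proof -
  have 1: "token_free [(LT, s)]" "token_free [(LZ, s)]" for s by (simp_all add: token_free_def)
  have 2: "token_free (u @ w) \<longleftrightarrow> token_free u \<and> token_free w" for u w
    by (auto simp: token_free_def)
  show "(s, b, t) \<in> edges p \<Longrightarrow> ?thesis"
    unfolding edges_def by (auto simp: 1 2 token_free_lab token_free_inv_word)
qed

text \<open>Tokens do not move the configuration, so \<open>b\<close> and its inverse cancel; what
  remains is one negative crossing of \<open>s\<close> and one positive crossing of
  \<open>t\<close>.\<close>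

lemma relator_action:
  assumes "(s, b, t) \<in> edges p" "valid \<omega>"
  shows "mv n (relator (s, b, t)) \<omega> = \<omega>"
    and "cnt n (relator (s, b, t)) \<omega> v = of_bool (v = (t, mv n b \<omega>)) - of_bool (v = (s, \<omega>))"
proof -
  have *: "token s" "token t" "token_free b" "token_free (inv_word b)"
    using edges_token[OF assms(1)] token_free_inv_word by blast+
  then show "mv n (relator (s, b, t)) \<omega> = \<omega>"
    using assms(2) by (simp add: relator_def omv_token mv_inv_word)
  show "cnt n (relator (s, b, t)) \<omega> v = of_bool (v = (t, mv n b \<omega>)) - of_bool (v = (s, \<omega>))"
    using * by (simp add: relator_def omv_token cnt_append cnt_token_free of_bool_def)
qed

text \<open>Pairs whose components are indistinguishable by configuration and token count; by
  \<open>gens_flat\<close> every generator is flat or an edge relator.\<close>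

definition flat :: "nat \<Rightarrow> word \<times> word \<Rightarrow> bool" where
  "flat n g \<longleftrightarrow> (\<forall>\<omega>. valid \<omega> \<longrightarrow> mv n (fst g) \<omega> = mv n (snd g) \<omega> \<and>
     (\<forall>v. cnt n (fst g) \<omega> v = cnt n (snd g) \<omega> v))"

definition steps :: "nat \<Rightarrow> batom rex \<Rightarrow> ((letter \<times> oconf) \<times> letter \<times> oconf) set" where
  "steps n p = {((s, \<omega>), (t, mv n b \<omega>)) | s b t \<omega>. (s, b, t) \<in> edges p \<and> valid \<omega>}"

text \<open>Both components move the configuration alike, so the excess of tokens in the second
  comes from the edge relators, each applied at the configuration reached before it.\<close>

lemma realized_edges:
  assumes "\<forall>g\<in>set gs. flat n g \<or> (\<exists>e\<in>edges p. g = ([], relator e))" "valid \<omega>"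
  shows "\<exists>R. set R \<subseteq> steps n p \<and> mv n (concat (map fst gs)) \<omega> = mv n (concat (map snd gs)) \<omega> \<and>
    (\<forall>v. sum_list (map (\<lambda>(a, b). of_bool (v = b) - of_bool (v = a)) R) =
      cnt n (concat (map snd gs)) \<omega> v - cnt n (concat (map fst gs)) \<omega> v)"
  using assms
proof (induction gs arbitrary: \<omega>)
  case Nil
  show ?case by (intro exI[of _ "[]"]) simp
next
  case (Cons g gs)
  from Cons.prems(1) consider "flat n g" | e where "e \<in> edges p" "g = ([], relator e)"
    by auto
  then show ?case
  proof cases
    case 1
    then have g: "mv n (fst g) \<omega> = mv n (snd g) \<omega>" "cnt n (fst g) \<omega> v = cnt n (snd g) \<omega> v" for v
      using Cons.prems(2) unfolding flat_def by blast+
    have "valid (mv n (snd g) \<omega>)" using Cons.prems(2) by (rule valid_mv)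
    with Cons.IH[of "mv n (snd g) \<omega>"] Cons.prems(1) show ?thesis by (simp add: g cnt_append)
  next
    case 2
    obtain s b t where e: "e = (s, b, t)" by (cases e)
    note r = relator_action[OF 2(1)[unfolded e] Cons.prems(2), of n]
    from Cons.IH[OF _ Cons.prems(2)] Cons.prems(1) obtain R where R: "set R \<subseteq> steps n p"
      "mv n (concat (map fst gs)) \<omega> = mv n (concat (map snd gs)) \<omega>"
      "\<And>v. sum_list (map (\<lambda>(a, b). of_bool (v = b) - of_bool (v = a)) R) =
        cnt n (concat (map snd gs)) \<omega> v - cnt n (concat (map fst gs)) \<omega> v"
      by auto
    have "((s, \<omega>), (t, mv n b \<omega>)) \<in> steps n p"
      using 2(1) Cons.prems(2) unfolding e steps_def by blast
    then show ?thesis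
      using R by (intro exI[of _ "((s, \<omega>), (t, mv n b \<omega>)) # R"]) (simp add: 2(2) e r cnt_append)
  qed
qed

text \<open>Since both products act trivially, the list \<open>R\<close> together with the step of
  the leading relator is balanced at every vertex, and \<open>circulation\<close> closes that step
  to a cycle.\<close>

lemma identity_cycle:
  assumes "inj \<nu>" and gs: "\<forall>g\<in>set gs. flat n g \<or> (\<exists>e\<in>edges p. g = ([], relator e))"
    and e: "(s, b, t) \<in> edges p"
    and "wval (map (map_prod \<nu> id) (concat (map fst gs))) \<in> {0, uneg}"
    and "wval (map (map_prod \<nu> id) (relator (s, b, t) @ concat (map snd gs))) \<in> {0, uneg}"
    and \<omega>: "valid \<omega>"
  shows "((t, mv n b \<omega>), (s, \<omega>)) \<in> (steps n p)\<^sup>*"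
proof -
  note r = relator_action[OF e \<omega>, of n]
  obtain R where R: "set R \<subseteq> steps n p"
    "\<And>v. sum_list (map (\<lambda>(a, b). of_bool (v = b) - of_bool (v = a)) R) =
        cnt n (concat (map snd gs)) \<omega> v - cnt n (concat (map fst gs)) \<omega> v"
    using realized_edges[OF gs \<omega>] by blast
  let ?R = "((s, \<omega>), (t, mv n b \<omega>)) # R"
  have "cnt n (concat (map fst gs)) \<omega> v = 0" for v
    using free_mv_cnt[OF assms(1) _ \<omega>] assms(4) by blast
  moreover have "cnt n (relator (s, b, t) @ concat (map snd gs)) \<omega> v = 0" for v
    using free_mv_cnt[OF assms(1) _ \<omega>] assms(5) by blast
  ultimately have "sum_list (map (\<lambda>(a, b). of_bool (v = b) - of_bool (v = a)) ?R) = (0 :: int)" for v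
    by (simp add: R(2) cnt_append r)
  from circulation[OF this] have "((t, mv n b \<omega>), (s, \<omega>)) \<in> (set ?R)\<^sup>*" by simp
  moreover have "((s, \<omega>), (t, mv n b \<omega>)) \<in> steps n p"
    using e \<omega> unfolding steps_def by blast
  then have "set ?R \<subseteq> steps n p" using R(1) by simp
  ultimately show ?thesis using rtrancl_mono by blast
qed

subsection \<open>Runs without trivial label\<close>

definition brun :: "nat \<Rightarrow> batom list \<Rightarrow> bconf \<Rightarrow> bconf" where
  "brun n w c = fold (bact n) (map lab w) c"

lemma brun_simps [simp]: "brun n [] c = c" "brun n (x # w) c = brun n w (bact n (lab x) c)"
  "brun n (u @ w) c = brun n w (brun n u c)"
  by (simp_all add: brun_def)

lemma bact_lab_snd: "snd (snd (bact n (lab x) c)) = snd (snd c)"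
  by (cases x rule: lab.cases; cases c) simp_all

lemma brun_snd: "snd (snd (brun n w c)) = snd (snd c)"
  by (induction w arbitrary: c) (simp_all add: bact_lab_snd)

lemma mv_lab: "mv n (map lab w) (c, st) = (brun n w c, st)"
proof (induction w arbitrary: c)
  case (Cons x w)
  have "fst (lab x) \<noteq> LT" by (cases x rule: lab.cases) simp_all
  then show ?case using Cons by (simp add: omv_def)
qed simp

lemma mv_inv_lab: "\<exists>c'. mv n (inv_word (map lab w)) (c, st) = (c', st) \<and> snd (snd c') = snd (snd c)"
proof (induction w arbitrary: c rule: rev_induct)
  case (snoc x w)
  obtain y s where y: "lab x = (y, s)" by (cases "lab x")
  have "y \<noteq> LT \<and> snd (snd (bact n (y, \<not> s) c)) = snd (snd c)"
    using y by (cases x rule: lab.cases; cases c) auto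
  moreover obtain c' where "mv n (inv_word (map lab w)) (bact n (y, \<not> s) c, st) = (c', st)"
    "snd (snd c') = snd (snd (bact n (y, \<not> s) c))"
    using snoc.IH by blast
  ultimately show ?case by (simp add: inv_word_def omv_def y)
qed (simp add: inv_word_def)

text \<open>Instructions move positions forward only, so a lamp that has been left behind keeps its
  value.\<close>

lemma brun_Ins_past:
  "brun n (map Ins w) (l, p, z) = (l', p', z') \<Longrightarrow> j < p i \<Longrightarrow> l' i j = l i j"
proof (induction w arbitrary: l p)
  case (Cons x w)
  show ?case
  proof (cases x)
    case (Inc k)
    with Cons.prems(1) have "brun n (map Ins w) (l(k := (l k)(p k := l k (p k) + 1)), p, z) = (l', p', z')"
      by simp
    from Cons.IH[OF this Cons.prems(2)] show ?thesis using Cons.prems(2) by (cases "k = i") auto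
  next
    case (Dec k)
    with Cons.prems(1) have "brun n (map Ins w) (l(k := (l k)(p k := l k (p k) - 1)), p, z) = (l', p', z')"
      by simp
    from Cons.IH[OF this Cons.prems(2)] show ?thesis using Cons.prems(2) by (cases "k = i") auto
  next
    case (Tst k)
    with Cons.prems have run: "brun n (map Ins w) (l, p(k := p k + 1), z) = (l', p', z')" by simp
    have "j < (p(k := p k + 1)) i" using Cons.prems(2) by (cases "i = k") auto
    from Cons.IH[OF run this] show ?thesis .
  qed
qed simp

text \<open>The lamp at the current position is the counter. A test leaves it behind for good, so it
  must be 0 already if all lamps are to end at 0; the lamp ahead is still 0, so the counter keeps
  its value.\<close>

lemma brun_Ins_exec:
  assumes "brun n (map Ins w) (l, p, z) = (\<lambda>_ _. 0, p', z')" "\<forall>i. \<forall>j>p i. l i j = 0"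
  shows "exec w (\<lambda>i. l i (p i)) = Some (\<lambda>_. 0)"
  using assms
proof (induction w arbitrary: l p)
  case Nil
  then show ?case by simp
next
  case (Cons x w)
  have upd: "exec w ((\<lambda>i. l i (p i))(k := l k (p k) + d)) = Some (\<lambda>_. 0)"
    if "brun n (map Ins w) (l(k := (l k)(p k := l k (p k) + d)), p, z) = (\<lambda>_ _. 0, p', z')" for k d
  proof -
    have "\<forall>i. \<forall>j>p i. (l(k := (l k)(p k := l k (p k) + d))) i j = 0" using Cons.prems(2) by simp
    from Cons.IH[OF that this]
    have "exec w (\<lambda>i. (l(k := (l k)(p k := l k (p k) + d))) i (p i)) = Some (\<lambda>_. 0)" .
    moreover have "(\<lambda>i. (l(k := (l k)(p k := l k (p k) + d))) i (p i)) =
        (\<lambda>i. l i (p i))(k := l k (p k) + d)"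
      by (auto simp: fun_eq_iff)
    ultimately show ?thesis by simp
  qed
  show ?case
  proof (cases x)
    case (Inc k)
    with Cons.prems(1) upd[of k 1] show ?thesis by simp
  next
    case (Dec k)
    with Cons.prems(1) upd[of k "- 1"] show ?thesis by simp
  next
    case (Tst k)
    with Cons.prems(1) have run: "brun n (map Ins w) (l, p(k := p k + 1), z) = (\<lambda>_ _. 0, p', z')"
      by simp
    have "l k (p k) = 0" using brun_Ins_past[OF run, of "p k" k] by simp
    moreover have "l k (p k + 1) = 0" using Cons.prems(2) by simp
    ultimately have "(\<lambda>i. l i ((p(k := p k + 1)) i)) = (\<lambda>i. l i (p i))"
      by (auto simp: fun_eq_iff)
    moreover have "\<forall>i. \<forall>j>(p(k := p k + 1)) i. l i j = 0" using Cons.prems(2) by simp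
    from Cons.IH[OF run this]
    have "exec w (\<lambda>i. l i ((p(k := p k + 1)) i)) = Some (\<lambda>_. 0)" .
    ultimately show ?thesis using \<open>l k (p k) = 0\<close> Tst by simp
  qed
qed

lemma brun_Pop: "set v \<subseteq> range Pop \<Longrightarrow> fst (brun n v c) = fst c"
proof (induction v arbitrary: c)
  case (Cons x v)
  then obtain i where "x = Pop i" by auto
  moreover have "fst (bact n (CY i, False) c) = fst c" by (cases c) simp
  ultimately show ?case using Cons by simp
qed simp

lemma trivial_run_sem:
  assumes "lng (full q k) w" "brun n w base = base"
  shows "sem q ((\<lambda>_. 0)(0 := int n)) (\<lambda>_. 0)"
proof -
  obtain u v where w: "w = Inp # map Ins u @ v" and u: "lng q u" and v: "lng (pops k) v"
    using assms(1) unfolding lng_full by blast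
  define l :: "nat \<Rightarrow> int \<Rightarrow> int" where "l = (\<lambda>_ _. 0)(0 := (\<lambda>_. 0)(0 := int n))"
  have "bact n (lab Inp) base = (l, \<lambda>_. 0, 0)" by (simp add: base_def l_def)
  then have "brun n v (brun n (map Ins u) (l, \<lambda>_. 0, 0)) = base" using assms(2) by (simp add: w)
  then have "fst (brun n (map Ins u) (l, \<lambda>_. 0, 0)) = (\<lambda>_ _. 0)"
    using brun_Pop[OF lng_pops[OF v], of n "brun n (map Ins u) (l, \<lambda>_. 0, 0)"] by (simp add: base_def)
  then obtain p' z' where "brun n (map Ins u) (l, \<lambda>_. 0, 0) = (\<lambda>_ _. 0, p', z')"
    by (cases "brun n (map Ins u) (l, \<lambda>_. 0, 0)") simp
  moreover have "\<forall>i. \<forall>j>(\<lambda>_. 0) i. l i j = 0" by (simp add: l_def)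
  ultimately have "exec u (\<lambda>i. l i ((\<lambda>_. 0) i)) = Some (\<lambda>_. 0)" by (rule brun_Ins_exec)
  moreover have "(\<lambda>i. l i ((\<lambda>_. 0) i)) = (\<lambda>_. 0)(0 := int n)" by (auto simp: l_def fun_eq_iff)
  ultimately show ?thesis using u unfolding sem_def by metis
qed

text \<open>Holds for everything reachable after the edge from \<open>Pst []\<close> to
  \<open>Ust\<close> has pushed. In \<open>Pst ps\<close> a token either came from
  \<open>Ust\<close> with one \<open>LZ\<close> or is in a run that started at \<open>base\<close>;
  going to \<open>Dst\<close> adds one more, giving 2 or 1 modulo 3. So neither \<open>LT\<close>
  edge ever finds \<open>base\<close> and both only push.\<close>

definition inv_state :: "nat \<Rightarrow> batom rex \<Rightarrow> letter \<times> oconf \<Rightarrow> bool" where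
  "inv_state n p x \<longleftrightarrow> (case x of (s, c, st) \<Rightarrow> st \<noteq> [] \<and> (case s of
       Ust \<Rightarrow> c = base
     | Dst \<Rightarrow> snd (snd c) \<noteq> 0
     | Pst ps \<Rightarrow> snd (snd c) = 1 \<or> (\<exists>w. path (set (edg p [])) [p] w ps \<and> c = brun n w base)
     | _ \<Rightarrow> False))"

lemma three: "(1 :: 3) \<noteq> 0" "(1 :: 3) + 1 \<noteq> 0" "(z :: 3) + 1 + 1 + 1 = z"
  by simp_all

lemma inv_state_step:
  assumes no: "\<And>w. lng p w \<Longrightarrow> brun n w base \<noteq> base"
    and "inv_state n p x" "(x, y) \<in> steps n p"
  shows "inv_state n p y"
proof -
  from assms(3) obtain s b t \<omega> where x: "x = (s, \<omega>)" and y: "y = (t, mv n b \<omega>)" and e: "(s, b, t) \<in> edges p"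
    unfolding steps_def by blast
  obtain c st where \<omega>: "\<omega> = (c, st)" by (cases \<omega>)
  have z0: "snd (snd base) = 0" by (simp add: base_def)
  have push: "mv n [(LT, r)] (c, st) = (base, c # st)" if "c \<noteq> base" for r
    using that by (simp add: omv_def flip_def)
  have LZ: "mv n [(LZ, True)] (d, st) = ((fst d, fst (snd d), snd (snd d) + 1), st)" for d
    by (cases d) (simp add: omv_def)
  from e consider
    "s = Dst" "b = [(LT, True)]" "t = Pst [p]"
    | "s = Pst []" "b = [(LT, False)]" "t = Ust"
    | q a q' where "(q, a, q') \<in> set (edg p [])" "s = Pst q" "b = map lab a" "t = Pst q'"
    | q a q' where "(q, a, q') \<in> set (edg p [])" "s = Ust" "b = [(LZ, True)]" "t = Pst q"
    | q a q' where "(q, a, q') \<in> set (edg p [])" "s = Pst q'" "b = inv_word (map lab a) @ [(LZ, True)]" "t = Dst"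
    unfolding edges_def by blast
  then show ?thesis
  proof cases
    case 1
    then have "c \<noteq> base" using assms(2) z0 by (auto simp: inv_state_def x \<omega>)
    then show ?thesis using push[of True] path.nil[of "set (edg p [])" "[p]"]
      unfolding y \<omega> 1 inv_state_def by (auto intro!: exI[of _ "[]"])
  next
    case 2
    \<comment> \<open>Leaving \<open>Pst []\<close> with \<open>base\<close> would complete a run
      with trivial label.\<close>
    have "c \<noteq> base"
    proof
      assume "c = base"
      then obtain w where "path (set (edg p [])) [p] w []" "base = brun n w base"
        using assms(2) z0 three(1) unfolding inv_state_def x \<omega> 2 by auto
      then show False using no path_iff_lng by metis
    qed
    then show ?thesis using push[of False] unfolding y \<omega> 2 inv_state_def by simp
  next
    case 3
    have st: "st \<noteq> []" using assms(2) by (simp add: inv_state_def x \<omega>)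
    consider "snd (snd c) = 1" | w where "path (set (edg p [])) [p] w q" "c = brun n w base"
      using assms(2) unfolding inv_state_def x \<omega> 3 by auto
    then show ?thesis
    proof cases
      case 1
      then show ?thesis unfolding y \<omega> 3 inv_state_def using st by (simp add: mv_lab brun_snd)
    next
      case 2
      then have "path (set (edg p [])) [p] (w @ a) q'" "brun n a c = brun n (w @ a) base"
        using path_append path_edge[OF 3(1)] by auto
      then show ?thesis unfolding y \<omega> 3 inv_state_def using st by (auto simp: mv_lab)
    qed
  next
    case 4
    then show ?thesis using assms(2) unfolding inv_state_def x y \<omega> 4
      by (simp add: LZ z0 del: mv_simps(2))
  next
    case 5
    have "snd (snd c) = 1 \<or> snd (snd c) = 0"
      using assms(2) unfolding inv_state_def x \<omega> 5 by (auto simp: brun_snd z0)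
    then have z: "snd (snd c) + 1 \<noteq> 0" using three by auto
    obtain c' where "mv n (inv_word (map lab a)) (c, st) = (c', st)" "snd (snd c') = snd (snd c)"
      using mv_inv_lab by blast
    then show ?thesis using assms(2) z unfolding inv_state_def x y \<omega> 5
      by (simp add: LZ del: mv_simps(2))
  qed
qed

text \<open>A cycle through the edge from \<open>Pst []\<close> to \<open>Ust\<close> would have to shorten the stack of the normal form
  again, but without a trivial run it only grows.\<close>

lemma no_cycle:
  assumes "\<And>w. lng p w \<Longrightarrow> brun n w base \<noteq> base"
  shows "\<exists>\<omega>. valid \<omega> \<and> ((Ust, mv n [(LT, False)] \<omega>), (Pst [], \<omega>)) \<notin> (steps n p)\<^sup>*"
proof -
  \<comment> \<open>Any configuration other than \<open>base\<close> works: the edge pushes it,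
    whereas closing the cycle would require an empty stack again.\<close>
  define c :: bconf where "c = (\<lambda>_ _. 0, \<lambda>_. 0, 1)"
  have c: "c \<noteq> base" by (simp add: c_def base_def)
  have init: "inv_state n p (Ust, mv n [(LT, False)] (c, []))"
    using c by (simp add: inv_state_def omv_def flip_def)
  have "inv_state n p y" if "((Ust, mv n [(LT, False)] (c, [])), y) \<in> (steps n p)\<^sup>*" for y
    using that
  proof (induction rule: rtrancl_induct)
    case base
    show ?case by (rule init)
  next
    case (step y z)
    then show ?case using inv_state_step[OF assms] by blast
  qed
  moreover have "\<not> inv_state n p (Pst [], (c, []))" by (simp add: inv_state_def)
  ultimately have "((Ust, mv n [(LT, False)] (c, [])), (Pst [], (c, []))) \<notin> (steps n p)\<^sup>*" by blast
  then show ?thesis by (intro exI[of _ "(c, [])"]) (simp add: valid_def)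
qed

subsection \<open>Flat generators\<close>

lemma flat_refl: "flat n (w, w)"
  by (simp add: flat_def)

lemma mv_not_LT: "\<forall>l\<in>set w. fst l \<noteq> LT \<Longrightarrow> mv n w (c, st) = (fold (bact n) w c, st)"
  by (induction w arbitrary: c) (simp_all add: omv_def)

lemma flatI:
  assumes "\<forall>l\<in>set u. fst l \<noteq> LT" "\<forall>l\<in>set w. fst l \<noteq> LT" "token_free u" "token_free w"
    and "\<And>c. fold (bact n) u c = fold (bact n) w c"
  shows "flat n (u, w)"
  unfolding flat_def using assms by (auto simp: mv_not_LT cnt_token_free)

fun coord :: "letter \<Rightarrow> nat option" where
  "coord (CA i) = Some i"
| "coord (CY i) = Some i"
| "coord _ = None"

lemma bact_commute:
  assumes "coord x = Some i" "coord y = Some j" "i \<noteq> j"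
  shows "bact n (x, s) (bact n (y, t) c) = bact n (y, t) (bact n (x, s) c)"
  using assms by (cases x; cases y; cases c) (auto simp: fun_eq_iff)

text \<open>The inverse of \<open>commutator x y\<close> is \<open>commutator y x\<close>, so these
  relators come in inverse pairs.\<close>

definition commutator :: "letter \<Rightarrow> letter \<Rightarrow> word" where
  "commutator x y = [(x, False), (y, False), (x, True), (y, True)]"

lemma flat_commutator:
  assumes "coord x = Some i" "coord y = Some j" "i \<noteq> j"
  shows "flat n ([], commutator x y)"
proof (rule flatI)
  have "x \<noteq> LT" "y \<noteq> LT" "\<not> token x" "\<not> token y" using assms by (cases x; cases y; auto)+
  then show "\<forall>l\<in>set (commutator x y). fst l \<noteq> LT" "token_free (commutator x y)"
    by (simp_all add: commutator_def token_free_def)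
  show "fold (bact n) [] c = fold (bact n) (commutator x y) c" for c
    using bact_inverse[of n x False] bact_inverse[of n y False]
    by (simp add: commutator_def bact_commute[OF assms, of n True False])
qed (simp_all add: token_free_def)

lemma flat_cube: "flat n ([], [(LZ, s), (LZ, s), (LZ, s)])"
proof (rule flatI)
  show "fold (bact n) [] c = fold (bact n) [(LZ, s), (LZ, s), (LZ, s)] c" for c
  proof -
    obtain l p z where c: "c = (l, p, z)" by (cases c)
    have "z - 1 - 1 - 1 = z" using three(3)[of "z - 1 - 1 - 1"] by simp
    then show ?thesis using three(3)[of z] by (cases s) (simp_all add: c)
  qed
qed (simp_all add: token_free_def)

lemma flat_input: "flat n ([(CH, s)], replicate n (CA 0, s))"
proof (rule flatI)
  have *: "fold (bact k) (replicate n (CA 0, s)) (l, p, z) =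
      (l(0 := (l 0)(p 0 := l 0 (p 0) + sg s * int n)), p, z)" for l p z k
    by (induction n arbitrary: l) (simp_all add: algebra_simps del: fold_replicate)
  show "fold (bact n) [(CH, s)] c = fold (bact n) (replicate n (CA 0, s)) c" for c
    by (cases c) (simp add: * del: fold_replicate)
qed (simp_all add: token_free_def)

subsection \<open>Normal submonoids\<close>

lemmas group_simps = minus_add add.assoc diff_conv_add_uminus

text \<open>\<open>N\<close> will be the set of all \<open>v\<close> for which the pair
  \<open>(0, v)\<close> acts as an element of the semigroup; the pairs \<open>(y, y)\<close> make it
  closed under conjugation.\<close>

locale normal_submonoid =
  fixes lv :: "letter \<Rightarrow> 'g :: group_add" and N :: "'g set"
  assumes zero_mem: "0 \<in> N" and add_mem: "a \<in> N \<Longrightarrow> b \<in> N \<Longrightarrow> a + b \<in> N"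
    and conj_mem: "a \<in> N \<Longrightarrow> lv x + a + - lv x \<in> N" "a \<in> N \<Longrightarrow> - lv x + a + lv x \<in> N"
begin

definition sv :: "letter \<times> bool \<Rightarrow> 'g" where
  "sv l = (if snd l then lv (fst l) else - lv (fst l))"

lemma sv_simps [simp]: "sv (x, True) = lv x" "sv (x, False) = - lv x"
  by (simp_all add: sv_def)

abbreviation wv :: "word \<Rightarrow> 'g" where
  "wv w \<equiv> sum_list (map sv w)"

lemma wv_inv_word: "wv (inv_word w) = - wv w"
proof (induction w)
  case (Cons l w)
  have "sv (fst l, \<not> snd l) = - sv l" by (simp add: sv_def)
  with Cons show ?case by (simp add: inv_word_def minus_add)
qed (simp add: inv_word_def)

lemma conj_word: "a \<in> N \<Longrightarrow> wv w + a + - wv w \<in> N"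
proof (induction w)
  case (Cons l w)
  obtain x s where l: "l = (x, s)" by (cases l)
  have "sv l + (wv w + a + - wv w) + - sv l \<in> N"
    using conj_mem[OF Cons.IH[OF Cons.prems], of x]
    by (cases s) (simp_all only: l sv_simps minus_minus)
  then show ?case by (simp only: list.map sum_list.Cons group_simps del: add_uminus_conv_diff)
qed simp

lemma conj_word': "a \<in> N \<Longrightarrow> - wv w + a + wv w \<in> N"
  using conj_word[of a "inv_word w"] by (simp only: wv_inv_word minus_minus)

text \<open>Congruence modulo the largest normal subgroup contained in the submonoid.\<close>

definition eqv :: "word \<Rightarrow> word \<Rightarrow> bool" where
  "eqv u w \<longleftrightarrow> - wv u + wv w \<in> N \<and> - wv w + wv u \<in> N"

lemma eqvI: "wv u = wv w \<Longrightarrow> eqv u w"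
  by (simp add: eqv_def zero_mem)

lemma eqv_sym: "eqv u w \<Longrightarrow> eqv w u"
  by (simp add: eqv_def)

lemma eqv_trans [trans]: "eqv u v \<Longrightarrow> eqv v w \<Longrightarrow> eqv u w"
proof -
  have *: "- a + b \<in> N \<Longrightarrow> - b + c \<in> N \<Longrightarrow> - a + c \<in> N" for a b c
    using add_mem[of "- a + b" "- b + c"] by (simp add: group_simps del: add_uminus_conv_diff)
  show "eqv u v \<Longrightarrow> eqv v w \<Longrightarrow> eqv u w" unfolding eqv_def using * by blast
qed

lemma eqv_left: "eqv u w \<Longrightarrow> eqv (v @ u) (v @ w)"
  by (simp add: eqv_def group_simps del: add_uminus_conv_diff)

lemma eqv_right: "eqv u w \<Longrightarrow> eqv (u @ v) (w @ v)"
  using conj_word'[of "- wv u + wv w" v] conj_word'[of "- wv w + wv u" v]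
  by (simp add: eqv_def group_simps del: add_uminus_conv_diff)

section \<open>Commutation and sorting modulo the submonoid\<close>

definition com :: "word \<Rightarrow> word \<Rightarrow> bool" where
  "com u w \<longleftrightarrow> eqv (u @ w) (w @ u)"

lemma com_sym: "com u w \<Longrightarrow> com w u"
  by (simp add: com_def eqv_sym)

lemma com_inverse: "com [(x, True)] w \<Longrightarrow> com [(x, False)] w"
proof -
  assume "com [(x, True)] w"
  then have "eqv ([(x, False)] @ (w @ [(x, True)]) @ [(x, False)])
      ([(x, False)] @ ([(x, True)] @ w) @ [(x, False)])"
    unfolding com_def by (rule eqv_left[OF eqv_right[OF eqv_sym]])
  moreover have "wv ([(x, False)] @ (w @ [(x, True)]) @ [(x, False)]) = wv ([(x, False)] @ w)"
    "wv ([(x, False)] @ ([(x, True)] @ w) @ [(x, False)]) = wv (w @ [(x, False)])"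
    by (simp_all add: group_simps del: add_uminus_conv_diff)
  ultimately show ?thesis unfolding com_def eqv_def by simp
qed

lemma com_append: "com u v \<Longrightarrow> com u w \<Longrightarrow> com u (v @ w)"
proof -
  assume "com u v" "com u w"
  then have "eqv (u @ v @ w) (v @ u @ w)" "eqv (v @ u @ w) (v @ w @ u)"
    using eqv_right[of "u @ v" "v @ u" w] eqv_left[of "u @ w" "w @ u" v] by (simp_all add: com_def)
  then show ?thesis unfolding com_def append_assoc by (rule eqv_trans)
qed

lemma com_word: "(\<And>l. l \<in> set w \<Longrightarrow> com u [l]) \<Longrightarrow> com u w"
proof (induction w)
  case Nil
  show ?case by (simp add: com_def eqvI)
next
  case (Cons l w)
  then show ?case using com_append[of u "[l]" w] by simp
qed

end

locale counter_monoid = normal_submonoid lv N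
  for lv :: "letter \<Rightarrow> 'g :: group_add" and N +
  fixes k n :: nat
  assumes commutator_mem: "coord x = Some i \<Longrightarrow> coord y = Some j \<Longrightarrow> i \<noteq> j \<Longrightarrow> i < k \<Longrightarrow> j < k \<Longrightarrow>
      wv (commutator x y) \<in> N"
    and input_eqv: "eqv [(CH, True)] (replicate n (CA 0, True))"
    and k_pos: "0 < k"
begin

lemma com_coord:
  assumes "coord x = Some i" "coord y = Some j" "i \<noteq> j" "i < k" "j < k"
  shows "com [(x, s)] [(y, t)]"
proof -
  have "eqv ([(x, True)] @ [(y, True)]) ([(y, True)] @ [(x, True)])"
    using commutator_mem[OF assms] commutator_mem[OF assms(2,1) assms(3)[symmetric] assms(5,4)]
    by (simp add: eqv_def commutator_def group_simps del: add_uminus_conv_diff)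
  then have "com [(x, True)] [(y, True)]" by (simp add: com_def)
  then have "com [(x, s)] [(y, True)]" by (cases s) (simp_all add: com_inverse)
  then have "com [(y, True)] [(x, s)]" by (rule com_sym)
  then have "com [(y, t)] [(x, s)]" by (cases t) (simp_all add: com_inverse)
  then show ?thesis by (rule com_sym)
qed

abbreviation proj :: "nat \<Rightarrow> word \<Rightarrow> word" where
  "proj i w \<equiv> filter (\<lambda>l. coord (fst l) = Some i) w"

lemma insert_letter:
  assumes "coord (fst l) = Some c" "c \<in> set js" "distinct js" "set js \<subseteq> {..<k}"
  shows "eqv (concat (map (\<lambda>i. proj i w) js) @ [l]) (concat (map (\<lambda>i. proj i (w @ [l])) js))"
  using assms(2-4)
proof (induction js)
  case (Cons j js)
  show ?case
  proof (cases "j = c")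
    case True
    have "com [l] (concat (map (\<lambda>i. proj i w) js))"
    proof (rule com_word)
      fix m assume "m \<in> set (concat (map (\<lambda>i. proj i w) js))"
      then obtain i where i: "i \<in> set js" "coord (fst m) = Some i" by auto
      have "com [(fst l, snd l)] [(fst m, snd m)]"
        by (rule com_coord[OF assms(1) i(2)]) (use i Cons.prems True in auto)
      then show "com [l] [m]" by simp
    qed
    then have "eqv (proj j w @ (concat (map (\<lambda>i. proj i w) js) @ [l]))
        (proj j w @ ([l] @ concat (map (\<lambda>i. proj i w) js)))"
      unfolding com_def by (rule eqv_left[OF eqv_sym])
    moreover have "concat (map (\<lambda>i. proj i (w @ [l])) js) = concat (map (\<lambda>i. proj i w) js)"
      using Cons.prems assms(1) True by (intro arg_cong[of _ _ concat] map_cong) auto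
    ultimately show ?thesis using assms(1) True by simp
  next
    case False
    then have "eqv (concat (map (\<lambda>i. proj i w) js) @ [l]) (concat (map (\<lambda>i. proj i (w @ [l])) js))"
      using Cons by simp
    from eqv_left[OF this, of "proj j w"] show ?thesis using assms(1) False by simp
  qed
qed simp

text \<open>Letters of different counters commute modulo \<open>N\<close>, so a word is congruent to
  the product of its projections, as in a direct product.\<close>

lemma sort_word:
  assumes "\<forall>l\<in>set w. \<exists>i<k. coord (fst l) = Some i"
  shows "eqv w (concat (map (\<lambda>i. proj i w) [0..<k]))"
  using assms
proof (induction w rule: rev_induct)
  case Nil
  show ?case by (rule eqvI) (simp add: map_replicate_const)
next
  case (snoc l w)
  obtain c where c: "coord (fst l) = Some c" "c < k" using snoc.prems by auto
  have "eqv w (concat (map (\<lambda>i. proj i w) [0..<k]))" using snoc by simp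
  then have "eqv (w @ [l]) (concat (map (\<lambda>i. proj i w) [0..<k]) @ [l])" by (rule eqv_right)
  also have "eqv \<dots> (concat (map (\<lambda>i. proj i (w @ [l])) [0..<k]))"
    by (rule insert_letter[OF c(1)]) (use c(2) in auto)
  finally show ?case .
qed

definition pow_A :: "nat \<Rightarrow> int \<Rightarrow> 'g" where
  "pow_A i c = (if 0 \<le> c then wv (replicate (nat c) (CA i, True)) else wv (replicate (nat (- c)) (CA i, False)))"

lemma wv_replicate_Suc: "wv (replicate (Suc m) l) = wv (replicate m l) + sv l"
proof -
  have "replicate (Suc m) l = replicate m l @ [l]" by (simp only: replicate_append_same replicate_Suc)
  then show ?thesis by (simp only: map_append sum_list_append list.map sum_list.Cons sum_list.Nil add_0_right)
qed

lemma pow_A_Suc: "pow_A i (c + 1) = pow_A i c + lv (CA i)"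
proof (cases "0 \<le> c")
  case True
  then have "nat (c + 1) = Suc (nat c)" by simp
  then show ?thesis using True
    by (simp only: pow_A_def wv_replicate_Suc) (simp del: map_replicate)
next
  case False
  then obtain m where m: "nat (- c) = Suc m" by (cases "nat (- c)") auto
  then have c: "c = - int (Suc m)" using False by linarith
  have "pow_A i c = wv (replicate m (CA i, False)) + sv (CA i, False)"
    using False by (simp only: pow_A_def m wv_replicate_Suc if_False)
  moreover have "pow_A i (c + 1) = wv (replicate m (CA i, False))"
  proof (cases "m = 0")
    case True
    then show ?thesis using c by (simp add: pow_A_def)
  next
    case False
    then have "\<not> 0 \<le> c + 1" "nat (- (c + 1)) = m" using c by linarith+
    then show ?thesis by (simp only: pow_A_def if_False)
  qed
  ultimately show ?thesis by (simp add: group_simps del: map_replicate add_uminus_conv_diff)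
qed

lemma pow_A_pred: "pow_A i (c - 1) = pow_A i c + - lv (CA i)"
  using pow_A_Suc[of i "c - 1"] by (simp add: group_simps del: add_uminus_conv_diff)

lemma pow_A_pred': "pow_A i (c + - 1) = pow_A i c + - lv (CA i)"
  using pow_A_pred[of i c] by simp

lemma pow_A_0: "pow_A i 0 = 0"
  by (simp add: pow_A_def)

text \<open>The counter value is carried along as a power of \<open>CA i\<close>. At a test it is 0,
  so \<open>CY i\<close> comes out on the left, and the tests add up to a power of
  \<open>CY i\<close>.\<close>

lemma exec_proj:
  assumes "exec u \<sigma> = Some \<tau>"
  shows "pow_A i (\<sigma> i) + wv (proj i (map lab (map Ins u))) =
    wv (replicate (count_list u (Tst i)) (CY i, True)) + pow_A i (\<tau> i)"
  using assms
proof (induction u arbitrary: \<sigma>)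
  case Nil
  then show ?case by simp
next
  case (Cons x u)
  show ?case
  proof (cases x)
    case (Inc j)
    with Cons.prems have "exec u (\<sigma>(j := \<sigma> j + 1)) = Some \<tau>" by simp
    from Cons.IH[OF this] show ?thesis
      by (cases "i = j") (simp_all add: Inc pow_A_Suc group_simps del: map_replicate add_uminus_conv_diff)
  next
    case (Dec j)
    with Cons.prems have "exec u (\<sigma>(j := \<sigma> j - 1)) = Some \<tau>" by simp
    from Cons.IH[OF this] show ?thesis
      by (cases "i = j") (simp_all add: Dec pow_A_pred' group_simps del: map_replicate add_uminus_conv_diff)
  next
    case (Tst j)
    with Cons.prems have *: "\<sigma> j = 0" "exec u \<sigma> = Some \<tau>" by (simp_all split: if_splits)
    from Cons.IH[OF *(2)] show ?thesis using *(1)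
      by (cases "i = j") (simp_all add: Tst pow_A_0 group_simps del: map_replicate add_uminus_conv_diff)
  qed
qed

lemma wv_replicate_cancel: "wv (replicate m (x, True)) + wv (replicate m (x, False)) = 0"
proof (induction m)
  case (Suc m)
  have "wv (replicate (Suc m) (x, False)) = sv (x, False) + wv (replicate m (x, False))"
    by (simp only: replicate_Suc list.map sum_list.Cons)
  moreover have "wv (replicate m (x, True)) + sv (x, True) + (sv (x, False) + wv (replicate m (x, False))) =
      wv (replicate m (x, True)) + wv (replicate m (x, False))"
    by (simp add: group_simps del: map_replicate add_uminus_conv_diff)
  ultimately show ?case using Suc by (simp only: wv_replicate_Suc)
qed simp

lemma proj_pops:
  "proj i (map lab (concat (map (\<lambda>j. replicate (m j) (Pop j)) (rev [0..<l])))) =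
    (if i < l then replicate (m i) (CY i, False) else [])"
  by (induction l) (auto simp: filter_replicate less_Suc_eq)

lemma wv_concat_zero: "(\<And>i. i \<in> set js \<Longrightarrow> wv (f i) = 0) \<Longrightarrow> wv (concat (map f js)) = 0"
  by (induction js) simp_all

lemma trivial_run:
  assumes u: "lng q u" "exec u ((\<lambda>_. 0)(0 := int n)) = Some (\<lambda>_. 0)"
    and idx: "\<forall>x\<in>set u. \<exists>i<k. coord (fst (lab (Ins x))) = Some i"
  shows "\<exists>w. lng (full q k) w \<and> eqv (map lab w) []"
proof -
  \<comment> \<open>Each counter is popped as often as \<open>u\<close> tests it.\<close>
  define v where "v = concat (map (\<lambda>i. replicate (count_list u (Tst i)) (Pop i)) (rev [0..<k]))"
  let ?w = "Inp # map Ins u @ v"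
  let ?W = "replicate n (CA 0, True) @ map lab (map Ins u) @ map lab v"
  have run: "lng (full q k) ?w"
  proof -
    have "lng (pops k) v" unfolding v_def by (rule lng_pops_replicate)
    with u(1) show ?thesis unfolding lng_full by blast
  qed
  have "\<exists>i<k. coord (fst l) = Some i" if "l \<in> set ?W" for l
  proof -
    from that consider "l = (CA 0, True)" | x where "x \<in> set u" "l = lab (Ins x)"
      | i where "i < k" "l = lab (Pop i)"
      by (auto simp: v_def)
    then show ?thesis using idx k_pos by cases auto
  qed
  then have "\<forall>l\<in>set ?W. \<exists>i<k. coord (fst l) = Some i" by blast
  then have "eqv ?W (concat (map (\<lambda>i. proj i ?W) [0..<k]))" by (rule sort_word)
  moreover have "wv (proj i ?W) = 0" if "i < k" for i
  proof -
    have "wv (proj i (replicate n (CA 0, True))) = pow_A i (((\<lambda>_. 0)(0 := int n)) i)"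
      by (cases "i = 0") (simp_all add: pow_A_def del: map_replicate)
    then have "wv (proj i ?W) = wv (replicate (count_list u (Tst i)) (CY i, True)) + pow_A i 0 +
        wv (proj i (map lab v))"
      using exec_proj[OF u(2), of i]
      by (simp only: filter_append map_append sum_list_append add.assoc[symmetric])
    also have "proj i (map lab v) = replicate (count_list u (Tst i)) (CY i, False)"
      unfolding v_def proj_pops using that by simp
    finally show ?thesis by (simp only: pow_A_0 add_0_right wv_replicate_cancel)
  qed
  then have "wv (concat (map (\<lambda>i. proj i ?W) [0..<k])) = 0"
    by (intro wv_concat_zero) simp
  ultimately have "eqv ?W []" unfolding eqv_def by simp
  moreover have "eqv (map lab ?w) ?W"
    using eqv_right[OF input_eqv, of "map lab (map Ins u) @ map lab v"] by simp
  ultimately have "eqv (map lab ?w) []" using eqv_trans[of "map lab ?w" ?W "[]"] by (simp only:)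
  with run show ?thesis by blast
qed

end

text \<open>The relator of an edge \<open>(s, b, t)\<close> moves a token \<open>s\<close> at position \<open>g\<close> to a token \<open>t\<close> at \<open>gb\<close>.\<close>

context normal_submonoid
begin

definition tok :: "letter \<Rightarrow> word \<Rightarrow> 'g" where
  "tok s g = wv g + lv s + - wv g"

definition reach :: "letter \<times> word \<Rightarrow> letter \<times> word \<Rightarrow> bool" where
  "reach x y \<longleftrightarrow> - tok (fst x) (snd x) + tok (fst y) (snd y) \<in> N"

lemma reach_trans [trans]: "reach x y \<Longrightarrow> reach y z \<Longrightarrow> reach x z"
  unfolding reach_def
  using add_mem[of "- tok (fst x) (snd x) + tok (fst y) (snd y)" "- tok (fst y) (snd y) + tok (fst z) (snd z)"]
  by (simp add: group_simps del: add_uminus_conv_diff)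

lemma wv_relator: "wv (relator (s, b, t)) = - lv s + wv b + lv t + - wv b"
  by (simp add: relator_def wv_inv_word group_simps del: add_uminus_conv_diff)

lemma reach_edge:
  assumes "wv (relator (s, b, t)) \<in> N"
  shows "reach (s, g) (t, g @ b)"
  using conj_word[OF assms, of g] unfolding wv_relator reach_def tok_def
  by (simp add: group_simps del: add_uminus_conv_diff)

lemma reach_eqv:
  assumes "eqv g h"
  shows "reach (s, g) (s, h)"
proof -
  let ?G = "wv g" and ?H = "wv h"
  have "- lv s + (- ?G + ?H) + lv s \<in> N" "- ?H + ?G \<in> N"
    using assms conj_mem(2) unfolding eqv_def by blast+
  \<comment> \<open>These two conjugates telescope to the quotient of the tokens at \<open>g\<close>
    and \<open>h\<close>.\<close>
  then have "(?G + (- lv s + (- ?G + ?H) + lv s) + - ?G) + (?G + (- ?H + ?G) + - ?G) \<in> N"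
    by (rule add_mem[OF conj_word conj_word])
  moreover have "(?G + (- lv s + (- ?G + ?H) + lv s) + - ?G) + (?G + (- ?H + ?G) + - ?G) =
      - tok s g + tok s h"
    unfolding tok_def by (simp add: group_simps del: add_uminus_conv_diff)
  ultimately show ?thesis by (simp add: reach_def)
qed

text \<open>A way back from the target of an edge is literally the inverse of its relator.\<close>

lemma reach_inverse:
  assumes "reach (t, b) (s, [])"
  shows "- wv (relator (s, b, t)) \<in> N"
  using assms unfolding reach_def tok_def wv_relator by (simp add: group_simps del: add_uminus_conv_diff)

text \<open>A trivial run leads from \<open>Dst\<close> to \<open>Ust\<close> without moving, since
  the two \<open>LT\<close> cancel. The way back costs two factors \<open>LZ\<close>, which order
  three removes; so all states become mutually reachable at the same position.\<close>

lemma inverse_relators: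
  assumes rel: "\<And>e. e \<in> edges p \<Longrightarrow> wv (relator e) \<in> N"
    and cube: "eqv [(LZ, True), (LZ, True), (LZ, True)] []"
    and run: "lng p w" "eqv (map lab w) []"
    and e: "e \<in> edges p"
  shows "- wv (relator e) \<in> N"
proof -
  let ?T = "[(LT, True)]" and ?T' = "[(LT, False)]" and ?Z = "[(LZ, True)]"
  have edge: "reach (s, g) (t, g @ b)" if "(s, b, t) \<in> edges p" for s b t g
    using rel[OF that] by (rule reach_edge)
  have cong: "reach x (s, h)" if "reach x (s, g)" "eqv g h" for x s g h
    using that(1) reach_eqv[OF that(2)] by (rule reach_trans)
  have Z3: "eqv (g @ ?Z @ ?Z @ ?Z) g" for g
    using eqv_left[OF cube, of g] by simp
  have start: "reach (Dst, g) (Pst [p], g @ ?T)" for g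
    by (rule edge) (simp add: edges_def)
  have stop: "reach (Pst [], g) (Ust, g @ ?T')" for g
    by (rule edge) (simp add: edges_def)
  have inner: "reach (Pst q, g) (Pst q', g @ map lab a)" "reach (Ust, g) (Pst q, g @ ?Z)"
    "reach (Pst q', g) (Dst, g @ inv_word (map lab a) @ ?Z)" if "(q, a, q') \<in> set (edg p [])" for q a q' g
  proof -
    have "{(Pst q, map lab a, Pst q'), (Ust, ?Z, Pst q), (Pst q', inv_word (map lab a) @ ?Z, Dst)} \<subseteq> edges p"
      using that unfolding edges_def by blast
    then show "reach (Pst q, g) (Pst q', g @ map lab a)" "reach (Ust, g) (Pst q, g @ ?Z)"
      "reach (Pst q', g) (Dst, g @ inv_word (map lab a) @ ?Z)"
      by (simp_all add: edge)
  qed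
  have "path E q v q' \<Longrightarrow> E = set (edg p []) \<Longrightarrow> reach (Pst q, g) (Pst q', g @ map lab v)" for E q v q' g
  proof (induction arbitrary: g rule: path.induct)
    case (nil q)
    show ?case by (simp add: reach_eqv eqvI)
  next
    case (step q b q' v q'')
    have "reach (Pst q, g) (Pst q', g @ map lab b)" using inner(1) step.hyps(1) step.prems by blast
    also have "reach \<dots> (Pst q'', (g @ map lab b) @ map lab v)" by (rule step.IH[OF step.prems])
    finally show ?case by simp
  qed
  then have "reach (Pst [p], g) (Pst [], g @ map lab w)" for g
    using run(1) path_iff_lng by blast
  then have prog: "reach (Pst [p], g) (Pst [], g)" for g
    by (rule cong) (use eqv_left[OF run(2), of g] in simp)
  have stop': "reach (Pst [], g @ ?T) (Ust, g)" for g
    by (rule cong[OF stop]) (simp add: eqvI)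
  have DU: "reach (Dst, g) (Ust, g)" for g
    by (rule reach_trans[OF start reach_trans[OF prog stop']])
  have return: "reach (Pst q, g) (Dst, g @ ?Z)" "reach (Ust, g) (Dst, g @ ?Z @ ?Z)"
    if q: "(q, a, q') \<in> set (edg p [])" for q a q' g
  proof -
    have 1: "reach (Pst q, g) (Dst, g @ ?Z)" for g
      by (rule cong[OF reach_trans[OF inner(1)[OF q] inner(3)[OF q]]])
         (simp add: eqvI wv_inv_word group_simps del: add_uminus_conv_diff)
    then show "reach (Pst q, g) (Dst, g @ ?Z)" .
    show "reach (Ust, g) (Dst, g @ ?Z @ ?Z)"
      using reach_trans[OF inner(2)[OF q, of g] 1] by simp
  qed
  obtain b0 q0 where q0: "([p], b0, q0) \<in> set (edg p [])" using edg_start by blast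
  have UD: "reach (Ust, g) (Dst, g @ ?Z @ ?Z)" for g by (rule return(2)[OF q0])
  have shift: "reach (Dst, g) (Dst, g @ ?Z)" for g
  proof -
    have "reach (Dst, g) (Dst, g @ ?Z @ ?Z)" for g
      by (rule reach_trans[OF DU UD])
    \<comment> \<open>Two rounds add four factors \<open>LZ\<close>, which is one modulo
      three.\<close>
    from reach_trans[OF this[of g] this[of "g @ ?Z @ ?Z"]]
    have "reach (Dst, g) (Dst, (g @ ?Z) @ ?Z @ ?Z @ ?Z)" by simp
    from cong[OF this Z3] show ?thesis .
  qed
  have unshift: "reach (Dst, g @ ?Z @ ?Z) (Dst, g)" for g
  proof -
    have "reach (Dst, g @ ?Z @ ?Z) (Dst, g @ ?Z @ ?Z @ ?Z)" using shift[of "g @ ?Z @ ?Z"] by simp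
    from cong[OF this Z3] show ?thesis .
  qed
  have UD0: "reach (Ust, g) (Dst, g)" for g
    by (rule reach_trans[OF UD unshift])
  have enter: "reach (Dst, g) (Pst q, g)" if q: "(q, a, q') \<in> set (edg p [])" for q a q' g
  proof -
    \<comment> \<open>Two shifts prepare for the third \<open>LZ\<close>, which the edge from
      \<open>Ust\<close> to \<open>Pst q\<close> adds.\<close>
    have "reach (Dst, g) (Dst, g @ ?Z)" by (rule shift)
    also have "reach (Dst, g @ ?Z) (Dst, g @ ?Z @ ?Z)" using shift[of "g @ ?Z"] by simp
    also have "reach (Dst, g @ ?Z @ ?Z) (Ust, g @ ?Z @ ?Z)" by (rule DU)
    also have "reach (Ust, g @ ?Z @ ?Z) (Pst q, g @ ?Z @ ?Z @ ?Z)"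
      using inner(2)[OF q, of "g @ ?Z @ ?Z"] by simp
    finally have "reach (Dst, g) (Pst q, g @ ?Z @ ?Z @ ?Z)" .
    from cong[OF this Z3] show ?thesis .
  qed
  obtain s b t where stb: "e = (s, b, t)" by (cases e)
  from e consider
    "s = Dst" "b = ?T" "t = Pst [p]" | "s = Pst []" "b = ?T'" "t = Ust"
    | q a q' where "(q, a, q') \<in> set (edg p [])" "s = Pst q" "b = map lab a" "t = Pst q'"
    | q a q' where "(q, a, q') \<in> set (edg p [])" "s = Ust" "b = ?Z" "t = Pst q"
    | q a q' where "(q, a, q') \<in> set (edg p [])" "s = Pst q'" "b = inv_word (map lab a) @ ?Z" "t = Dst"
    unfolding edges_def stb by blast
  then have "reach (t, b) (s, [])"
  proof cases
    case 1
    have "reach (Pst [p], [] @ ?T) (Dst, [])"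
      by (rule reach_trans[OF prog reach_trans[OF stop' UD0]])
    then show ?thesis unfolding 1 by simp
  next
    case 2
    have "reach (Ust, ?T') (Pst [p], ?T' @ ?T)" by (rule reach_trans[OF UD0 start])
    moreover have "eqv (?T' @ ?T) []" by (simp add: eqvI)
    ultimately have "reach (Ust, ?T') (Pst [p], [])" by (rule cong)
    from reach_trans[OF this prog] show ?thesis unfolding 2 .
  next
    case 3
    have "reach (Pst q', map lab a) (Dst, ?Z)"
      by (rule cong[OF inner(3)[OF 3(1)]]) (simp add: eqvI wv_inv_word group_simps del: add_uminus_conv_diff)
    also have "reach (Dst, ?Z) (Dst, ?Z @ ?Z)" by (rule shift)
    also have "reach (Dst, ?Z @ ?Z) (Dst, [])" using unshift[of "[]"] by simp
    also have "reach (Dst, []) (Pst q, [])" by (rule enter[OF 3(1)])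
    finally show ?thesis unfolding 3 .
  next
    case 4
    have "reach (Pst q, ?Z) (Dst, ?Z @ ?Z)" by (rule return(1)[OF 4(1)])
    also have "reach (Dst, ?Z @ ?Z) (Dst, [])" using unshift[of "[]"] by simp
    also have "reach (Dst, []) (Ust, [])" by (rule DU)
    finally show ?thesis unfolding 4 .
  next
    case 5
    let ?a = "inv_word (map lab a)"
    have "reach (Dst, ?a @ ?Z) (Dst, ?a @ ?Z @ ?Z)" using shift[of "?a @ ?Z"] by simp
    also have "reach (Dst, ?a @ ?Z @ ?Z) (Dst, ?a)" by (rule unshift)
    also have "reach (Dst, ?a) (Pst q, ?a)" by (rule enter[OF 5(1)])
    also have "reach (Pst q, ?a) (Pst q', [])"
      by (rule cong[OF inner(1)[OF 5(1)]]) (simp add: eqvI wv_inv_word)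
    finally show ?thesis unfolding 5 .
  qed
  then show ?thesis unfolding stb by (rule reach_inverse)
qed

end

subsection \<open>Semigroups of rotations\<close>

definition rots :: "(uquat \<times> uquat) list \<Rightarrow> quat \<Rightarrow> quat" where
  "rots gs = rot (sum_list (map fst gs), sum_list (map snd gs))"

lemma rots_append: "rots (gs @ hs) = rots gs \<circ> rots hs"
  by (simp add: rots_def rot_add)

lemma rots_single: "rots [g] = rot g"
  by (simp add: rots_def)

lemma rot_uminus: "rot (- a, - b) \<circ> rot (a, b) = id" "rot (a, b) \<circ> rot (- a, - b) = id"
  by (simp_all add: rot_0 flip: rot_add)

lemma gen_semigroup_rots:
  "f \<in> gen_semigroup (rot ` G) \<Longrightarrow> \<exists>gs. set gs \<subseteq> G \<and> f = rots gs"
proof (induction rule: gen_semigroup.induct)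
  case (gen f)
  then obtain g where "g \<in> G" "f = rots [g]" by (auto simp: rots_single)
  then show ?case by (intro exI[of _ "[g]"]) simp
next
  case (comp f f')
  then obtain gs hs where "set gs \<subseteq> G" "set hs \<subseteq> G" "f = rots gs" "f' = rots hs" by blast
  then show ?case by (intro exI[of _ "gs @ hs"]) (simp add: rots_append)
qed

lemma group_inverse_word:
  assumes "semigroup_is_group (gen_semigroup (rot ` G))" "g \<in> G"
  shows "\<exists>gs. set gs \<subseteq> G \<and> rots (g # gs) = id"
proof -
  obtain e where "group \<lparr>carrier = gen_semigroup (rot ` G), mult = (\<circ>), one = e\<rparr>"
    using assms(1) unfolding semigroup_is_group_def ..
  then interpret M: group "\<lparr>carrier = gen_semigroup (rot ` G), mult = (\<circ>), one = e\<rparr>" .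
  have e: "e \<in> gen_semigroup (rot ` G)" "e \<circ> e = e" using M.one_closed M.l_one[OF M.one_closed] by simp_all
  then obtain hs where hs: "e = rots hs" using gen_semigroup_rots by blast
  obtain a b where ab: "e = rot (a, b)" unfolding hs rots_def by blast
  \<comment> \<open>The neutral element is only known to be idempotent; as an invertible map it must
    be the identity.\<close>
  have "e = rot (- a, - b) \<circ> (e \<circ> e)"
    unfolding ab comp_assoc[symmetric] rot_uminus by simp
  then have "e = id" unfolding e(2) unfolding ab rot_uminus .
  have g: "rot g \<in> gen_semigroup (rot ` G)" using assms(2) by (auto intro: gen_semigroup.gen)
  then obtain f where f: "f \<in> gen_semigroup (rot ` G)" "rot g \<circ> f = e"
    using M.r_inv_ex[of "rot g"] by auto
  obtain gs where "set gs \<subseteq> G" "f = rots gs" using gen_semigroup_rots[OF f(1)] by blast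
  then show ?thesis
    using f(2) \<open>e = id\<close> rots_append[of "[g]" gs] by (intro exI[of _ gs]) (simp add: rots_single)
qed

lemma semigroup_is_groupI:
  assumes "id \<in> gen_semigroup (rot ` G)"
    and inv: "\<And>a b. (a, b) \<in> G \<Longrightarrow> rot (- a, - b) \<in> gen_semigroup (rot ` G)"
  shows "semigroup_is_group (gen_semigroup (rot ` G))"
proof -
  have "\<exists>f'\<in>gen_semigroup (rot ` G). f' \<circ> f = id" if "f \<in> gen_semigroup (rot ` G)" for f
    using that
  proof (induction rule: gen_semigroup.induct)
    case (gen f)
    then obtain a b where "(a, b) \<in> G" "f = rot (a, b)" by auto
    with inv rot_uminus(1) show ?case by metis
  next
    case (comp f g)
    then obtain f' g' where *: "f' \<in> gen_semigroup (rot ` G)" "f' \<circ> f = id"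
      "g' \<in> gen_semigroup (rot ` G)" "g' \<circ> g = id" by blast
    have "(g' \<circ> f') \<circ> (f \<circ> g) = g' \<circ> (f' \<circ> f) \<circ> g" by (simp add: comp_assoc)
    with * have "(g' \<circ> f') \<circ> (f \<circ> g) = id" by simp
    with * show ?case using gen_semigroup.comp by blast
  qed
  then have "group \<lparr>carrier = gen_semigroup (rot ` G), mult = (\<circ>), one = id\<rparr>"
    by (intro groupI) (auto intro: gen_semigroup.comp assms(1) simp: comp_assoc)
  then show ?thesis unfolding semigroup_is_group_def by blast
qed

subsection \<open>The reduction\<close>

text \<open>The letter \<open>CA 0\<close>, whose powers encode the input, becomes the quaternion \<open>A\<close> itself.\<close>

definition num :: "letter \<Rightarrow> nat" where
  "num x = (if x = CA 0 then 0 else Suc (to_nat x))"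

lemma inj_num: "inj num"
  by (auto simp: inj_def num_def split: if_splits)

definition cval :: "word \<Rightarrow> uquat" where
  "cval w = wval (map (map_prod num id) w)"

lemma cval_Cons: "cval (l # w) = cval [l] + cval w"
  by (simp add: cval_def)

text \<open>Values of single letters are the normal forms; \<open>cval_Cons\<close> as a rewrite
  rule would loop on them.\<close>

lemma cval_simps [simp]:
  "cval [] = 0" "cval (l # m # w) = cval [l] + cval (m # w)" "cval (u @ w) = cval u + cval w"
  by (simp_all add: cval_def)

lemma cval_inverse: "cval [(x, \<not> s)] = - cval [(x, s)]" "cval [(x, False)] = - cval [(x, True)]"
  using lval_inverse[of "num x" s] lval_inverse[of "num x" True] by (simp_all add: cval_def)

definition pval :: "word \<times> word \<Rightarrow> uquat \<times> uquat" where
  "pval g = (cval (fst g), cval (snd g))"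

definition alphabet :: "batom rex \<Rightarrow> nat \<Rightarrow> letter set" where
  "alphabet p k = {CH, LZ} \<union> CA ` {..<k} \<union> CY ` {..<k} \<union> (\<Union>e\<in>edges p. fst ` set (relator e))"

text \<open>Both signs and both orders of a commutator are present, so only the edge relators lack
  their inverses.\<close>

definition fixed_gens :: "batom rex \<Rightarrow> nat \<Rightarrow> (word \<times> word) set" where
  "fixed_gens p k = (\<lambda>l. ([l], [l])) ` (alphabet p k \<times> UNIV) \<union>
     {([], commutator x y) | x y i j. x \<in> alphabet p k \<and> y \<in> alphabet p k \<and>
       coord x = Some i \<and> coord y = Some j \<and> i \<noteq> j \<and> i < k \<and> j < k} \<union>
     (\<lambda>s. ([], [(LZ, s), (LZ, s), (LZ, s)])) ` UNIV \<union> (\<lambda>e. ([], relator e)) ` edges p"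

definition input_gens :: "nat \<Rightarrow> (word \<times> word) set" where
  "input_gens n = (\<lambda>s. ([(CH, s)], replicate n (CA 0, s))) ` UNIV"

lemma finite_edges: "finite (edges p)"
  by (auto simp: edges_def)

lemma finite_fixed_gens: "finite (fixed_gens p k)"
proof -
  have "finite (alphabet p k)" by (simp add: alphabet_def finite_edges)
  moreover have "finite {([] :: word, commutator x y) | x y i j. x \<in> alphabet p k \<and> y \<in> alphabet p k \<and>
       coord x = Some i \<and> coord y = Some j \<and> i \<noteq> j \<and> i < k \<and> j < k}"
    by (rule finite_subset[of _ "(\<lambda>(x, y). ([], commutator x y)) ` (alphabet p k \<times> alphabet p k)"])
       (use calculation in auto)
  ultimately show ?thesis by (simp add: fixed_gens_def finite_edges)
qed

lemma relator_in_gens: "e \<in> edges p \<Longrightarrow> ([], relator e) \<in> fixed_gens p k"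
  using imageI[of e "edges p" "\<lambda>e. ([] :: word, relator e)"] unfolding fixed_gens_def Un_iff by argo

lemma commutator_in_gens:
  "x \<in> alphabet p k \<Longrightarrow> y \<in> alphabet p k \<Longrightarrow> coord x = Some i \<Longrightarrow> coord y = Some j \<Longrightarrow>
    i \<noteq> j \<Longrightarrow> i < k \<Longrightarrow> j < k \<Longrightarrow> ([], commutator x y) \<in> fixed_gens p k"
proof -
  assume *: "x \<in> alphabet p k" "y \<in> alphabet p k" "coord x = Some i" "coord y = Some j"
    "i \<noteq> j" "i < k" "j < k"
  have "([] :: word, commutator x y) \<in> {([], commutator x y) | x y i j. x \<in> alphabet p k \<and> y \<in> alphabet p k \<and>
       coord x = Some i \<and> coord y = Some j \<and> i \<noteq> j \<and> i < k \<and> j < k}"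
    unfolding mem_Collect_eq by (rule exI[of _ x], rule exI[of _ y], rule exI[of _ i], rule exI[of _ j]) (simp add: *)
  then show ?thesis unfolding fixed_gens_def Un_iff by argo
qed

lemma gens_cases:
  assumes "g \<in> fixed_gens p k \<union> input_gens n"
  obtains (letter) x s where "x \<in> alphabet p k" "g = ([(x, s)], [(x, s)])"
    | (commutator) x y i j where "g = ([], commutator x y)" "x \<in> alphabet p k" "y \<in> alphabet p k"
        "coord x = Some i" "coord y = Some j" "i \<noteq> j" "i < k" "j < k"
    | (cube) s where "g = ([], [(LZ, s), (LZ, s), (LZ, s)])"
    | (edge) e where "e \<in> edges p" "g = ([], relator e)"
    | (input) s where "g = ([(CH, s)], replicate n (CA 0, s))"
proof -
  from assms consider
    (1) "g \<in> (\<lambda>l. ([l], [l])) ` (alphabet p k \<times> UNIV)"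
    | (2) "g \<in> {([], commutator x y) | x y i j. x \<in> alphabet p k \<and> y \<in> alphabet p k \<and>
       coord x = Some i \<and> coord y = Some j \<and> i \<noteq> j \<and> i < k \<and> j < k}"
    | (3) "g \<in> (\<lambda>s. ([], [(LZ, s), (LZ, s), (LZ, s)])) ` UNIV"
    | (4) "g \<in> (\<lambda>e. ([], relator e)) ` edges p"
    | (5) "g \<in> (\<lambda>s. ([(CH, s)], replicate n (CA 0, s))) ` UNIV"
    unfolding fixed_gens_def input_gens_def Un_iff by argo
  then show thesis
  proof cases
    case 1
    then obtain x s where "x \<in> alphabet p k" "g = ([(x, s)], [(x, s)])" by blast
    then show thesis by (rule letter)
  next
    case 2
    then obtain x y i j where "g = ([], commutator x y)" "x \<in> alphabet p k" "y \<in> alphabet p k"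
      "coord x = Some i" "coord y = Some j" "i \<noteq> j" "i < k" "j < k" by blast
    then show thesis by (rule commutator)
  next
    case 3
    then obtain s where "g = ([], [(LZ, s), (LZ, s), (LZ, s)])" by (rule imageE)
    then show thesis by (rule cube)
  next
    case 4
    then obtain e where "g = ([], relator e)" "e \<in> edges p" by (rule imageE)
    then show thesis by (intro edge)
  next
    case 5
    then obtain s where "g = ([(CH, s)], replicate n (CA 0, s))" by (rule imageE)
    then show thesis by (rule input)
  qed
qed

lemma gens_flat:
  assumes "g \<in> fixed_gens p k \<union> input_gens n"
  shows "flat n g \<or> (\<exists>e\<in>edges p. g = ([], relator e))"
  using assms
proof (cases rule: gens_cases)
  case (commutator x y i j)
  then show ?thesis using flat_commutator[of x i y j n] by simp
next
  case (edge e)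
  then show ?thesis by blast
qed (simp_all add: flat_refl flat_cube flat_input)

text \<open>Inverting the relator of the edge from \<open>Pst []\<close> to \<open>Ust\<close>
  yields a cycle through that edge at every valid configuration, against
  \<open>no_cycle\<close>.\<close>

lemma group_imp_trivial_run:
  assumes "semigroup_is_group (gen_semigroup (rot ` pval ` (fixed_gens (full q k) k \<union> input_gens n)))"
  shows "sem q ((\<lambda>_. 0)(0 := int n)) (\<lambda>_. 0)"
proof (rule ccontr)
  let ?p = "full q k" and ?W = "fixed_gens (full q k) k \<union> input_gens n"
  let ?e = "(Pst [], [(LT, False)], Ust)"
  assume no: "\<not> sem q ((\<lambda>_. 0)(0 := int n)) (\<lambda>_. 0)"
  have "brun n w base \<noteq> base" if "lng ?p w" for w
    using trivial_run_sem[OF that] no by blast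
  from no_cycle[OF this] obtain \<omega> where \<omega>: "valid \<omega>"
    "((Ust, mv n [(LT, False)] \<omega>), (Pst [], \<omega>)) \<notin> (steps n ?p)\<^sup>*" by blast
  have e: "?e \<in> edges ?p" by (simp add: edges_def)
  then have "([], relator ?e) \<in> ?W" by (intro UnI1 relator_in_gens)
  then have "pval ([], relator ?e) \<in> pval ` ?W" by (rule imageI)
  from group_inverse_word[OF assms this] obtain gs where
    gs: "set gs \<subseteq> pval ` ?W" "rots (pval ([], relator ?e) # gs) = id" by blast
  have "gs \<in> lists (pval ` ?W)" using gs(1) by (simp only: in_lists_conv_set subset_eq)
  then obtain ws where ws': "gs = map pval ws" "ws \<in> lists ?W" unfolding lists_image by (rule imageE)
  from ws' have ws: "set ws \<subseteq> ?W" "gs = map pval ws" by (simp_all only: in_lists_conv_set subset_eq)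
  have sums: "sum_list (map fst gs) = cval (concat (map fst ws))"
    "sum_list (map snd gs) = cval (concat (map snd ws))"
    unfolding ws(2) by (induction ws) (simp_all add: pval_def)
  have "rot (cval (concat (map fst ws)), cval (relator ?e @ concat (map snd ws))) = id"
    using gs(2) sums by (simp add: rots_def pval_def)
  from rot_eq_idD[OF this] have *: "cval (concat (map fst ws)) \<in> {0, uneg}"
    "cval (relator ?e @ concat (map snd ws)) \<in> {0, uneg}" by auto
  have "\<forall>g\<in>set ws. flat n g \<or> (\<exists>e\<in>edges ?p. g = ([], relator e))"
    using ws(1) by (intro ballI gens_flat) (rule subsetD)
  from identity_cycle[OF inj_num this e *[unfolded cval_def] \<omega>(1)] \<omega>(2) show False
    by (rule notE[rotated])
qed

lemma trivial_run_imp_group: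
  assumes q: "lng q u" "exec u ((\<lambda>_. 0)(0 := int n)) = Some (\<lambda>_. 0)" and k: "0 < k"
    and idx: "\<forall>x\<in>set u. \<exists>i<k. coord (fst (lab (Ins x))) = Some i"
  shows "semigroup_is_group (gen_semigroup (rot ` pval ` (fixed_gens (full q k) k \<union> input_gens n)))"
proof -
  let ?p = "full q k" and ?W = "fixed_gens (full q k) k \<union> input_gens n"
  let ?A = "alphabet (full q k) k"
  define S where "S = gen_semigroup (rot ` pval ` ?W)"
  have S: "rot (cval u, cval w) \<in> S" if "(u, w) \<in> ?W" for u w
    unfolding S_def using imageI[OF imageI[OF that, of pval], of rot]
    by (intro gen_semigroup.gen) (simp add: pval_def)
  have S_add: "rot (a + a', b + b') \<in> S" if "rot (a, b) \<in> S" "rot (a', b') \<in> S" for a a' b b'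
    using that unfolding rot_add S_def by (rule gen_semigroup.comp)
  have in_letter: "rot (cval [(x, s)], cval [(x, s)]) \<in> S" if "x \<in> ?A" for x s
    by (rule S) (use that in \<open>auto simp: fixed_gens_def\<close>)
  have id: "rot (0, 0) \<in> S"
    using S_add[OF in_letter[of LZ True] in_letter[of LZ False]]
    by (simp add: alphabet_def cval_inverse(2))
  \<comment> \<open>The default 0 keeps conjugation by letters outside the alphabet harmless: the
    locale asks for all letters.\<close>
  define lv where "lv x = (if x \<in> ?A then cval [(x, True)] else 0)" for x
  define N where "N = {v. rot (0, v) \<in> S}"
  have lv_S: "rot (lv x, lv x) \<in> S" "rot (- lv x, - lv x) \<in> S" for x
    using in_letter[of x True] in_letter[of x False] id by (auto simp: lv_def cval_inverse(2))
  interpret normal_submonoid lv N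
  proof
    show "0 \<in> N" using id by (simp add: N_def)
    show "a + b \<in> N" if "a \<in> N" "b \<in> N" for a b
      using S_add[of 0 a 0 b] that by (simp add: N_def)
    fix a x assume "a \<in> N"
    then have a: "rot (0, a) \<in> S" by (simp add: N_def)
    show "lv x + a + - lv x \<in> N"
      using S_add[OF S_add[OF lv_S(1)[of x] a] lv_S(2)[of x]] by (simp add: N_def)
    show "- lv x + a + lv x \<in> N"
      using S_add[OF S_add[OF lv_S(2)[of x] a] lv_S(1)[of x]] by (simp add: N_def)
  qed
  have wv_eq: "wv w = cval w" if "fst ` set w \<subseteq> ?A" for w
    using that
  proof (induction w)
    case (Cons l w)
    obtain x s where l: "l = (x, s)" by (cases l)
    have "sv l = cval [l]"
      using Cons.prems by (cases s) (simp_all add: l lv_def cval_inverse(2))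
    moreover have "wv w = cval w" using Cons by simp
    ultimately show ?case by (simp only: list.map sum_list.Cons cval_Cons[of l w])
  qed simp
  have gen_N: "wv w \<in> N" if "([], w) \<in> ?W" "fst ` set w \<subseteq> ?A" for w
    using S[OF that(1)] by (simp add: N_def wv_eq[OF that(2)])
  have coords: "x \<in> ?A" if "coord x = Some i" "i < k" for x i
    using that by (cases x) (auto simp: alphabet_def)
  have relators: "fst ` set (relator e) \<subseteq> ?A" if "e \<in> edges ?p" for e
    using that unfolding alphabet_def by blast
  have CH: "CH \<in> ?A" and LZ: "LZ \<in> ?A" and CA0: "CA 0 \<in> ?A"
    using k by (auto simp: alphabet_def)
  let ?R = "\<lambda>s. replicate n (CA 0, s)"
  have R_minus: "cval (?R False) = - cval (?R True)"
  proof (induction n)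
    case (Suc n)
    have "replicate (Suc n) (CA 0, True) = replicate n (CA 0, True) @ [(CA 0, True)]"
      by (simp only: replicate_append_same replicate_Suc)
    then have "cval (replicate (Suc n) (CA 0, True)) = cval (replicate n (CA 0, True)) + cval [(CA 0, True)]"
      by (simp only: cval_simps(3))
    moreover have "cval (replicate (Suc n) (CA 0, False)) = cval [(CA 0, False)] + cval (replicate n (CA 0, False))"
      by (simp only: replicate_Suc cval_Cons[of _ "replicate n _"])
    ultimately show ?case by (simp only: Suc cval_inverse(2) minus_add)
  qed simp
  have in_S: "rot (cval [(CH, s)], cval (?R s)) \<in> S" for s
    by (rule S) (auto simp: input_gens_def)
  interpret counter_monoid lv N k n
  proof
    fix x y i j
    assume *: "coord x = Some i" "coord y = Some j" "i \<noteq> j" "i < k" "j < k"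
    then have "x \<in> ?A" "y \<in> ?A" using coords by blast+
    with * show "wv (commutator x y) \<in> N"
    proof (intro gen_N)
      show "([], commutator x y) \<in> ?W"
        using \<open>x \<in> ?A\<close> \<open>y \<in> ?A\<close> * by (intro UnI1 commutator_in_gens)
    qed (simp add: commutator_def)
  next
    have "wv [(CH, True)] = cval [(CH, True)]" by (rule wv_eq) (use CH in simp)
    moreover have "wv (?R True) = cval (?R True)"
      by (rule wv_eq) (use CA0 in \<open>auto simp: set_replicate_conv_if\<close>)
    \<comment> \<open>The inverse of \<open>(CH, CH)\<close> times the input generator has trivial
      first component.\<close>
    moreover have "- cval [(CH, True)] + cval (?R True) \<in> N"
      using S_add[OF in_letter[OF CH, of False] in_S[of True]] by (simp add: N_def cval_inverse(2))
    moreover have "- cval (?R True) + cval [(CH, True)] \<in> N"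
      using S_add[OF in_S[of False] in_letter[OF CH, of True]]
      by (simp add: N_def cval_inverse(2) R_minus)
    ultimately show "eqv [(CH, True)] (?R True)" unfolding eqv_def by (simp only: simp_thms)
  qed (rule k)
  obtain w where w: "lng ?p w" "eqv (map lab w) []" using trivial_run[OF q idx] by blast
  have cube_eqv: "eqv [(LZ, True), (LZ, True), (LZ, True)] []"
  proof -
    have "wv [(LZ, s), (LZ, s), (LZ, s)] \<in> N" for s
      by (rule gen_N) (use LZ in \<open>auto simp: fixed_gens_def\<close>)
    from this[of True] this[of False] show ?thesis
      by (simp add: eqv_def group_simps del: add_uminus_conv_diff)
  qed
  have rel: "wv (relator e) \<in> N" if "e \<in> edges ?p" for e
    by (rule gen_N) (use that relators relator_in_gens in blast)+
  show ?thesis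
  proof (rule semigroup_is_groupI)
    show "id \<in> gen_semigroup (rot ` pval ` ?W)" using id unfolding rot_0 S_def .
    fix a b assume "(a, b) \<in> pval ` ?W"
    then obtain g where g: "g \<in> ?W" "(a, b) = pval g" by blast
    from g(1) have "rot (- a, - b) \<in> S"
    proof (cases rule: gens_cases)
      case (letter x s)
      then show ?thesis using g(2) in_letter[OF letter(1), of "\<not> s"] by (simp add: pval_def cval_inverse(1))
    next
      case (commutator x y i j)
      have "([], commutator y x) \<in> ?W"
        by (intro UnI1 commutator_in_gens[OF commutator(3,2,5,4)]) (use commutator(6-8) in simp_all)
      moreover have "cval (commutator y x) = - cval (commutator x y)"
        by (simp add: commutator_def cval_inverse(2) group_simps del: add_uminus_conv_diff)
      ultimately show ?thesis using g(2) S[of "[]" "commutator y x"] by (simp add: commutator(1) pval_def)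
    next
      case (cube s)
      have "([], [(LZ, \<not> s), (LZ, \<not> s), (LZ, \<not> s)]) \<in> ?W" by (simp add: fixed_gens_def)
      from S[OF this] have "rot (0, - cval [(LZ, s)] + (- cval [(LZ, s)] + - cval [(LZ, s)])) \<in> S"
        by (simp add: cval_inverse(1) del: add_uminus_conv_diff)
      then show ?thesis using g(2)
        by (simp add: cube pval_def group_simps del: add_uminus_conv_diff)
    next
      case (edge e)
      have "- wv (relator e) \<in> N" by (rule inverse_relators[OF rel cube_eqv w edge(1)])
      then show ?thesis using g(2) by (simp add: edge(2) pval_def N_def wv_eq[OF relators[OF edge(1)]])
    next
      case (input s)
      have "cval (?R (\<not> s)) = - cval (?R s)" using R_minus by (cases s) simp_all
      then show ?thesis using g(2) in_S[of "\<not> s"] by (simp add: input pval_def cval_inverse(1))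
    qed
    then show "rot (- a, - b) \<in> gen_semigroup (rot ` pval ` ?W)" unfolding S_def .
  qed
qed

lemma finite_set_rex: "finite (set_rex p)"
  by (induction p) auto

lemma lng_set_rex: "lng p w \<Longrightarrow> set w \<subseteq> set_rex p"
  by (induction rule: lng.induct) auto

lemma counter_bound: "\<exists>k>0. \<forall>u. lng q u \<longrightarrow> (\<forall>x\<in>set u. \<exists>i<k. coord (fst (lab (Ins x))) = Some i)"
proof -
  have c: "\<exists>i. coord (fst (lab (Ins x))) = Some i" for x by (cases x) auto
  define f where "f x = the (coord (fst (lab (Ins x))))" for x
  have f: "coord (fst (lab (Ins x))) = Some (f x)" for x using c[of x] by (auto simp: f_def)
  have "f x < Suc (Max (f ` set_rex q))" if "x \<in> set_rex q" for x
    using that finite_set_rex by (simp add: less_Suc_eq_le)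
  then show ?thesis using f lng_set_rex
    by (intro exI[of _ "Suc (Max (f ` set_rex q))"]) blast
qed

lemma group_iff_halting:
  "\<exists>q k. \<forall>n. semigroup_is_group (gen_semigroup (rot ` pval ` (fixed_gens (full q k) k \<union> input_gens n)))
     \<longleftrightarrow> (\<exists>y. eval_rf f [n] y)"
proof -
  obtain q where q: "\<And>n. (\<exists>y. eval_rf f [n] y) \<longleftrightarrow> sem q ((\<lambda>_. 0)(0 := int n)) (\<lambda>_. 0)"
    using halting_program by blast
  obtain k where k: "k > 0"
    "\<And>u. lng q u \<Longrightarrow> \<forall>x\<in>set u. \<exists>i<k. coord (fst (lab (Ins x))) = Some i"
    using counter_bound by blast
  have "semigroup_is_group (gen_semigroup (rot ` pval ` (fixed_gens (full q k) k \<union> input_gens n)))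
     \<longleftrightarrow> sem q ((\<lambda>_. 0)(0 := int n)) (\<lambda>_. 0)" (is "?G \<longleftrightarrow> ?S") for n
  proof
    assume ?S
    then obtain u where u: "lng q u" "exec u ((\<lambda>_. 0)(0 := int n)) = Some (\<lambda>_. 0)"
      unfolding sem_def by blast
    from trivial_run_imp_group[OF u k(1) k(2)[OF u(1)]] show ?G .
  qed (rule group_imp_trivial_run)
  then show ?thesis unfolding q by blast
qed

subsection \<open>Computing the code of an instance\<close>

text \<open>Real and imaginary part of \<open>(3 + 4i) ^ n\<close>.\<close>

fun re im :: "nat \<Rightarrow> int" where
  "re 0 = 1" | "im 0 = 0"
| "re (Suc n) = 3 * re n - 4 * im n" | "im (Suc n) = 3 * im n + 4 * re n"

lemma re_im_norm: "(re n)\<^sup>2 + (im n)\<^sup>2 = (5 ^ n)\<^sup>2"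
proof (induction n)
  case (Suc n)
  have "(re (Suc n))\<^sup>2 + (im (Suc n))\<^sup>2 = 25 * ((re n)\<^sup>2 + (im n)\<^sup>2)"
    by (simp add: power2_eq_square algebra_simps)
  also have "\<dots> = 25 * (5 ^ n)\<^sup>2" by (simp only: Suc)
  also have "\<dots> = (5 ^ Suc n)\<^sup>2" by (simp add: power2_eq_square)
  finally show ?case .
qed simp

lemma re_im_bound: "\<bar>re n\<bar> \<le> 5 ^ n" "\<bar>im n\<bar> \<le> 5 ^ n"
proof -
  have "(re n)\<^sup>2 \<le> (5 ^ n)\<^sup>2" "(im n)\<^sup>2 \<le> (5 ^ n)\<^sup>2"
    using re_im_norm[of n] zero_le_power2[of "re n"] zero_le_power2[of "im n"] by linarith+
  then show "\<bar>re n\<bar> \<le> 5 ^ n" "\<bar>im n\<bar> \<le> 5 ^ n"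
    by (simp_all add: abs_le_square_iff[symmetric])
qed

text \<open>Modulo 5 the number 3 + 4i is idempotent: its square is -7 + 24i.\<close>

lemma re_im_mod: "re (Suc n) mod 5 = 3 \<and> im (Suc n) mod 5 = 4"
proof -
  have "\<exists>a b. re (Suc n) = 3 + 5 * a \<and> im (Suc n) = 4 + 5 * b"
  proof (induction n)
    case 0
    show ?case by (intro exI[of _ 0]) simp
  next
    case (Suc n)
    then obtain a b where "re (Suc n) = 3 + 5 * a" "im (Suc n) = 4 + 5 * b" by blast
    then have "re (Suc (Suc n)) = 3 + 5 * (3 * a - 4 * b - 2)"
      "im (Suc (Suc n)) = 4 + 5 * (3 * b + 4 * a + 4)"
      unfolding re.simps(2)[of "Suc n"] im.simps(2)[of "Suc n"] by (simp_all add: algebra_simps)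
    then show ?case by blast
  qed
  then show ?thesis by (elim exE conjE) (simp only: mod_mult_self2, simp)
qed

text \<open>The coordinates are in lowest terms, so their codes can be computed without cancelling
  fractions.\<close>

lemma re_im_coprime: "coprime (re n) (5 ^ n)" "coprime (im n) (5 ^ n)"
proof -
  have "coprime x (5 ^ n)" if "x mod 5 = 3 \<or> x mod 5 = 4" for x :: int
  proof -
    have "gcd x 5 = gcd 5 (x mod 5)" by (rule gcd_red_int)
    also have "\<dots> = 1" using that by (auto simp: gcd_non_0_int)
    finally have "coprime x 5" by (simp add: coprime_iff_gcd_eq_1)
    then show ?thesis by simp
  qed
  then show "coprime (re n) (5 ^ n)" "coprime (im n) (5 ^ n)"
    using re_im_mod by (cases n; simp only: re.simps(1) im.simps(1) power_0; simp)+
qed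

lemma Rep_power:
  "Rep_uquat (cval (replicate n (CA 0, s))) = (of_int (re n) / 5 ^ n, of_int (sg s * im n) / 5 ^ n, 0, 0)"
proof -
  have 1: "cval (replicate n (CA 0, s)) = val2 (replicate n (True, s))"
    by (induction n) (simp_all add: cval_def num_def lval_def del: map_replicate)
  have 2: "nval2 (replicate n (True, s)) = (re n, sg s * im n, 0, 0)"
    by (induction n) (simp_all add: qm_def)
  show ?thesis unfolding 1 Rep_val2 2 by simp
qed

lemma rat_code_quotient:
  assumes "coprime a (5 ^ n)"
  shows "rat_code (of_int a / 5 ^ n) = prod_encode (int_encode a, 5 ^ n)"
proof -
  have "of_int a / 5 ^ n = Fract a (5 ^ n)" by (simp add: Fract_of_int_quotient)
  then have "quotient_of (of_int a / 5 ^ n) = (a, 5 ^ n)"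
    using assms by (simp add: quotient_of_Fract normalize_stable)
  then show ?thesis by (simp add: rat_code_def nat_power_eq)
qed

definition power_code :: "bool \<Rightarrow> nat \<Rightarrow> nat" where
  "power_code s n = list_encode [prod_encode (int_encode (re n), 5 ^ n),
     prod_encode (int_encode (sg s * im n), 5 ^ n), rat_code 0, rat_code 0]"

lemma rquat_code_power: "rquat_code (Rep_uquat (cval (replicate n (CA 0, s)))) = power_code s n"
proof -
  have "coprime (sg s * im n) (5 ^ n)" using re_im_coprime(2) by (cases s) simp_all
  from rat_code_quotient[OF this] show ?thesis
    unfolding rquat_code_def Rep_power power_code_def prod.case
    by (simp only: rat_code_quotient[OF re_im_coprime(1)])
qed

text \<open>Subtraction on the right is truncated, so at most one summand is nonzero.\<close>

lemma int_encode_diff: "int_encode (int x - int y) = 2 * (x - y) + (2 * (y - x) - 1)"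
proof (cases "y \<le> x")
  case True
  then show ?thesis by (simp add: int_encode_def sum_encode_def nat_diff_distrib' flip: of_nat_diff)
next
  case False
  then have "nat (- (int x - int y) - 1) = y - x - 1" by simp
  then show ?thesis using False by (simp add: int_encode_def sum_encode_def)
qed

lemma total_rec_int_encode:
  "total_rec n f \<Longrightarrow> total_rec n g \<Longrightarrow> total_rec n (\<lambda>xs. int_encode (int (f xs) - int (g xs)))"
  unfolding int_encode_diff
  by (intro total_rec_add total_rec_mult total_rec_minus total_rec_const)

text \<open>Real and imaginary parts are shifted by \<open>5 ^ n\<close> to make them natural numbers.\<close>

definition re_nat :: "nat \<Rightarrow> nat" where "re_nat n = nat (re n + 5 ^ n)"
definition im_nat :: "nat \<Rightarrow> nat" where "im_nat n = nat (im n + 5 ^ n)"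

lemma int_re_im_nat: "int (re_nat n) = re n + 5 ^ n" "int (im_nat n) = im n + 5 ^ n"
  using re_im_bound[of n] by (simp_all add: re_nat_def im_nat_def)

text \<open>The shifts contribute 6 = 5 - 3 + 4 and -2 = 5 - 4 - 3 times \<open>5 ^ n\<close>.
  Nothing is truncated, because the shifted values are nonnegative.\<close>

lemma re_im_nat_Suc:
  "re_nat (Suc n) = 3 * re_nat n + 6 * 5 ^ n - 4 * im_nat n"
  "im_nat (Suc n) = 4 * re_nat n + 3 * im_nat n - 2 * 5 ^ n"
proof -
  have "int (re_nat (Suc n)) = 3 * int (re_nat n) + 6 * 5 ^ n - 4 * int (im_nat n)"
    "int (im_nat (Suc n)) = 4 * int (re_nat n) + 3 * int (im_nat n) - 2 * 5 ^ n"
    unfolding int_re_im_nat by simp_all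
  then have "int (re_nat (Suc n)) = int (3 * re_nat n + 6 * 5 ^ n) - int (4 * im_nat n)"
    "int (im_nat (Suc n)) = int (4 * re_nat n + 3 * im_nat n) - int (2 * 5 ^ n)"
    by simp_all
  then show "re_nat (Suc n) = 3 * re_nat n + 6 * 5 ^ n - 4 * im_nat n"
    "im_nat (Suc n) = 4 * re_nat n + 3 * im_nat n - 2 * 5 ^ n"
    by linarith+
qed

text \<open>Pairing turns the simultaneous recursion into a single one.\<close>

lemma rec1_re_im_nat: "rec1 (\<lambda>n. prod_encode (re_nat n, im_nat n))"
proof (rule rec1_primrec)
  show "rec2 (\<lambda>n m. prod_encode (3 * fst (prod_decode m) + 6 * 5 ^ n - 4 * snd (prod_decode m),
      4 * fst (prod_decode m) + 3 * snd (prod_decode m) - 2 * 5 ^ n))"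
    by (intro total_rec_prod_encode total_rec_minus total_rec_add total_rec_mult total_rec_const
        total_rec_power total_rec_fst total_rec_snd total_rec_proj) simp_all
  show "prod_encode (re_nat (Suc n), im_nat (Suc n)) =
      prod_encode (3 * fst (prod_decode (prod_encode (re_nat n, im_nat n))) + 6 * 5 ^ n
        - 4 * snd (prod_decode (prod_encode (re_nat n, im_nat n))),
      4 * fst (prod_decode (prod_encode (re_nat n, im_nat n)))
        + 3 * snd (prod_decode (prod_encode (re_nat n, im_nat n))) - 2 * 5 ^ n)" for n
    by (simp only: re_im_nat_Suc prod_encode_inverse fst_conv snd_conv)
qed

lemma rec1_re_nat: "rec1 re_nat" and rec1_im_nat: "rec1 im_nat"
  using total_rec_fst[OF rec1_re_im_nat] total_rec_snd[OF rec1_re_im_nat] by simp_all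

lemma rec1_power_code: "rec1 (power_code s)"
proof -
  have "re n = int (re_nat n) - int (5 ^ n)"
    "sg s * im n = (if s then int (im_nat n) - int (5 ^ n) else int (5 ^ n) - int (im_nat n))" for n
    by (simp_all add: int_re_im_nat)
  then have eq: "power_code s n = Suc (prod_encode (prod_encode (int_encode (int (re_nat n) - int (5 ^ n)), 5 ^ n),
      Suc (prod_encode (prod_encode (if s then int_encode (int (im_nat n) - int (5 ^ n))
          else int_encode (int (5 ^ n) - int (im_nat n)), 5 ^ n),
        list_encode [rat_code 0, rat_code 0]))))" for n
    by (simp add: power_code_def)
  show ?thesis unfolding eq
    by (cases s; simp only: if_True if_False;
      intro total_rec_Suc total_rec_prod_encode total_rec_int_encode total_rec_power
        total_rec_const rec1_re_nat rec1_im_nat total_rec_proj; simp)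
qed

definition inst :: "(uquat \<times> uquat) list \<Rightarrow> (rquat \<times> rquat) list" where
  "inst L = map (map_prod Rep_uquat Rep_uquat) L"

lemma inst_valid: "inst L \<in> valid_instances"
proof -
  have "unit_rquat (fst x) \<and> unit_rquat (snd x)" if "x \<in> set (inst L)" for x
    using that by (auto simp: inst_def unit_rquat_Rep)
  then show ?thesis unfolding valid_instances_def by fastforce
qed

lemma inst_group: "rotation_semigroup_is_group (inst L) \<longleftrightarrow> semigroup_is_group (gen_semigroup (rot ` set L))"
proof -
  have "(\<lambda>(a, b). rotation a b) ` set (inst L) = rot ` set L"
    unfolding inst_def set_map image_image by (intro image_cong) (auto simp: rot_def)
  then show ?thesis by (simp add: rotation_semigroup_is_group_def)
qed

definition input_code :: "bool \<Rightarrow> nat \<Rightarrow> nat" where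
  "input_code s n = prod_encode (rquat_code (Rep_uquat (cval [(CH, s)])), power_code s n)"

text \<open>\<open>list_encode\<close> codes a cons as \<open>Suc\<close> of a pair, so the code of
  a list extended in front is computed from its code \<open>n\<close> alone, without
  decoding.\<close>

definition diagonal_code :: "nat \<Rightarrow> nat" where
  "diagonal_code n = Suc (prod_encode (input_code True n, Suc (prod_encode (input_code False n, n))))"

lemma rec1_diagonal_code: "rec1 diagonal_code"
  unfolding diagonal_code_def input_code_def
  by (intro total_rec_Suc total_rec_prod_encode total_rec_const rec1_power_code total_rec_proj) simp

lemma instance_code_inputs:
  "instance_code (inst (pval ([(CH, True)], replicate n (CA 0, True)) #
      pval ([(CH, False)], replicate n (CA 0, False)) # L)) =
    Suc (prod_encode (input_code True n, Suc (prod_encode (input_code False n, instance_code (inst L)))))"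
  unfolding instance_code_def inst_def list.map list_encode.simps pval_def fst_conv snd_conv
    map_prod_simp prod.case rquat_code_power input_code_def ..

subsection \<open>Diagonalisation\<close>

lemma set_inputs:
  "set (pval ([(CH, True)], replicate n (CA 0, True)) # pval ([(CH, False)], replicate n (CA 0, False)) # L) =
    pval ` input_gens n \<union> set L"
  by (auto simp: input_gens_def UNIV_bool)

lemma eval_Cn1_iff:
  assumes "length xs = n" "\<And>x. eval_rf g xs x \<longleftrightarrow> x = v"
  shows "eval_rf (Cn n f [g]) xs z \<longleftrightarrow> eval_rf f [v] z"
proof
  assume "eval_rf (Cn n f [g]) xs z"
  then obtain ys where "list_all2 (\<lambda>g y. eval_rf g xs y) [g] ys" "eval_rf f ys z" by (rule eval_Cn)
  then show "eval_rf f [v] z" unfolding list_all2_Cons1 by (auto simp: assms(2))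
next
  assume "eval_rf f [v] z"
  then show "eval_rf (Cn n f [g]) xs z"
    by (intro eval_rf.comp[where ys = "[v]"]) (simp_all add: assms)
qed

text \<open>If \<open>d\<close> decided the problem, then the recursive function that halts on the code \<open>n\<close> of a list of
  generators if \<open>d\<close> rejects that list extended by the input generators for \<open>n\<close> would be represented
  by some list, which can be applied to its own code.\<close>

theorem mainTheorem8:
  shows "\<not> decidable_problem valid_instances instance_code rotation_semigroup_is_group"
proof
  assume "decidable_problem valid_instances instance_code rotation_semigroup_is_group"
  then obtain d where d: "\<And>x. x \<in> valid_instances \<Longrightarrow>
      eval_rf d [instance_code x] (if rotation_semigroup_is_group x then 1 else 0)"
    unfolding decidable_problem_def by blast
  obtain t where t: "\<And>n. eval_rf t [n] (diagonal_code n)"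
    using total_rec_1D[OF rec1_diagonal_code] by auto
  \<comment> \<open>The search variable is ignored, so \<open>D\<close> halts, with value 0, exactly
    if \<open>d\<close> answers 0 on \<open>diagonal_code n\<close>.\<close>
  define D where "D = Mn 1 (Cn 2 d [Cn 2 t [Id 2 1]])"
  have inner: "eval_rf (Cn 2 d [Cn 2 t [Id 2 1]]) [y, n] z \<longleftrightarrow> eval_rf d [diagonal_code n] z" for y n z
  proof -
    have "eval_rf (Id 2 1) [y, n] n" using eval_rf.proj[of "[y, n]" 2 1] by simp
    then have "eval_rf (Id 2 1) [y, n] x \<longleftrightarrow> x = n" for x
      using eval_rf_deterministic[of "Id 2 1" "[y, n]" n x] by blast
    then have "eval_rf (Cn 2 t [Id 2 1]) [y, n] x \<longleftrightarrow> eval_rf t [n] x" for x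
      by (intro eval_Cn1_iff) simp_all
    moreover have "eval_rf t [n] x \<longleftrightarrow> x = diagonal_code n" for x
      using t[of n] eval_rf_deterministic[OF t[of n], of x] by metis
    ultimately have "eval_rf (Cn 2 t [Id 2 1]) [y, n] x \<longleftrightarrow> x = diagonal_code n" for x
      by (simp only:)
    then show ?thesis by (intro eval_Cn1_iff) simp_all
  qed
  have D: "(\<exists>y. eval_rf D [n] y) \<longleftrightarrow> eval_rf d [diagonal_code n] 0" for n
  proof -
    have "length [n] = 1" by simp
    from eval_Mn_iff[OF this, of "Cn 2 d [Cn 2 t [Id 2 1]]", unfolded inner]
    have *: "eval_rf D [n] y \<longleftrightarrow> eval_rf d [diagonal_code n] 0 \<and>
        (\<forall>u<y. \<exists>v. eval_rf d [diagonal_code n] v \<and> v \<noteq> 0)" for y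
      unfolding D_def .
    from *[of 0] * show ?thesis by (metis not_less_zero)
  qed
  obtain q k where qk: "\<forall>n. semigroup_is_group (gen_semigroup
      (rot ` pval ` (fixed_gens (full q k) k \<union> input_gens n))) \<longleftrightarrow> (\<exists>y. eval_rf D [n] y)"
    using group_iff_halting[of D] by (elim exE)
  have "\<exists>L. set L = pval ` fixed_gens (full q k) k"
    by (rule finite_list[OF finite_imageI[OF finite_fixed_gens]])
  then obtain L where L: "set L = pval ` fixed_gens (full q k) k" ..
  define n where "n = instance_code (inst L)"
  define M where "M = inst (pval ([(CH, True)], replicate n (CA 0, True)) #
      pval ([(CH, False)], replicate n (CA 0, False)) # L)"
  have code: "instance_code M = diagonal_code n"
    unfolding M_def instance_code_inputs diagonal_code_def n_def ..
  have "rotation_semigroup_is_group M \<longleftrightarrow> (\<exists>y. eval_rf D [n] y)"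
    unfolding M_def inst_group set_inputs L image_Un[symmetric] Un_commute[of "input_gens n"] by (rule qk[rule_format])
  also have "\<dots> \<longleftrightarrow> eval_rf d [instance_code M] 0" unfolding D code ..
  also have "\<dots> \<longleftrightarrow> \<not> rotation_semigroup_is_group M"
  proof -
    have "M \<in> valid_instances" unfolding M_def by (rule inst_valid)
    from d[OF this] show ?thesis
      using eval_rf_deterministic[of d "[instance_code M]" 0 1] by (cases "rotation_semigroup_is_group M") auto
  qed
  finally show False by simp
qed

end
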